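(* The space $(SL(2),\delta)$ is geodesic orbit, i.e., every geodesic in $(SL(2),\delta)$ is an orbit of some 1-parameter isometry subgroup of the space $(SL(2),\delta)$.
   Context: Let $e_{ij}$ be the $2\times2$ matrix units, $p_1=\frac12(e_{11}-e_{22})$, $p_2=\frac12(e_{12}+e_{21})$. $\delta$ is the left-invariant sub-Riemannian metric (Carnot–Carathéodory distance) on $SL(2)$ (real $2\times2$ matrices with determinant 1, unit $e$) defined by the left-invariant distribution $D$ with $D(e)=\operatorname{Lin}(p_1,p_2)$ and the scalar product on $D(e)$ with orthonormal basis $p_1,p_2$. A geodesic is a curve, defined on all of $\mathbb{R}$ and parametrized by arclength, which is locally a shortest arc (length equal to the distance between endpoints). *)

theory Defs
  imports "HOL-Analysis.Analysis"
begin

section \<open>Curves, isometries and geodesics in a metric space\<close>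

text \<open>
  A metric space is given by a carrier \<open>M\<close> and a distance function \<open>d\<close>, of which only the values
  on \<open>M\<close> matter. The maps below are total functions; only their restrictions to \<open>M\<close> are
  constrained.
\<close>

text \<open>
  Length of \<open>\<gamma>\<close> on \<open>[a, b]\<close>, where \<open>a \<le> b\<close>: the supremum over all finite partitions. A partition is
  represented by a monotone sequence in \<open>[a, b]\<close>, of which only the first \<open>n + 1\<close> terms are used.
\<close>

definition curve_length :: "('a \<Rightarrow> 'a \<Rightarrow> real) \<Rightarrow> (real \<Rightarrow> 'a) \<Rightarrow> real \<Rightarrow> real \<Rightarrow> ereal" where
  "curve_length d \<gamma> a b =
     (SUP (n, \<tau>) \<in> {(n :: nat, \<tau> :: nat \<Rightarrow> real). mono \<tau> \<and> range \<tau> \<subseteq> {a..b}}.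
        ereal (\<Sum>i<n. d (\<gamma> (\<tau> i)) (\<gamma> (\<tau> (Suc i)))))"

definition shortest_arc :: "('a \<Rightarrow> 'a \<Rightarrow> real) \<Rightarrow> (real \<Rightarrow> 'a) \<Rightarrow> real \<Rightarrow> real \<Rightarrow> bool" where
  "shortest_arc d \<gamma> a b \<longleftrightarrow> curve_length d \<gamma> a b = ereal (d (\<gamma> a) (\<gamma> b))"

text \<open>Continuity of a geodesic is not listed, since parametrization by arclength makes it 1-Lipschitz.\<close>

definition geodesic :: "'a set \<Rightarrow> ('a \<Rightarrow> 'a \<Rightarrow> real) \<Rightarrow> (real \<Rightarrow> 'a) \<Rightarrow> bool" where
  "geodesic M d \<gamma> \<longleftrightarrow>
     range \<gamma> \<subseteq> M \<and>
     (\<forall>a b. a \<le> b \<longrightarrow> curve_length d \<gamma> a b = ereal (b - a)) \<and>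
     (\<forall>t. \<exists>\<epsilon>>0. shortest_arc d \<gamma> (t - \<epsilon>) (t + \<epsilon>))"

definition isometry_of :: "'a set \<Rightarrow> ('a \<Rightarrow> 'a \<Rightarrow> real) \<Rightarrow> ('a \<Rightarrow> 'a) \<Rightarrow> bool" where
  "isometry_of M d f \<longleftrightarrow> bij_betw f M M \<and> (\<forall>x\<in>M. \<forall>y\<in>M. d (f x) (f y) = d x y)"

text \<open>
  The last condition is continuity of the homomorphism \<open>\<phi>\<close> for the topology of pointwise convergence,
  which on groups of isometries agrees with the compact-open topology.
\<close>

definition one_parameter_isometry_subgroup ::
    "'a set \<Rightarrow> ('a \<Rightarrow> 'a \<Rightarrow> real) \<Rightarrow> (real \<Rightarrow> 'a \<Rightarrow> 'a) \<Rightarrow> bool" where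
  "one_parameter_isometry_subgroup M d \<phi> \<longleftrightarrow>
     (\<forall>t. isometry_of M d (\<phi> t)) \<and>
     (\<forall>x\<in>M. \<phi> 0 x = x) \<and>
     (\<forall>s t. \<forall>x\<in>M. \<phi> (s + t) x = \<phi> s (\<phi> t x)) \<and>
     (\<forall>x\<in>M. \<forall>t. ((\<lambda>s. d (\<phi> s x) (\<phi> t x)) \<longlongrightarrow> 0) (at t))"

text \<open>
  ``Orbit'' is meant for parametrized curves: the geodesic is the orbit map of one of its points, not
  merely a curve with the same image.
\<close>

definition geodesic_orbit_space :: "'a set \<Rightarrow> ('a \<Rightarrow> 'a \<Rightarrow> real) \<Rightarrow> bool" where
  "geodesic_orbit_space M d \<longleftrightarrow>
     (\<forall>\<gamma>. geodesic M d \<gamma> \<longrightarrow>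
        (\<exists>\<phi>. one_parameter_isometry_subgroup M d \<phi> \<and> (\<forall>t. \<gamma> t = \<phi> t (\<gamma> 0))))"


section \<open>The sub-Riemannian metric on \<open>SL(2)\<close>\<close>

type_synonym mat2 = "real^2^2"

definition SL2 :: "mat2 set" where
  "SL2 = {A. det A = 1}"

definition matrix_unit :: "2 \<Rightarrow> 2 \<Rightarrow> mat2" where
  "matrix_unit i j = (\<chi> k l. if k = i \<and> l = j then 1 else 0)"

definition p1 :: mat2 where
  "p1 = (1/2) *\<^sub>R (matrix_unit 1 1 - matrix_unit 2 2)"

definition p2 :: mat2 where
  "p2 = (1/2) *\<^sub>R (matrix_unit 1 2 + matrix_unit 2 1)"

definition distribution_at_unit :: "mat2 set" where
  "distribution_at_unit = span {p1, p2}"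

text \<open>
  The scalar product on \<open>span {p1, p2}\<close> with orthonormal basis \<open>p1, p2\<close>. Both matrices have norm
  \<open>1 / sqrt 2\<close> for the Euclidean (Frobenius) inner product \<open>\<bullet>\<close> of matrices, hence the factor 2.
\<close>

definition scalar_product :: "mat2 \<Rightarrow> mat2 \<Rightarrow> real" where
  "scalar_product A B = 2 * (A \<bullet> B)"

lemma scalar_product_orthonormal:
  "scalar_product p1 p1 = 1" "scalar_product p2 p2 = 1" "scalar_product p1 p2 = 0"
  by (simp_all add: scalar_product_def p1_def p2_def matrix_unit_def inner_vec_def sum_2)

lemma scalar_product_coordinates:
  "scalar_product (a *\<^sub>R p1 + b *\<^sub>R p2) (c *\<^sub>R p1 + d *\<^sub>R p2) = a * c + b * d"
  by (simp add: scalar_product_def p1_def p2_def matrix_unit_def inner_vec_def sum_2 algebra_simps)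

text \<open>Left translation by \<open>g\<close> is linear in the matrix entries, so its differential is \<open>A \<mapsto> g ** A\<close>.\<close>

definition distribution :: "mat2 \<Rightarrow> mat2 set" where
  "distribution g = (\<lambda>A. g ** A) ` distribution_at_unit"

definition subriemannian_norm :: "mat2 \<Rightarrow> mat2 \<Rightarrow> real" where
  "subriemannian_norm g v =
     sqrt (scalar_product (matrix_inv g ** v) (matrix_inv g ** v))"

definition horizontal_path :: "(real \<Rightarrow> mat2) \<Rightarrow> bool" where
  "horizontal_path c \<longleftrightarrow>
     valid_path c \<and> path_image c \<subseteq> SL2 \<and>
     (\<exists>S. finite S \<and> (\<forall>t\<in>{0..1} - S. \<exists>v\<in>distribution (c t). (c has_vector_derivative v) (at t)))"

text \<open>
  A relation rather than a function, because \<open>valid_path\<close> (piecewise \<open>C\<^sup>1\<close>) does not bound the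
  derivative near the exceptional points: a path whose speed is not integrable has no length, whereas
  the total function \<open>integral\<close> would give it the value 0.
\<close>

definition has_subriemannian_length :: "(real \<Rightarrow> mat2) \<Rightarrow> real \<Rightarrow> bool" where
  "has_subriemannian_length c L \<longleftrightarrow>
     ((\<lambda>t. subriemannian_norm (c t) (vector_derivative c (at t))) has_integral L) {0..1}"

text \<open>
  The Carnot-Caratheodory distance. For \<open>g, h \<in> SL2\<close> the set of lengths is nonempty by the
  Rashevskii-Chow theorem, as \<open>p1\<close>, \<open>p2\<close> and their commutator span the Lie algebra and \<open>SL2\<close> is
  connected; hence \<open>Inf\<close> is the true infimum.
\<close>

definition cc_distance :: "mat2 \<Rightarrow> mat2 \<Rightarrow> real" where
  "cc_distance g h =
     Inf {L. \<exists>c. horizontal_path c \<and> pathstart c = g \<and> pathfinish c = h \<and>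
                 has_subriemannian_length c L}"

end

theory Submission
  imports Defs
begin

text \<open>
  The quotient of \<open>SL2\<close> by the rotations is the hyperbolic plane of curvature \<open>-1\<close>. A horizontal
  path in \<open>SL2\<close> has the length of its projection to the plane, and it is determined by that
  projection; up to sign, the rotation angle of its end point is the area between the projection and
  its chord. Shortest arcs therefore solve the isoperimetric problem of Dido, and they project to
  curves of constant geodesic curvature. Written in the group, such a curve is
  \<open>t \<mapsto> g ** exp_sub b u t ** rot (b * t / 2)\<close>, a one-parameter subgroup between a left translation and a
  rotation acting from the right. Left translations and right rotations are isometries, so that this
  curve is an orbit of \<open>x \<mapsto> g ** exp_sub b u t ** matrix_inv g ** x ** rot (b * t / 2)\<close>.

  The work lies in showing that a geodesic, which is a priori only a curve that is locally shortest in
  the metric sense, is one of these arcs. No derivative of the geodesic is ever taken; the argument rests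
  on calibrations. For each curvature \<open>b\<close> the function \<open>calib b\<close>, a multiple of the rotation angle plus a
  function of the hyperbolic distance from the base point, grows along a horizontal path at most as fast
  as the arc length, and exactly as fast along the arcs of curvature \<open>b\<close> through the unit. Hence
  differences of \<open>calib b\<close> are lower bounds for the distance near the unit
  (\<open>cc_distance_calib_le\<close>). If an arc of curvature \<open>b\<close> joins the ends of a shortest curve, then the curve
  must realize this bound at all of its points. Since the bound holds for all neighbouring
  curvatures as well, its derivative in \<open>b\<close> vanishes there, and this determines the polar coordinates of
  each point (\<open>calibrated_curve_hol\<close>). Doing this from both ends fixes the points themselves
  (\<open>straight_minimizer_is_arc\<close>).

  An arc with the right end points is available as soon as the curve is almost straight, that is, its
  projection has a chord almost as long as the curve. Such a piece exists in every interval: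
  otherwise a product of polar decompositions would give a polygon with the same ends, up to a
  negligible rotation, that is shorter by a fixed factor (\<open>straight_pair_exists\<close>). And where an
  arc ends, the geodesic is again almost straight, because a corner could be cut
  (\<open>arc_extends_straight\<close>). So the arc continues beyond its end, and the whole geodesic is
  one arc (\<open>locally_minimizing_is_arc\<close>).
\<close>

section \<open>Complex coordinates on two-by-two matrices\<close>

text \<open>
  A matrix acts on the plane of complex numbers by \<open>z \<mapsto> hol g * z + anti g * cnj z\<close>. In these
  coordinates \<open>SL2\<close> is the group \<open>SU(1,1)\<close>.
\<close>

definition hol :: "mat2 \<Rightarrow> complex" where
  "hol g = Complex ((g$1$1 + g$2$2) / 2) ((g$2$1 - g$1$2) / 2)"

definition anti :: "mat2 \<Rightarrow> complex" where
  "anti g = Complex ((g$1$1 - g$2$2) / 2) ((g$1$2 + g$2$1) / 2)"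

definition of_parts :: "complex \<Rightarrow> complex \<Rightarrow> mat2" where
  "of_parts a z = vector [vector [Re a + Re z, Im z - Im a], vector [Im a + Im z, Re a - Re z]]"

lemma hol_of_parts [simp]: "hol (of_parts a z) = a"
  and anti_of_parts [simp]: "anti (of_parts a z) = z"
  by (simp_all add: hol_def anti_def of_parts_def complex_eq_iff)

lemma parts_eq_iff: "g = h \<longleftrightarrow> hol g = hol h \<and> anti g = anti h"
proof
  assume "hol g = hol h \<and> anti g = anti h"
  then show "g = h"
    by (simp add: hol_def anti_def vec_eq_iff forall_2 field_simps)
qed simp

lemma hol_mult: "hol (g ** h) = hol g * hol h + anti g * cnj (anti h)"
  and anti_mult: "anti (g ** h) = hol g * anti h + anti g * cnj (hol h)"
  by (simp_all add: hol_def anti_def matrix_matrix_mult_def sum_2 complex_eq_iff field_simps)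

lemma hol_mat1 [simp]: "hol (mat 1) = 1"
  and anti_mat1 [simp]: "anti (mat 1) = 0"
  by (simp_all add: hol_def anti_def mat_def complex_eq_iff)

lemma det_parts: "det g = (cmod (hol g))\<^sup>2 - (cmod (anti g))\<^sup>2"
  unfolding cmod_power2 by (simp add: hol_def anti_def det_2 field_simps power2_eq_square)

lemma SL2_iff: "g \<in> SL2 \<longleftrightarrow> (cmod (hol g))\<^sup>2 = 1 + (cmod (anti g))\<^sup>2"
  by (auto simp: SL2_def det_parts)

lemma SL2_norm_eqs:
  assumes "g \<in> SL2"
  shows "hol g * cnj (hol g) = 1 + anti g * cnj (anti g)"
proof -
  have "hol g * cnj (hol g) = of_real ((cmod (hol g))\<^sup>2)"
    by (rule complex_norm_square[symmetric])
  also have "\<dots> = 1 + of_real ((cmod (anti g))\<^sup>2)"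
    using assms by (simp add: SL2_iff)
  also have "of_real ((cmod (anti g))\<^sup>2) = anti g * cnj (anti g)"
    by (rule complex_norm_square)
  finally show ?thesis .
qed

lemma SL2_mult [simp, intro]: "g \<in> SL2 \<Longrightarrow> h \<in> SL2 \<Longrightarrow> g ** h \<in> SL2"
  by (simp add: SL2_def det_mul)

lemma SL2_mat1 [simp]: "mat 1 \<in> SL2"
  by (simp add: SL2_def)

lemma SL2_hol_ge_1: "g \<in> SL2 \<Longrightarrow> 1 \<le> cmod (hol g)"
  using power2_le_imp_le[of 1 "cmod (hol g)"] by (simp add: SL2_iff)

lemma SL2_hol_nonzero: "g \<in> SL2 \<Longrightarrow> hol g \<noteq> 0"
  using SL2_hol_ge_1 by fastforce

lemma SL2_anti_less_hol: "g \<in> SL2 \<Longrightarrow> cmod (anti g) < cmod (hol g)"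
  by (rule power2_less_imp_less) (auto simp: SL2_iff)

lemma SL2_inv_left [simp]: "g \<in> SL2 \<Longrightarrow> matrix_inv g ** g = mat 1"
  and SL2_inv_right [simp]: "g \<in> SL2 \<Longrightarrow> g ** matrix_inv g = mat 1"
proof -
  assume "g \<in> SL2"
  then have "invertible g"
    by (simp add: SL2_def invertible_det_nz)
  then have "g ** matrix_inv g = mat 1 \<and> matrix_inv g ** g = mat 1"
    unfolding invertible_def matrix_inv_def by (rule someI_ex)
  then show "matrix_inv g ** g = mat 1" "g ** matrix_inv g = mat 1"
    by auto
qed

lemma SL2_inv_cancel_left [simp]: "g \<in> SL2 \<Longrightarrow> matrix_inv g ** (g ** h) = h"
  and SL2_inv_cancel_right [simp]: "g \<in> SL2 \<Longrightarrow> g ** (matrix_inv g ** h) = h"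
  by (simp_all add: matrix_mul_assoc)

lemma SL2_inv_eq:
  assumes "g \<in> SL2"
  shows "matrix_inv g = of_parts (cnj (hol g)) (- anti g)"
proof -
  have "of_parts (cnj (hol g)) (- anti g) ** g = mat 1"
    using SL2_norm_eqs[OF assms] by (simp add: parts_eq_iff hol_mult anti_mult mult.commute)
  then have "of_parts (cnj (hol g)) (- anti g) ** (g ** matrix_inv g) = matrix_inv g"
    by (simp add: matrix_mul_assoc)
  then show ?thesis
    using assms by simp
qed

lemma SL2_inv [simp, intro]: "g \<in> SL2 \<Longrightarrow> matrix_inv g \<in> SL2"
  by (simp add: SL2_inv_eq) (simp add: SL2_iff)

lemma hol_inv_mult: "g \<in> SL2 \<Longrightarrow> hol (matrix_inv g ** h) = cnj (hol g) * hol h - anti g * cnj (anti h)"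
  by (simp add: SL2_inv_eq hol_mult)

lemma bounded_linear_hol: "bounded_linear hol"
proof (rule linear_conv_bounded_linear[THEN iffD1], rule linearI)
  show "hol (x + y) = hol x + hol y" "hol (r *\<^sub>R x) = r *\<^sub>R hol x" for x y r
    by (simp_all add: hol_def complex_eq_iff field_simps)
qed

lemma bounded_linear_anti: "bounded_linear anti"
proof (rule linear_conv_bounded_linear[THEN iffD1], rule linearI)
  show "anti (x + y) = anti x + anti y" "anti (r *\<^sub>R x) = r *\<^sub>R anti x" for x y r
    by (simp_all add: anti_def complex_eq_iff field_simps)
qed

lemma bounded_linear_of_parts: "bounded_linear (\<lambda>(a, z). of_parts a z)"
proof (rule linear_conv_bounded_linear[THEN iffD1], rule linearI)
  show "(\<lambda>(a, z). of_parts a z) (x + y) = (\<lambda>(a, z). of_parts a z) x + (\<lambda>(a, z). of_parts a z) y"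
    "(\<lambda>(a, z). of_parts a z) (r *\<^sub>R x) = r *\<^sub>R (\<lambda>(a, z). of_parts a z) x" for x y and r :: real
    by (auto simp: of_parts_def vec_eq_iff forall_2 field_simps split: prod.splits)
qed

text \<open>
  The rotations are the stabilizer of the base point of the hyperbolic plane.
\<close>

definition rot :: "real \<Rightarrow> mat2" where
  "rot \<phi> = of_parts (cis \<phi>) 0"

lemma hol_rot [simp]: "hol (rot \<phi>) = cis \<phi>"
  and anti_rot [simp]: "anti (rot \<phi>) = 0"
  by (simp_all add: rot_def)

lemma rot_SL2 [simp]: "rot \<phi> \<in> SL2"
  by (simp add: SL2_iff)

lemma rot_add: "rot \<phi> ** rot \<psi> = rot (\<phi> + \<psi>)"
  by (simp add: parts_eq_iff hol_mult anti_mult cis_mult)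

lemma rot_0 [simp]: "rot 0 = mat 1"
  by (simp add: parts_eq_iff)

section \<open>Horizontal velocities\<close>

text \<open>
  The distribution at the unit consists of the matrices with vanishing \<open>hol\<close>. The factor \<open>1/2\<close> makes the
  norm of the control \<open>u\<close> the sub-Riemannian speed.
\<close>

abbreviation horiz :: "complex \<Rightarrow> mat2" where
  "horiz u \<equiv> of_parts 0 (u / 2)"

lemma horiz_eq: "horiz u = Re u *\<^sub>R p1 + Im u *\<^sub>R p2"
  by (simp add: of_parts_def p1_def p2_def matrix_unit_def vec_eq_iff forall_2)

lemma distribution_iff: "v \<in> distribution g \<longleftrightarrow> (\<exists>u. v = g ** horiz u)"
proof -
  have eq: "distribution_at_unit = range (\<lambda>u. horiz u)"
  proof (intro equalityI subsetI)
    fix A assume "A \<in> distribution_at_unit"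
    then obtain a b where "A - a *\<^sub>R p1 = b *\<^sub>R p2"
      unfolding distribution_at_unit_def span_insert span_singleton by auto
    then have "A = horiz (Complex a b)"
      unfolding horiz_eq by (simp add: diff_eq_eq add.commute)
    then show "A \<in> range horiz" by blast
  next
    fix A assume "A \<in> range horiz"
    then show "A \<in> distribution_at_unit"
      unfolding distribution_at_unit_def horiz_eq by (auto intro: span_add span_scale span_base)
  qed
  show ?thesis
    unfolding distribution_def eq by (simp add: image_iff)
qed

lemma subriemannian_norm_horiz:
  assumes "g \<in> SL2"
  shows "subriemannian_norm g (g ** horiz u) = cmod u"
  using assms
  by (simp add: subriemannian_norm_def horiz_eq scalar_product_coordinates cmod_def power2_eq_square)

section \<open>Horizontal paths and their lengths\<close>

text \<open>
  The control \<open>u\<close> is an explicit witness for horizontality outside the finite set \<open>S\<close>. The length is then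
  an ordinary integral without vector derivatives.
\<close>

definition controlled_path :: "(real \<Rightarrow> mat2) \<Rightarrow> real set \<Rightarrow> (real \<Rightarrow> complex) \<Rightarrow> real \<Rightarrow> bool" where
  "controlled_path c S u L \<longleftrightarrow>
     valid_path c \<and> path_image c \<subseteq> SL2 \<and> finite S \<and>
     (\<forall>t\<in>{0..1} - S. (c has_vector_derivative c t ** horiz (u t)) (at t)) \<and>
     ((\<lambda>t. cmod (u t)) has_integral L) {0..1}"

lemma controlled_path_SL2: "controlled_path c S u L \<Longrightarrow> t \<in> {0..1} \<Longrightarrow> c t \<in> SL2"
  by (auto simp: controlled_path_def path_image_def)

lemma horizontal_path_iff_controlled:
  "horizontal_path c \<and> has_subriemannian_length c L \<longleftrightarrow> (\<exists>S u. controlled_path c S u L)"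
proof
  assume *: "horizontal_path c \<and> has_subriemannian_length c L"
  then obtain S where S: "finite S"
    "\<forall>t\<in>{0..1} - S. \<exists>v\<in>distribution (c t). (c has_vector_derivative v) (at t)"
    unfolding horizontal_path_def by auto
  have "\<forall>t\<in>{0..1} - S. \<exists>u. (c has_vector_derivative c t ** horiz u) (at t)"
  proof
    fix t assume "t \<in> {0..1} - S"
    with S(2) obtain v where "v \<in> distribution (c t)" "(c has_vector_derivative v) (at t)"
      by blast
    then show "\<exists>u. (c has_vector_derivative c t ** horiz u) (at t)"
      by (auto simp: distribution_iff)
  qed
  from bchoice[OF this] obtain u
    where u: "\<And>t. t\<in>{0..1} - S \<Longrightarrow> (c has_vector_derivative c t ** horiz (u t)) (at t)"
    by blast
  have SL: "c t \<in> SL2" if "t \<in> {0..1}" for t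
    using * that by (auto simp: horizontal_path_def path_image_def)
  have "((\<lambda>t. cmod (u t)) has_integral L) {0..1}"
  proof (rule has_integral_spike_finite[OF S(1)])
    show "((\<lambda>t. subriemannian_norm (c t) (vector_derivative c (at t))) has_integral L) {0..1}"
      using * by (simp add: has_subriemannian_length_def)
    show "cmod (u t) = subriemannian_norm (c t) (vector_derivative c (at t))" if "t \<in> {0..1} - S" for t
      using that by (simp add: vector_derivative_at[OF u] subriemannian_norm_horiz SL)
  qed
  then show "\<exists>S u. controlled_path c S u L"
    using * S(1) u unfolding controlled_path_def horizontal_path_def by blast
next
  assume "\<exists>S u. controlled_path c S u L"
  then obtain S u where c: "controlled_path c S u L" by blast
  then have S: "finite S" and
    u: "\<And>t. t\<in>{0..1} - S \<Longrightarrow> (c has_vector_derivative c t ** horiz (u t)) (at t)"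
    by (auto simp: controlled_path_def)
  have "((\<lambda>t. subriemannian_norm (c t) (vector_derivative c (at t))) has_integral L) {0..1}"
  proof (rule has_integral_spike_finite[OF S])
    show "((\<lambda>t. cmod (u t)) has_integral L) {0..1}"
      using c by (simp add: controlled_path_def)
    show "subriemannian_norm (c t) (vector_derivative c (at t)) = cmod (u t)" if "t \<in> {0..1} - S" for t
      using that by (simp add: vector_derivative_at[OF u] subriemannian_norm_horiz controlled_path_SL2[OF c])
  qed
  moreover have "\<forall>t\<in>{0..1} - S. \<exists>v\<in>distribution (c t). (c has_vector_derivative v) (at t)"
  proof
    fix t assume "t \<in> {0..1} - S"
    from u[OF this] show "\<exists>v\<in>distribution (c t). (c has_vector_derivative v) (at t)"
      by (rule bexI) (auto simp: distribution_iff)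
  qed
  then have "horizontal_path c"
    using c S unfolding horizontal_path_def controlled_path_def by (intro conjI exI[of _ S]) simp_all
  ultimately show "horizontal_path c \<and> has_subriemannian_length c L"
    by (simp add: has_subriemannian_length_def)
qed

definition joined :: "mat2 \<Rightarrow> mat2 \<Rightarrow> real \<Rightarrow> bool" where
  "joined g h L \<longleftrightarrow> (\<exists>c S u. controlled_path c S u L \<and> c 0 = g \<and> c 1 = h)"

lemma cc_distance_joined: "cc_distance g h = Inf {L. joined g h L}"
proof -
  have "(\<exists>c. horizontal_path c \<and> pathstart c = g \<and> pathfinish c = h \<and> has_subriemannian_length c L)
      \<longleftrightarrow> (\<exists>c. (horizontal_path c \<and> has_subriemannian_length c L) \<and> c 0 = g \<and> c 1 = h)" for L
    by (auto simp: pathstart_def pathfinish_def)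
  then show ?thesis
    unfolding cc_distance_def joined_def horizontal_path_iff_controlled by simp
qed

lemma joined_nonneg: "joined g h L \<Longrightarrow> 0 \<le> L"
  by (auto simp: joined_def controlled_path_def intro: has_integral_nonneg)

lemma valid_path_bounded_linear:
  assumes "bounded_linear f" "valid_path c"
  shows "valid_path (\<lambda>t. f (c t))"
proof -
  obtain S D where c: "continuous_on {0..1} c" "finite S"
    "\<forall>t\<in>{0..1} - S. (c has_vector_derivative D t) (at t)" "continuous_on ({0..1} - S) D"
    using assms(2) unfolding valid_path_def piecewise_C1_differentiable_on_def C1_differentiable_on_def
    by blast
  have "\<forall>t\<in>{0..1} - S. ((\<lambda>t. f (c t)) has_vector_derivative f (D t)) (at t)"
    using c(3) bounded_linear.has_vector_derivative[OF assms(1), of c] by simp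
  moreover have "continuous_on ({0..1} - S) (\<lambda>t. f (D t))" "continuous_on {0..1} (\<lambda>t. f (c t))"
    using bounded_linear.continuous_on[OF assms(1) c(4)] bounded_linear.continuous_on[OF assms(1) c(1)]
    by simp_all
  ultimately show ?thesis
    unfolding valid_path_def piecewise_C1_differentiable_on_def C1_differentiable_on_def
    using c(2) by (intro conjI exI[of _ S] exI[of _ "\<lambda>t. f (D t)"])
qed

lemma bounded_linear_matrix_mult: "bounded_linear (\<lambda>g :: mat2. k ** g ** l)"
proof (rule linear_conv_bounded_linear[THEN iffD1], rule linearI)
  show "k ** (x + y) ** l = k ** x ** l + k ** y ** l" for x y :: mat2
    by (simp add: matrix_matrix_mult_def vec_eq_iff sum_2 algebra_simps)
  show "k ** (r *\<^sub>R x) ** l = r *\<^sub>R (k ** x ** l)" for x :: mat2 and r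
    by (simp add: matrix_matrix_mult_def vec_eq_iff sum_2 algebra_simps)
qed

lemma horiz_rot: "horiz u ** rot \<phi> = rot \<phi> ** horiz (u * cis (- 2 * \<phi>))"
proof -
  have "cis (- \<phi>) = cis \<phi> * cis (- 2 * \<phi>)"
    by (simp add: cis_mult)
  then show ?thesis
    by (simp add: parts_eq_iff hol_mult anti_mult cis_cnj)
qed

text \<open>
  Left translations preserve everything by definition. A right translation by a rotation turns the
  control by a constant angle, because conjugation by a rotation acts on the distribution at the unit as
  an isometry.
\<close>

lemma joined_translate:
  assumes "joined g h L" "k \<in> SL2"
  shows "joined (k ** g ** rot \<phi>) (k ** h ** rot \<phi>) L"
proof -
  obtain c S u where c: "controlled_path c S u L" "c 0 = g" "c 1 = h"
    using assms by (auto simp: joined_def)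
  define c' where "c' = (\<lambda>t. k ** c t ** rot \<phi>)"
  have "valid_path c'"
    unfolding c'_def using c valid_path_bounded_linear[OF bounded_linear_matrix_mult]
    by (auto simp: controlled_path_def)
  moreover have "path_image c' \<subseteq> SL2"
    using controlled_path_SL2[OF c(1)] assms(2) by (auto simp: path_image_def c'_def)
  moreover have "(c' has_vector_derivative c' t ** horiz (u t * cis (- 2 * \<phi>))) (at t)"
    if t: "t \<in> {0..1} - S" for t
  proof -
    have "(c has_vector_derivative c t ** horiz (u t)) (at t)"
      using c t by (auto simp: controlled_path_def)
    from bounded_linear.has_vector_derivative[OF bounded_linear_matrix_mult this]
    have "(c' has_vector_derivative k ** (c t ** horiz (u t)) ** rot \<phi>) (at t)"
      by (simp add: c'_def)
    also have "k ** (c t ** horiz (u t)) ** rot \<phi> = k ** (c t ** (horiz (u t) ** rot \<phi>))"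
      by (simp add: matrix_mul_assoc)
    also have "\<dots> = c' t ** horiz (u t * cis (- 2 * \<phi>))"
      unfolding horiz_rot by (simp add: c'_def matrix_mul_assoc)
    finally show ?thesis .
  qed
  moreover have "((\<lambda>t. cmod (u t * cis (- 2 * \<phi>))) has_integral L) {0..1}"
    using c by (simp add: controlled_path_def norm_mult)
  ultimately have "controlled_path c' S (\<lambda>t. u t * cis (- 2 * \<phi>)) L"
    using c unfolding controlled_path_def by blast
  then show ?thesis
    unfolding joined_def using c(2,3)
    by (intro exI[of _ c'] exI[of _ S] exI[of _ "\<lambda>t. u t * cis (- 2 * \<phi>)"] conjI) (simp_all add: c'_def)
qed

lemma mult_horiz_scaleR: "g ** horiz (of_real r * u) = r *\<^sub>R (g ** horiz u)" for g :: mat2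
  by (simp add: matrix_matrix_mult_def of_parts_def vec_eq_iff forall_2 sum_2 algebra_simps)

lemma joined_sym:
  assumes "joined g h L"
  shows "joined h g L"
proof -
  obtain c S u where c: "controlled_path c S u L" "c 0 = g" "c 1 = h"
    using assms by (auto simp: joined_def)
  define c' where "c' = reversepath c"
  have "((\<lambda>t. c (1 - t)) has_vector_derivative c (1 - t) ** horiz (- u (1 - t))) (at t)"
    if "t \<in> {0..1} - (\<lambda>t. 1 - t) ` S" for t
  proof -
    have "1 - t \<in> {0..1} - S"
      using that by (auto simp: image_iff)
    then have 1: "(c has_vector_derivative c (1 - t) ** horiz (u (1 - t))) (at (1 - t))"
      using c by (auto simp: controlled_path_def)
    have 2: "((\<lambda>t. 1 - t) has_vector_derivative - 1) (at t)"
      by (auto intro!: derivative_eq_intros)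
    have "c (1 - t) ** horiz (- u (1 - t)) = (- 1) *\<^sub>R (c (1 - t) ** horiz (u (1 - t)))"
      using mult_horiz_scaleR[of _ "- 1"] by simp
    then show ?thesis
      using vector_diff_chain_at[OF 2 1] by (simp add: o_def)
  qed
  moreover have "((\<lambda>t. cmod (- u (1 - t))) has_integral L) {0..1}"
    using c has_integral_affinity01[of "\<lambda>t. cmod (u t)" L "-1" 1]
    by (simp add: controlled_path_def)
  moreover have "path_image c' \<subseteq> SL2" "valid_path c'" "finite S"
    using c by (auto simp: controlled_path_def c'_def)
  ultimately have "controlled_path c' ((\<lambda>t. 1 - t) ` S) (\<lambda>t. - u (1 - t)) L"
    unfolding controlled_path_def by (auto simp: c'_def reversepath_def)
  then show ?thesis
    unfolding joined_def using c(2,3)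
    by (intro exI[of _ c'] exI[of _ "(\<lambda>t. 1 - t) ` S"] exI[of _ "\<lambda>t. - u (1 - t)"] conjI)
       (simp_all add: c'_def reversepath_def)
qed

lemma joined_trans:
  assumes "joined g h L" "joined h k L'"
  shows "joined g k (L + L')"
proof -
  obtain c S u where c: "controlled_path c S u L" "c 0 = g" "c 1 = h"
    using assms by (auto simp: joined_def)
  obtain d T v where d: "controlled_path d T v L'" "d 0 = h" "d 1 = k"
    using assms by (auto simp: joined_def)
  define w where "w t = (if t \<le> 1/2 then 2 * u (2 * t) else 2 * v (2 * t - 1))" for t
  define W where "W = insert (1/2) (((*) 2 -` S) \<union> ((\<lambda>t. 2 * t - 1) -` T))"
  have fin: "finite W"
    using c d by (auto simp: W_def controlled_path_def intro!: finite_vimageI inj_onI)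
  have scale: "x ** horiz (2 * y) = 2 *\<^sub>R (x ** horiz y)" for x :: mat2 and y
    using mult_horiz_scaleR[of x 2 y] by simp
  have der: "((c +++ d) has_vector_derivative (c +++ d) t ** horiz (w t)) (at t)" if t: "t \<in> {0..1} - W" for t
  proof (cases "t < 1/2")
    case True
    have "(c has_vector_derivative c (2 * t) ** horiz (u (2 * t))) (at (2 * t))"
      using c t True by (auto simp: controlled_path_def W_def)
    moreover have "((*) 2 has_vector_derivative 2) (at t)"
      by (auto intro!: derivative_eq_intros)
    moreover have eq: "(c +++ d) t ** horiz (w t) = 2 *\<^sub>R (c (2 * t) ** horiz (u (2 * t)))"
      using True scale[of "c (2 * t)" "u (2 * t)"] by (simp add: w_def joinpaths_def)
    ultimately have *: "((\<lambda>t. c (2 * t)) has_vector_derivative (c +++ d) t ** horiz (w t)) (at t)"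
      using vector_diff_chain_at[of "(*) 2" 2 t c] unfolding eq by (simp add: o_def)
    show ?thesis
      by (rule has_vector_derivative_transform_within[OF *, of "1/2 - t"])
         (use True in \<open>auto simp: joinpaths_def dist_real_def abs_if split: if_splits\<close>)
  next
    case False
    then have False': "t > 1/2"
      using t by (auto simp: W_def)
    have "(d has_vector_derivative d (2 * t - 1) ** horiz (v (2 * t - 1))) (at (2 * t - 1))"
      using d t False by (auto simp: controlled_path_def W_def)
    moreover have "((\<lambda>t. 2 * t - 1) has_vector_derivative 2) (at t)"
      by (auto intro!: derivative_eq_intros)
    moreover have eq: "(c +++ d) t ** horiz (w t) = 2 *\<^sub>R (d (2 * t - 1) ** horiz (v (2 * t - 1)))"
      using False' scale[of "d (2 * t - 1)" "v (2 * t - 1)"] by (simp add: w_def joinpaths_def)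
    ultimately have *: "((\<lambda>t. d (2 * t - 1)) has_vector_derivative (c +++ d) t ** horiz (w t)) (at t)"
      using vector_diff_chain_at[of "\<lambda>t. 2 * t - 1" 2 t d] unfolding eq by (simp add: o_def)
    show ?thesis
      by (rule has_vector_derivative_transform_within[OF *, of "t - 1/2"])
         (use False' in \<open>auto simp: joinpaths_def dist_real_def abs_if split: if_splits\<close>)
  qed
  have i1: "((\<lambda>x. 2 * cmod (u (2 * x))) has_integral L) {0..1/2}"
    using has_integral_affinity01 [of "\<lambda>t. cmod (u t)" L 2 0, THEN has_integral_cmul [where c=2]] c
    by (simp add: controlled_path_def)
  have im: "(\<lambda>x::real. x / 2 + 1 / 2) ` {0..1} = {1/2..1}"
    using image_affinity_atLeastAtMost_div[of 2 "1/2" 0 "1::real"] by simp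
  have i2: "((\<lambda>x. 2 * cmod (v (2 * x - 1))) has_integral L') {1/2..1}"
    using has_integral_affinity01 [of "\<lambda>t. cmod (v t)" L' 2 "-1", THEN has_integral_cmul [where c=2]] d
    by (simp add: controlled_path_def im)
  have "((\<lambda>t. cmod (w t)) has_integral L) {0..1/2}"
    by (rule has_integral_spike_finite[OF _ _ i1, of "{}"]) (auto simp: w_def norm_mult)
  moreover have "((\<lambda>t. cmod (w t)) has_integral L') {1/2..1}"
    by (rule has_integral_spike_finite[OF _ _ i2, of "{1/2}"]) (auto simp: w_def norm_mult)
  ultimately have "((\<lambda>t. cmod (w t)) has_integral (L + L')) {0..1}"
    by (rule has_integral_combine[rotated 2]) auto
  moreover have "valid_path (c +++ d)" "path_image (c +++ d) \<subseteq> SL2"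
    using c d path_image_join_subset[of c d]
    by (auto simp: controlled_path_def pathfinish_def pathstart_def intro!: valid_path_join)
  ultimately have "controlled_path (c +++ d) W w (L + L')"
    using fin der unfolding controlled_path_def by blast
  then show ?thesis
    unfolding joined_def using c(2,3) d(2,3)
    by (intro exI[of _ "c +++ d"] exI[of _ W] exI[of _ w] conjI) (simp_all add: joinpaths_def)
qed

section \<open>Arcs of constant geodesic curvature\<close>

text \<open>
  \<open>arcC b\<close> and \<open>arcS b\<close> solve \<open>y'' = arcK b * y\<close> with initial data \<open>(1, 0)\<close> and \<open>(0, 1)\<close>. The sign of
  \<open>arcK b\<close> distinguishes equidistant curves, horocycles and circles of the hyperbolic plane.
\<close>

definition arcC :: "real \<Rightarrow> real \<Rightarrow> real" where
  "arcC b t = (if b\<^sup>2 < 1 then cosh (sqrt (1 - b\<^sup>2) / 2 * t)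
     else if b\<^sup>2 = 1 then 1 else cos (sqrt (b\<^sup>2 - 1) / 2 * t))"

definition arcS :: "real \<Rightarrow> real \<Rightarrow> real" where
  "arcS b t = (if b\<^sup>2 < 1 then sinh (sqrt (1 - b\<^sup>2) / 2 * t) / (sqrt (1 - b\<^sup>2) / 2)
     else if b\<^sup>2 = 1 then t else sin (sqrt (b\<^sup>2 - 1) / 2 * t) / (sqrt (b\<^sup>2 - 1) / 2))"

definition arcK :: "real \<Rightarrow> real" where
  "arcK b = (1 - b\<^sup>2) / 4"

lemma arc_cases:
  obtains (hyp) w where "w > 0" "arcK b = w\<^sup>2" "arcC b = (\<lambda>t. cosh (w * t))" "arcS b = (\<lambda>t. sinh (w * t) / w)"
  | (par) "arcK b = 0" "arcC b = (\<lambda>t. 1)" "arcS b = (\<lambda>t. t)"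
  | (ell) w where "w > 0" "arcK b = - w\<^sup>2" "arcC b = (\<lambda>t. cos (w * t))" "arcS b = (\<lambda>t. sin (w * t) / w)"
proof -
  consider "b\<^sup>2 < 1" | "b\<^sup>2 = 1" | "b\<^sup>2 > 1" by linarith
  then show ?thesis
  proof cases
    case 1
    show ?thesis
      by (rule hyp[of "sqrt (1 - b\<^sup>2) / 2"])
         (use 1 in \<open>auto simp: arcC_def arcS_def arcK_def power_divide real_sqrt_pow2 fun_eq_iff field_simps\<close>)
  next
    case 2
    show ?thesis
      by (rule par) (use 2 in \<open>auto simp: arcC_def arcS_def arcK_def fun_eq_iff\<close>)
  next
    case 3
    show ?thesis
      by (rule ell[of "sqrt (b\<^sup>2 - 1) / 2"])
         (use 3 in \<open>auto simp: arcC_def arcS_def arcK_def power_divide real_sqrt_pow2 fun_eq_iff field_simps\<close>)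
  qed
qed

lemma arc_0 [simp]: "arcC b 0 = 1" "arcS b 0 = 0"
  by (simp_all add: arcC_def arcS_def)

lemma arc_minus: "arcC b (- t) = arcC b t" "arcS b (- t) = - arcS b t"
  "arcC (- b) t = arcC b t" "arcS (- b) t = arcS b t"
  by (simp_all add: arcC_def arcS_def)

lemma arc_add:
  "arcC b (s + t) = arcC b s * arcC b t + arcK b * (arcS b s * arcS b t)" (is ?C)
  "arcS b (s + t) = arcS b s * arcC b t + arcC b s * arcS b t" (is ?S)
proof -
  have "?C \<and> ?S"
  proof (cases rule: arc_cases[of b])
    case (hyp w)
    then show ?thesis
      by (simp add: distrib_left cosh_add sinh_add add_divide_distrib power2_eq_square)
  next
    case par
    then show ?thesis by simp
  next
    case (ell w)
    then show ?thesis
      by (simp add: distrib_left cos_add sin_add add_divide_distrib power2_eq_square)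
  qed
  then show ?C ?S by auto
qed

lemma arc_square: "(arcC b t)\<^sup>2 - arcK b * (arcS b t)\<^sup>2 = 1"
proof (cases rule: arc_cases[of b])
  case (hyp w)
  then show ?thesis
    by (simp add: power_divide hyperbolic_pythagoras)
next
  case par
  then show ?thesis by simp
next
  case (ell w)
  then show ?thesis
    by (simp add: power_divide)
qed

lemma arc_DERIV:
  "(arcC b has_real_derivative arcK b * arcS b t) (at t)"
  "(arcS b has_real_derivative arcC b t) (at t)"
  by (cases rule: arc_cases[of b];
      auto intro!: derivative_eq_intros simp: power2_eq_square)+

definition arc_hol :: "real \<Rightarrow> real \<Rightarrow> complex" where
  "arc_hol b t = Complex (arcC b t) (- (b * arcS b t / 2)) * cis (b * t / 2)"

text \<open>
  The arc that leaves the unit with control \<open>u\<close> and projects to a curve of geodesic curvature \<open>\<bar>b\<bar>\<close> in the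
  hyperbolic plane, parametrized by arc length.
\<close>

definition geo_arc :: "real \<Rightarrow> complex \<Rightarrow> real \<Rightarrow> mat2" where
  "geo_arc b u t = of_parts (arc_hol b t) (u * arcS b t / 2 * cis (- (b * t / 2)))"

text \<open>
  The one-parameter subgroup with generator \<open>of_parts (- \<i> * b / 2) (u / 2)\<close>: for \<open>cmod u = 1\<close> the square of this
  generator is the scalar \<open>arcK b\<close>.
\<close>

definition exp_sub :: "real \<Rightarrow> complex \<Rightarrow> real \<Rightarrow> mat2" where
  "exp_sub b u t = of_parts (Complex (arcC b t) (- (b * arcS b t / 2))) (u * arcS b t / 2)"

text \<open>
  The right factor cancels the vertical component of the velocity of the subgroup. This product form is
  what makes the arc an orbit of isometries.
\<close>

lemma geo_arc_eq_exp_sub_rot: "geo_arc b u t = exp_sub b u t ** rot (b * t / 2)"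
  by (simp add: parts_eq_iff hol_mult anti_mult geo_arc_def arc_hol_def exp_sub_def cis_cnj)

lemma exp_sub_SL2:
  assumes "cmod u = 1"
  shows "exp_sub b u t \<in> SL2"
proof -
  have "(cmod (Complex (arcC b t) (- (b * arcS b t / 2))))\<^sup>2 = (arcC b t)\<^sup>2 + b\<^sup>2 / 4 * (arcS b t)\<^sup>2"
    by (simp add: cmod_power2 power_mult_distrib power_divide)
  also have "\<dots> = 1 + (arcS b t)\<^sup>2 / 4"
    using arc_square[of b t] by (simp add: arcK_def field_simps)
  finally show ?thesis
    using assms by (simp add: SL2_iff exp_sub_def norm_mult norm_divide power_mult_distrib power_divide)
qed

lemma geo_arc_SL2: "cmod u = 1 \<Longrightarrow> geo_arc b u t \<in> SL2"
  by (simp add: geo_arc_eq_exp_sub_rot exp_sub_SL2)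

lemma exp_sub_0 [simp]: "exp_sub b u 0 = mat 1"
  by (simp add: exp_sub_def parts_eq_iff complex_eq_iff)

lemma geo_arc_at_0 [simp]: "geo_arc b u 0 = mat 1"
  by (simp add: geo_arc_eq_exp_sub_rot)

lemma exp_sub_add:
  assumes "cmod u = 1"
  shows "exp_sub b u (s + t) = exp_sub b u s ** exp_sub b u t"
proof -
  have u: "u * cnj u = 1"
    using assms complex_norm_square[of u] by simp
  then have "Re u * Re u + Im u * Im u = 1"
    by (simp add: complex_eq_iff)
  then have u2: "(Im u)\<^sup>2 = 1 - (Re u)\<^sup>2"
    by (simp add: power2_eq_square)
  show ?thesis
    unfolding parts_eq_iff hol_mult anti_mult
    by (simp add: exp_sub_def arc_add arcK_def complex_eq_iff field_simps)
       (use u2 in algebra)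
qed

lemma rot_conj_exp_sub: "exp_sub b u t ** rot \<phi> = rot \<phi> ** exp_sub b (u * cis (- 2 * \<phi>)) t"
proof -
  have "cis (- \<phi>) = cis \<phi> * cis (- 2 * \<phi>)"
    by (simp add: cis_mult)
  then show ?thesis
    by (simp add: parts_eq_iff hol_mult anti_mult cis_cnj exp_sub_def)
qed

text \<open>
  An arc restarted at one of its points is an arc of the same curvature with a turned initial
  control.
\<close>

lemma geo_arc_shift:
  assumes "cmod u = 1"
  shows "geo_arc b u (s + t) = geo_arc b u s ** geo_arc b (u * cis (- b * s)) t"
proof -
  have "geo_arc b u (s + t) = exp_sub b u s ** (exp_sub b u t ** rot (b * s / 2)) ** rot (b * t / 2)"
    by (simp add: geo_arc_eq_exp_sub_rot exp_sub_add[OF assms] distrib_left add_divide_distrib rot_add[symmetric] matrix_mul_assoc)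
  also have "\<dots> = geo_arc b u s ** geo_arc b (u * cis (- b * s)) t"
    unfolding rot_conj_exp_sub by (simp add: geo_arc_eq_exp_sub_rot matrix_mul_assoc)
  finally show ?thesis .
qed

lemma has_vector_derivative_of_parts:
  assumes "(f has_vector_derivative f') (at t)" "(g has_vector_derivative g') (at t)"
  shows "((\<lambda>t. of_parts (f t) (g t)) has_vector_derivative of_parts f' g') (at t)"
  using bounded_linear.has_vector_derivative[OF bounded_linear_of_parts has_vector_derivative_Pair[OF assms]]
  by simp

lemma continuous_on_of_parts:
  assumes "continuous_on S f" "continuous_on S g"
  shows "continuous_on S (\<lambda>t. of_parts (f t) (g t))"
  using bounded_linear.continuous_on[OF bounded_linear_of_parts continuous_on_Pair[OF assms]]
  by simp

lemma geo_arc_has_vector_derivative: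
  assumes "cmod u = 1"
  shows "(geo_arc b u has_vector_derivative geo_arc b u t ** horiz (u * cis (- b * t))) (at t)"
proof -
  have u: "u * cnj u = 1"
    using assms complex_norm_square[of u] by simp
  have cis: "((\<lambda>t. cis (c * t)) has_vector_derivative (\<i> * c * cis (c * t))) (at t)" for c
  proof -
    have "((\<lambda>t. exp (t *\<^sub>R (\<i> * of_real c))) has_vector_derivative
        exp (t *\<^sub>R (\<i> * of_real c)) * (\<i> * of_real c)) (at t)"
      by (rule exp_scaleR_has_vector_derivative_right)
    then show ?thesis
      by (simp add: cis_conv_exp scaleR_conv_of_real mult_ac)
  qed
  have 1: "((\<lambda>t. complex_of_real (arcC b t)) has_vector_derivative of_real (arcK b * arcS b t)) (at t)"
    "((\<lambda>t. complex_of_real (arcS b t)) has_vector_derivative of_real (arcC b t)) (at t)"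
    using arc_DERIV[of b t] by (auto intro!: has_vector_derivative_of_real simp del: of_real_mult)
  have hol_alt: "arc_hol b t = (of_real (arcC b t) - \<i> * b / 2 * of_real (arcS b t)) * cis (b / 2 * t)" for t
    by (simp add: arc_hol_def complex_eq_iff)
  have h: "(arc_hol b has_vector_derivative of_real (arcS b t) / 4 * cis (b * t / 2)) (at t)"
    unfolding hol_alt[abs_def]
    by (rule derivative_eq_intros 1 cis refl)+ (simp add: arcK_def field_simps power2_eq_square)
  have a: "((\<lambda>t. u / 2 * arcS b t * cis (- b / 2 * t)) has_vector_derivative
     arc_hol b t * u * cis (- b * t) / 2) (at t)"
  proof -
    have "cis (b / 2 * t) * cis (- b * t) = cis (- b / 2 * t)"
      by (simp add: cis_mult)
    then have eq: "arc_hol b t * u * cis (- b * t) / 2 =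
        u / 2 * (of_real (arcC b t) - \<i> * b / 2 * of_real (arcS b t)) * cis (- b / 2 * t)"
      unfolding hol_alt by (simp add: mult_ac)
    show ?thesis
      unfolding eq by (rule derivative_eq_intros 1 cis refl)+ (simp add: field_simps)
  qed
  have "u * (cis (- (b * t / 2)) * (cnj u * cis (b * t))) = u * cnj u * (cis (- (b * t / 2)) * cis (b * t))"
    by (simp only: mult_ac)
  also have "\<dots> = cis (b * t / 2)"
    by (simp add: u cis_mult)
  finally have uc: "u * (cis (- (b * t / 2)) * (cnj u * cis (b * t))) = cis (b * t / 2)" .
  have "geo_arc b u t ** horiz (u * cis (- b * t)) =
     of_parts (of_real (arcS b t) / 4 * cis (b * t / 2)) (arc_hol b t * u * cis (- b * t) / 2)"
    by (simp add: parts_eq_iff hol_mult anti_mult geo_arc_def cis_cnj uc)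
  then show ?thesis
    using has_vector_derivative_of_parts[OF h a] by (simp add: geo_arc_def[abs_def] mult_ac)
qed

lemma joined_arc:
  assumes "cmod u = 1" "0 \<le> T" "g \<in> SL2"
  shows "joined g (g ** geo_arc b u T) T"
proof -
  define c where "c t = g ** geo_arc b u (T * t) ** mat 1" for t
  define v where "v t = of_real T * (u * cis (- b * (T * t)))" for t
  have der: "(c has_vector_derivative c t ** horiz (v t)) (at t)" for t
  proof -
    have "((*) T has_vector_derivative T) (at t)"
      by (auto intro!: derivative_eq_intros)
    from vector_diff_chain_at[OF this geo_arc_has_vector_derivative[OF assms(1), of b "T * t"]]
    have "((\<lambda>t. geo_arc b u (T * t)) has_vector_derivative geo_arc b u (T * t) ** horiz (v t)) (at t)"
      unfolding v_def mult_horiz_scaleR by (simp add: o_def)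
    from bounded_linear.has_vector_derivative[OF bounded_linear_matrix_mult this, of g "mat 1"]
    show ?thesis
      by (simp add: c_def[abs_def] matrix_mul_assoc)
  qed
  have cont: "continuous_on UNIV c"
    using der by (meson continuous_at_imp_continuous_on has_vector_derivative_continuous)
  have "c t ** horiz (v t) = of_parts (anti (c t) * cnj (v t) / 2) (hol (c t) * v t / 2)" for t
    by (simp add: parts_eq_iff hol_mult anti_mult)
  moreover have "continuous_on UNIV (\<lambda>t. of_parts (anti (c t) * cnj (v t) / 2) (hol (c t) * v t / 2))"
    unfolding v_def using cont
    by (intro continuous_on_of_parts continuous_intros bounded_linear.continuous_on[OF bounded_linear_hol]
         bounded_linear.continuous_on[OF bounded_linear_anti]) auto
  ultimately have "continuous_on UNIV (\<lambda>t. c t ** horiz (v t))"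
    by simp
  then have "valid_path c"
    unfolding valid_path_def using der continuous_on_subset
    by (intro C1_differentiable_imp_piecewise, unfold C1_differentiable_on_def)
       (intro exI[of _ "\<lambda>t. c t ** horiz (v t)"], blast)
  moreover have "path_image c \<subseteq> SL2"
    using geo_arc_SL2[OF assms(1)] assms(3) by (auto simp: path_image_def c_def)
  moreover have "((\<lambda>t. cmod (v t)) has_integral T) {0..1}"
    using has_integral_const_real[of T 0 1] assms by (simp add: v_def norm_mult)
  ultimately have "controlled_path c {} v T"
    using der by (simp add: controlled_path_def)
  then show ?thesis
    unfolding joined_def
    by (intro exI[of _ c] exI[of _ "{}"] exI[of _ v]) (simp add: c_def)
qed

section \<open>The Carnot-Caratheodory distance\<close>

lemma cc_distance_le: "joined g h L \<Longrightarrow> cc_distance g h \<le> L"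
  unfolding cc_distance_joined
  by (rule cInf_lower) (auto intro!: bdd_belowI[of _ 0] simp: joined_nonneg)

lemma cc_distance_arc_le:
  "cmod u = 1 \<Longrightarrow> 0 \<le> T \<Longrightarrow> g \<in> SL2 \<Longrightarrow> cc_distance g (g ** geo_arc b u T) \<le> T"
  by (intro cc_distance_le joined_arc)

text \<open>
  The hyperbolic distance between the base point and its image under \<open>g\<close>.
\<close>

definition radius :: "mat2 \<Rightarrow> real" where
  "radius g = 2 * arsinh (cmod (anti g))"

text \<open>
  The rotation angle in the polar decomposition of \<open>g\<close>. Half of it is the argument of \<open>hol g\<close>, as \<open>rot\<close>
  is a double cover of the rotations of the hyperbolic plane.
\<close>

definition angle :: "mat2 \<Rightarrow> real" where
  "angle g = 2 * Im (Ln (hol g))"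

lemma radius_nonneg [simp]: "0 \<le> radius g"
  using arsinh_real_neg_iff[of "cmod (anti g)"] norm_ge_zero[of "anti g"]
  unfolding radius_def by linarith

lemma sinh_radius: "sinh (radius g / 2) = cmod (anti g)"
  by (simp add: radius_def)

lemma cosh_radius:
  assumes "g \<in> SL2"
  shows "cosh (radius g / 2) = cmod (hol g)"
proof -
  have "(cosh (radius g / 2))\<^sup>2 = (cmod (hol g))\<^sup>2"
    using assms by (simp add: SL2_iff cosh_square_eq sinh_radius)
  then show ?thesis
    by (simp add: power2_eq_iff_nonneg)
qed

lemma hol_polar: "g \<in> SL2 \<Longrightarrow> hol g = of_real (cosh (radius g / 2)) * cis (angle g / 2)"
  using rcis_cmod_Arg[of "hol g"]
  by (simp add: cosh_radius angle_def rcis_def Arg_eq_Im_Ln SL2_hol_nonzero)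

lemma geo_arc_0: "geo_arc 0 u t = of_parts (cosh (t / 2)) (u * sinh (t / 2))"
  by (simp add: geo_arc_def arc_hol_def arcC_def arcS_def complex_eq_iff parts_eq_iff)

lemma polar_decomposition:
  assumes "g \<in> SL2"
  obtains u where "cmod u = 1" "g = geo_arc 0 u (radius g) ** rot (angle g / 2)"
proof -
  define u where "u = (if anti g = 0 then 1 else sgn (anti g) * cis (angle g / 2))"
  have "cmod u = 1"
    by (simp add: u_def norm_mult norm_sgn)
  moreover have "anti g = cmod (anti g) * sgn (anti g)"
    by (simp add: sgn_eq)
  then have "anti g = u * sinh (radius g / 2) * cis (- (angle g / 2))"
    by (simp add: u_def sinh_radius mult_ac cis_mult)
  then have "g = geo_arc 0 u (radius g) ** rot (angle g / 2)"
    unfolding parts_eq_iff hol_mult anti_mult geo_arc_0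
    by (simp add: hol_polar[OF assms] cis_cnj)
  ultimately show ?thesis by (rule that)
qed

text \<open>
  The circumference of a hyperbolic circle that encloses the area \<open>\<bar>\<theta>\<bar>\<close>.
\<close>

definition rot_cost :: "real \<Rightarrow> real" where
  "rot_cost \<theta> = 2 * pi * sqrt ((1 + \<bar>\<theta>\<bar> / (2 * pi))\<^sup>2 - 1)"

lemma rot_cost_nonneg: "0 \<le> rot_cost \<theta>"
  by (simp add: rot_cost_def one_le_power)

text \<open>
  A circle traversed once returns to its starting fibre, turned by an angle equal to the enclosed
  area. Hence rotations are joined to the unit by horizontal paths, of small length if the angle is
  small.
\<close>

lemma geo_arc_full_circle:
  obtains b where "rot (\<theta> / 2) = geo_arc b 1 (rot_cost \<theta>)"
proof (cases "\<theta> = 0")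
  case True
  then show ?thesis
    by (intro that[of 0]) (simp add: rot_cost_def)
next
  case False
  define e where "e = (if \<theta> > 0 then 1 else - 1 :: real)"
  define q where "q = 1 + \<bar>\<theta>\<bar> / (2 * pi)"
  define s where "s = sqrt (q\<^sup>2 - 1)"
  (* curvature of the circle of circumference 2 * pi * s, signed by the direction of traversal *)
  define b where "b = e * (q / s)"
  have q: "q > 1"
    using False by (simp add: q_def)
  then have "q\<^sup>2 > 1"
    by (simp add: one_less_power)
  then have s: "s > 0" "s\<^sup>2 = q\<^sup>2 - 1"
    by (simp_all add: s_def)
  have "e\<^sup>2 = 1"
    by (simp add: e_def)
  then have "b\<^sup>2 - 1 = (1 / s)\<^sup>2"
    using s by (simp add: b_def power_mult_distrib power_divide field_simps)
  then have b: "sqrt (b\<^sup>2 - 1) = 1 / s" "b\<^sup>2 > 1"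
    using s by (simp_all add: real_sqrt_unique) (smt (verit) zero_less_divide_1_iff zero_less_power)
  have T: "rot_cost \<theta> = 2 * pi * s"
    by (simp add: rot_cost_def s_def q_def)
  have CS: "arcC b (rot_cost \<theta>) = - 1" "arcS b (rot_cost \<theta>) = 0"
    using b s by (simp_all add: arcC_def arcS_def T)
  have "b * rot_cost \<theta> / 2 = e * pi * q"
    using s by (simp add: b_def T)
  also have "\<dots> = e * pi + \<theta> / 2"
    by (simp add: q_def e_def field_simps)
  finally have eq: "b * rot_cost \<theta> / 2 = e * pi + \<theta> / 2" .
  have "cis (b * rot_cost \<theta> / 2) = - cis (\<theta> / 2)"
    unfolding eq by (cases "\<theta> > 0") (simp_all add: e_def complex_eq_iff cos_add sin_add cos_diff sin_diff)
  then have "rot (\<theta> / 2) = geo_arc b 1 (rot_cost \<theta>)"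
    by (simp add: parts_eq_iff geo_arc_def arc_hol_def CS complex_eq_iff)
  then show ?thesis by (rule that)
qed

lemma joined_polar:
  assumes "m \<in> SL2" "g \<in> SL2"
  shows "joined g (g ** m) (radius m + rot_cost (angle m))"
proof -
  obtain u where u: "cmod u = 1" "m = geo_arc 0 u (radius m) ** rot (angle m / 2)"
    using polar_decomposition[OF assms(1)] .
  obtain b where b: "rot (angle m / 2) = geo_arc b 1 (rot_cost (angle m))"
    by (rule geo_arc_full_circle)
  have "joined g (g ** geo_arc 0 u (radius m)) (radius m)"
    using u assms by (intro joined_arc) auto
  moreover have "joined (g ** geo_arc 0 u (radius m)) (g ** geo_arc 0 u (radius m) ** rot (angle m / 2))
     (rot_cost (angle m))"
    unfolding b using u assms by (intro joined_arc) (auto simp: rot_cost_nonneg geo_arc_SL2)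
  ultimately show ?thesis
    using joined_trans u by (metis matrix_mul_assoc)
qed

lemma cc_distance_polar_le:
  "m \<in> SL2 \<Longrightarrow> g \<in> SL2 \<Longrightarrow> cc_distance g (g ** m) \<le> radius m + rot_cost (angle m)"
  by (intro cc_distance_le joined_polar)

text \<open>
  The polar decomposition yields an explicit horizontal path between any two points: a segment followed by a
  full circle.
\<close>

lemma joined_exists:
  assumes "g \<in> SL2" "h \<in> SL2"
  shows "\<exists>L. joined g h L"
  using joined_polar[of "matrix_inv g ** h" g] assms by auto

lemma cc_distance_ge:
  assumes "g \<in> SL2" "h \<in> SL2" "\<And>L. joined g h L \<Longrightarrow> x \<le> L"
  shows "x \<le> cc_distance g h"
  unfolding cc_distance_joined
  using joined_exists[OF assms(1,2)] assms(3) by (intro cInf_greatest) auto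

lemma cc_distance_nonneg: "g \<in> SL2 \<Longrightarrow> h \<in> SL2 \<Longrightarrow> 0 \<le> cc_distance g h"
  by (rule cc_distance_ge) (auto simp: joined_nonneg)

lemma cc_distance_less:
  assumes "g \<in> SL2" "h \<in> SL2" "cc_distance g h < x"
  obtains L where "joined g h L" "L < x"
  using cInf_lessD[of "{L. joined g h L}" x] joined_exists[OF assms(1,2)] assms(3) that
  unfolding cc_distance_joined by auto

lemma cc_distance_sym: "cc_distance g h = cc_distance h g"
  unfolding cc_distance_joined using joined_sym by (intro arg_cong[of _ _ Inf] Collect_cong) blast

lemma cc_distance_triangle:
  assumes "g \<in> SL2" "h \<in> SL2" "k \<in> SL2"
  shows "cc_distance g k \<le> cc_distance g h + cc_distance h k"
proof (rule field_le_epsilon)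
  fix e :: real assume "e > 0"
  obtain L where L: "joined g h L" "L < cc_distance g h + e / 2"
    using cc_distance_less[OF assms(1,2), of "cc_distance g h + e / 2"] \<open>e > 0\<close> by auto
  obtain M where M: "joined h k M" "M < cc_distance h k + e / 2"
    using cc_distance_less[OF assms(2,3), of "cc_distance h k + e / 2"] \<open>e > 0\<close> by auto
  show "cc_distance g k \<le> cc_distance g h + cc_distance h k + e"
    using cc_distance_le[OF joined_trans[OF L(1) M(1)]] L(2) M(2) by linarith
qed

lemma cc_distance_translate:
  assumes "k \<in> SL2" "g \<in> SL2" "h \<in> SL2"
  shows "cc_distance (k ** g ** rot \<phi>) (k ** h ** rot \<phi>) = cc_distance g h"
proof -
  have "joined (k ** g ** rot \<phi>) (k ** h ** rot \<phi>) L \<longleftrightarrow> joined g h L" for L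
  proof
    assume "joined (k ** g ** rot \<phi>) (k ** h ** rot \<phi>) L"
    from joined_translate[OF this SL2_inv[OF assms(1)], of "- \<phi>"]
    show "joined g h L"
      using assms by (simp add: matrix_mul_assoc[symmetric] rot_add)
  qed (use joined_translate assms in auto)
  then show ?thesis
    unfolding cc_distance_joined by (intro arg_cong[of _ _ Inf] Collect_cong)
qed

lemma cc_distance_left:
  assumes "k \<in> SL2" "g \<in> SL2" "h \<in> SL2"
  shows "cc_distance (k ** g) (k ** h) = cc_distance g h"
  using cc_distance_translate[OF assms, of 0] by simp

section \<open>Calibrations\<close>

text \<open>
  The radial part of the calibration. An arc of curvature \<open>b\<close> from the base point meets the radial direction
  at distance \<open>x\<close> under an angle with sine \<open>b * tanh (x / 2)\<close>; the integrand is the cosine of this angle.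
  As a function of a radius the integral solves the eikonal equation of the problem.
\<close>

definition eikonal :: "real \<Rightarrow> real \<Rightarrow> real" where
  "eikonal b r = integral {0..r} (\<lambda>x. sqrt (1 - b\<^sup>2 * (tanh (x / 2))\<^sup>2))"

definition calib :: "real \<Rightarrow> mat2 \<Rightarrow> real" where
  "calib b g = b * angle g + eikonal b (radius g)"

lemma eikonal_0 [simp]: "eikonal b 0 = 0"
  by (simp add: eikonal_def)

lemma eikonal_has_derivative:
  assumes "r > 0"
  shows "(eikonal b has_real_derivative sqrt (1 - b\<^sup>2 * (tanh (r / 2))\<^sup>2)) (at r)"
proof -
  have "((\<lambda>x. integral {0..x} (\<lambda>x. sqrt (1 - b\<^sup>2 * (tanh (x / 2))\<^sup>2))) has_real_derivative
      sqrt (1 - b\<^sup>2 * (tanh (r / 2))\<^sup>2)) (at r within {0..r + 1})"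
    using assms by (intro integral_has_real_derivative continuous_intros) (auto simp: cosh_real_nonzero)
  moreover have "at r within {0..r + 1} = at r"
    using assms by (intro at_within_interior) (auto simp: interior_atLeastAtMost_real)
  ultimately show ?thesis
    by (simp add: eikonal_def[abs_def])
qed

lemma continuous_on_eikonal: "continuous_on {0..r} (eikonal b)"
  unfolding eikonal_def
  by (intro indefinite_integral_continuous_1 integrable_continuous_real continuous_intros)
     (auto simp: cosh_real_nonzero)

lemma eikonal_zero: "0 \<le> r \<Longrightarrow> eikonal 0 r = r"
  by (simp add: eikonal_def)

lemma calib_zero: "calib 0 g = radius g"
  by (simp add: calib_def eikonal_zero)

lemma calib_mat1 [simp]: "calib b (mat 1) = 0"
  by (simp add: calib_def angle_def radius_def)

text \<open>
  The mean value inequality in integrated form; the speed of a piecewise \<open>C\<^sup>1\<close> path need not be bounded.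
\<close>

lemma increment_le_integral:
  fixes f :: "real \<Rightarrow> real"
  assumes "a \<le> b" "continuous_on {a..b} f" "finite S" "g integrable_on {a..b}"
    "\<And>t. t \<in> {a..b} \<Longrightarrow> 0 \<le> g t"
    "\<And>t. t \<in> {a<..<b} - S \<Longrightarrow> \<exists>D. (f has_real_derivative D) (at t) \<and> D \<le> g t"
  shows "f b - f a \<le> integral {a..b} g"
proof -
  obtain D where D: "\<And>t. t \<in> {a<..<b} - S \<Longrightarrow> (f has_real_derivative D t) (at t) \<and> D t \<le> g t"
    using assms(6) by metis
  have "((\<lambda>t. if t \<in> {a<..<b} - S then D t else 0) has_integral f b - f a) {a..b}"
    using D assms
    by (intro fundamental_theorem_of_calculus_interior_strong[OF assms(3,1)])
       (auto simp: has_real_derivative_iff_has_vector_derivative)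
  then show ?thesis
    by (rule has_integral_le[OF _ integrable_integral[OF assms(4)]]) (use D assms(5) in auto)
qed

lemma controlled_path_derivatives:
  assumes "controlled_path c S u L" "t \<in> {0..1} - S"
  shows "((\<lambda>t. hol (c t)) has_vector_derivative anti (c t) * cnj (u t) / 2) (at t)"
    "((\<lambda>t. anti (c t)) has_vector_derivative hol (c t) * u t / 2) (at t)"
proof -
  have "(c has_vector_derivative c t ** horiz (u t)) (at t)"
    using assms by (simp add: controlled_path_def)
  from bounded_linear.has_vector_derivative[OF bounded_linear_hol this]
       bounded_linear.has_vector_derivative[OF bounded_linear_anti this]
  show "((\<lambda>t. hol (c t)) has_vector_derivative anti (c t) * cnj (u t) / 2) (at t)"
    "((\<lambda>t. anti (c t)) has_vector_derivative hol (c t) * u t / 2) (at t)"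
    by (simp_all add: hol_mult anti_mult)
qed

lemma controlled_path_continuous:
  assumes "controlled_path c S u L"
  shows "continuous_on {0..1} (\<lambda>t. hol (c t))" "continuous_on {0..1} (\<lambda>t. anti (c t))"
proof -
  have "continuous_on {0..1} c"
    using assms by (auto simp: controlled_path_def valid_path_def piecewise_C1_differentiable_on_def)
  then show "continuous_on {0..1} (\<lambda>t. hol (c t))" "continuous_on {0..1} (\<lambda>t. anti (c t))"
    by (auto intro: bounded_linear.continuous_on[OF bounded_linear_hol] bounded_linear.continuous_on[OF bounded_linear_anti])
qed

lemma tanh_radius:
  assumes "g \<in> SL2"
  shows "tanh (radius g / 2) = cmod (anti g) / cmod (hol g)"
  using assms by (simp add: tanh_def sinh_radius cosh_radius)

lemma angle_has_derivative:
  assumes c: "controlled_path c S u L" "t \<in> {0..1} - S" and pos: "Re (hol (c t)) > 0"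
  shows "((\<lambda>t. angle (c t)) has_real_derivative Im (anti (c t) * cnj (u t) / hol (c t))) (at t)"
proof -
  have nz: "hol (c t) \<noteq> 0"
    using pos by auto
  have "((Ln \<circ> (\<lambda>t. hol (c t))) has_vector_derivative
      (anti (c t) * cnj (u t) / 2) * inverse (hol (c t))) (at t)"
    using pos by (intro field_vector_diff_chain_at controlled_path_derivatives[OF c] has_field_derivative_Ln)
      (auto simp: complex_nonpos_Reals_iff)
  moreover have "bounded_linear (\<lambda>z. 2 * Im z)"
    by (intro bounded_linear_const_mult bounded_linear_Im)
  ultimately have "((\<lambda>t. 2 * Im (Ln (hol (c t)))) has_vector_derivative
      2 * Im ((anti (c t) * cnj (u t) / 2) * inverse (hol (c t)))) (at t)"
    using bounded_linear.has_vector_derivative[of "\<lambda>z. 2 * Im z" "Ln \<circ> (\<lambda>t. hol (c t))"] by (simp only: o_def)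
  moreover have "2 * Im ((anti (c t) * cnj (u t) / 2) * inverse (hol (c t))) = Im (anti (c t) * cnj (u t) / hol (c t))"
  proof -
    have "Im (2 * w) = 2 * Im w" for w
      by simp
    moreover have "anti (c t) * cnj (u t) / hol (c t) = 2 * ((anti (c t) * cnj (u t) / 2) * inverse (hol (c t)))"
      by (simp only: divide_inverse) simp
    ultimately show ?thesis
      by metis
  qed
  ultimately show ?thesis
    by (simp add: has_real_derivative_iff_has_vector_derivative angle_def)
qed

lemma radius_has_derivative:
  assumes c: "controlled_path c S u L" "t \<in> {0..1} - S" and nz: "anti (c t) \<noteq> 0"
  shows "((\<lambda>t. radius (c t)) has_real_derivative
     Re (cnj (anti (c t)) * hol (c t) * u t) / (cmod (anti (c t)) * cmod (hol (c t)))) (at t)"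
proof -
  have "((\<lambda>t. cmod (anti (c t))) has_derivative (\<lambda>h. (h *\<^sub>R (hol (c t) * u t / 2)) \<bullet> sgn (anti (c t)))) (at t)"
    using has_derivative_compose[OF controlled_path_derivatives(2)[OF c, unfolded has_vector_derivative_def]
      has_derivative_norm[OF nz]] by simp
  then have "((\<lambda>t. cmod (anti (c t))) has_real_derivative (hol (c t) * u t / 2) \<bullet> sgn (anti (c t))) (at t)"
    unfolding has_field_derivative_def by (rule has_derivative_eq_rhs) (auto simp: fun_eq_iff)
  then have R: "((\<lambda>t. radius (c t)) has_real_derivative
     2 * ((hol (c t) * u t / 2) \<bullet> sgn (anti (c t)) / sqrt ((cmod (anti (c t)))\<^sup>2 + 1))) (at t)"
    unfolding radius_def
    using DERIV_cmult[OF DERIV_chain2[OF arsinh_real_has_field_derivative], of _ _ t UNIV 2] by simp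
  have 1: "sqrt ((cmod (anti (c t)))\<^sup>2 + 1) = cmod (hol (c t))"
    using controlled_path_SL2[OF c(1), of t] c(2) by (intro real_sqrt_unique) (auto simp: SL2_iff)
  have 2: "(hol (c t) * u t / 2) \<bullet> sgn (anti (c t)) = Re (cnj (anti (c t)) * hol (c t) * u t) / (2 * cmod (anti (c t)))"
    by (simp add: inner_complex_def sgn_eq divide_simps) (simp add: algebra_simps)
  have "2 * (x / (2 * y) / z) = x / (y * z)" for x y z :: real
    by simp
  then show ?thesis
    by (rule DERIV_cong[OF R[unfolded 1 2]])
qed

text \<open>
  The left-hand side is the derivative of \<open>calib b\<close> in a direction \<open>u\<close>. In the frame of the radial and the
  angular direction it is the product of \<open>u\<close> with a unit vector, whose components are
  \<open>sqrt (1 - b\<^sup>2 * q\<^sup>2)\<close> and \<open>b * q\<close> for \<open>q = cmod z / cmod a\<close>. The claim is the inequality of Cauchy and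
  Schwarz.
\<close>

lemma calib_velocity_le:
  fixes a z u :: complex and b :: real
  assumes "z \<noteq> 0" "cmod z < cmod a" "\<bar>b\<bar> * (cmod z / cmod a) \<le> 1"
  shows "b * Im (z * cnj u / a) + sqrt (1 - b\<^sup>2 * (cmod z / cmod a)\<^sup>2) * (Re (cnj z * a * u) / (cmod z * cmod a)) \<le> cmod u"
proof -
  define w where "w = cnj z * a * u / (cmod z * cmod a)"
  define q where "q = cmod z / cmod a"
  define s where "s = sqrt (1 - b\<^sup>2 * q\<^sup>2)"
  have a: "a \<noteq> 0" using assms by auto
  have "(\<bar>b\<bar> * q)\<^sup>2 \<le> 1"
    using assms by (auto simp: q_def intro!: power_le_one)
  then have s: "s\<^sup>2 + (b * q)\<^sup>2 = 1"
    by (simp add: s_def power_mult_distrib)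
  have w: "cmod w = cmod u"
    using a assms by (simp add: w_def norm_mult norm_divide)
  have 1: "Im (z * cnj u / a) = - (q * Im w)"
  proof -
    have "z * cnj u / a = z * cnj u * cnj a / (of_real (cmod a))\<^sup>2"
      using a by (simp add: divide_simps complex_norm_square[symmetric] flip: of_real_power)
         (metis complex_norm_square mult.commute mult.left_commute of_real_power)
    also have "\<dots> = of_real q * cnj w"
      using a assms by (simp add: q_def w_def field_simps power2_eq_square)
    finally show ?thesis by simp
  qed
  have 2: "Re (cnj z * a * u) / (cmod z * cmod a) = Re w"
    unfolding w_def by (metis Re_divide_of_real of_real_mult)
  have "(s * Re w - b * q * Im w)\<^sup>2 \<le> (s * Re w - b * q * Im w)\<^sup>2 + (b * q * Re w + s * Im w)\<^sup>2"
    by simp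
  also have "\<dots> = (s\<^sup>2 + (b * q)\<^sup>2) * ((Re w)\<^sup>2 + (Im w)\<^sup>2)"
    by algebra
  also have "\<dots> = (cmod u)\<^sup>2"
    using s w by (simp flip: cmod_power2)
  finally have "s * Re w - b * q * Im w \<le> cmod u"
    by (rule power2_le_imp_le) simp
  then show ?thesis
    unfolding 1 2 s_def q_def by (simp add: mult_ac)
qed

lemma calib_increment_off_axis:
  assumes c: "controlled_path c S u L" and ab: "0 \<le> s" "s \<le> t" "t \<le> 1"
    and b: "\<And>x. x \<in> {s..t} \<Longrightarrow> \<bar>b\<bar> * tanh (radius (c x) / 2) \<le> 1"
    and pos: "b = 0 \<or> (\<forall>x\<in>{s..t}. Re (hol (c x)) > 0)"
    and nz: "\<And>x. x \<in> {s<..<t} \<Longrightarrow> anti (c x) \<noteq> 0"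
  shows "calib b (c t) - calib b (c s) \<le> integral {s..t} (\<lambda>x. cmod (u x))"
proof (rule increment_le_integral[OF ab(2), where S = S and f = "\<lambda>x. calib b (c x)"])
  have sub: "{s..t} \<subseteq> {0..1}"
    using ab by auto
  have "continuous_on {s..t} (\<lambda>x. radius (c x))"
    unfolding radius_def
    by (intro continuous_intros continuous_on_subset[OF controlled_path_continuous(2)[OF c] sub])
  moreover obtain M where "radius (c x) \<le> M" if "x \<in> {s..t}" for x
    using compact_continuous_image[OF calculation compact_Icc, THEN compact_imp_bounded]
    by (force simp: bounded_real)
  ultimately have "continuous_on {s..t} (\<lambda>x. eikonal b (radius (c x)))"
    by (intro continuous_on_compose2[OF continuous_on_eikonal[of M]]) auto
  moreover have "continuous_on {s..t} (\<lambda>x. b * angle (c x))"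
  proof (cases "b = 0")
    case False
    then have "Re (hol (c x)) > 0" if "x \<in> {s..t}" for x
      using pos that by blast
    then have "hol (c x) \<notin> \<real>\<^sub>\<le>\<^sub>0" if "x \<in> {s..t}" for x
      using that by (force simp: complex_nonpos_Reals_iff)
    then show ?thesis
      unfolding angle_def
      by (intro continuous_intros continuous_on_subset[OF controlled_path_continuous(1)[OF c] sub]) auto
  qed simp
  ultimately show "continuous_on {s..t} (\<lambda>x. calib b (c x))"
    unfolding calib_def by (intro continuous_on_add)
  show "(\<lambda>x. cmod (u x)) integrable_on {s..t}"
    using c sub integrable_on_subinterval unfolding controlled_path_def by blast
  show "finite S" "\<And>x. x \<in> {s..t} \<Longrightarrow> 0 \<le> cmod (u x)"
    using c by (auto simp: controlled_path_def)
  fix x assume x: "x \<in> {s<..<t} - S"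
  then have x': "x \<in> {0..1} - S" "x \<in> {s..t}"
    using sub by auto
  have SL: "c x \<in> SL2"
    using controlled_path_SL2[OF c] x' by auto
  have R: "radius (c x) > 0"
    using nz[of x] x by (simp add: radius_def)
  have "((\<lambda>x. b * angle (c x)) has_real_derivative b * Im (anti (c x) * cnj (u x) / hol (c x))) (at x)"
    using pos angle_has_derivative[OF c x'(1)] x' by (cases "b = 0") (auto intro: DERIV_cmult)
  moreover have "((\<lambda>x. eikonal b (radius (c x))) has_real_derivative
      sqrt (1 - b\<^sup>2 * (tanh (radius (c x) / 2))\<^sup>2) *
      (Re (cnj (anti (c x)) * hol (c x) * u x) / (cmod (anti (c x)) * cmod (hol (c x))))) (at x)"
    using nz[of x] x
    by (intro DERIV_chain2[where g = "\<lambda>x. radius (c x)"] eikonal_has_derivative[OF R]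
         radius_has_derivative[OF c x'(1)]) auto
  ultimately have "((\<lambda>x. calib b (c x)) has_real_derivative
     b * Im (anti (c x) * cnj (u x) / hol (c x)) + sqrt (1 - b\<^sup>2 * (tanh (radius (c x) / 2))\<^sup>2) *
      (Re (cnj (anti (c x)) * hol (c x) * u x) / (cmod (anti (c x)) * cmod (hol (c x))))) (at x)"
    unfolding calib_def by (rule DERIV_add)
  moreover have "\<bar>b\<bar> * (cmod (anti (c x)) / cmod (hol (c x))) \<le> 1"
    using b[OF x'(2)] by (simp only: tanh_radius[OF SL])
  moreover have "b * Im (anti (c x) * cnj (u x) / hol (c x)) + sqrt (1 - b\<^sup>2 * (tanh (radius (c x) / 2))\<^sup>2) *
      (Re (cnj (anti (c x)) * hol (c x) * u x) / (cmod (anti (c x)) * cmod (hol (c x)))) \<le> cmod (u x)"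
    unfolding tanh_radius[OF SL]
    using nz[of x] x SL2_anti_less_hol[OF SL] calculation(2)
    by (intro calib_velocity_le) auto
  ultimately show "\<exists>D. ((\<lambda>x. calib b (c x)) has_real_derivative D) (at x) \<and> D \<le> cmod (u x)"
    by blast
qed

text \<open>
  The angular part of the calibration alone also satisfies the estimate. It covers the stretches between
  two points over the base point, where the radius is not differentiable.
\<close>

lemma angle_increment:
  assumes c: "controlled_path c S u L" and ab: "0 \<le> s" "s \<le> t" "t \<le> 1"
    and b: "\<And>x. x \<in> {s..t} \<Longrightarrow> \<bar>b\<bar> * tanh (radius (c x) / 2) \<le> 1"
    and pos: "\<forall>x\<in>{s..t}. Re (hol (c x)) > 0"
  shows "b * angle (c t) - b * angle (c s) \<le> integral {s..t} (\<lambda>x. cmod (u x))"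
proof (rule increment_le_integral[OF ab(2), where S = S and f = "\<lambda>x. b * angle (c x)"])
  have sub: "{s..t} \<subseteq> {0..1}"
    using ab by auto
  have "hol (c x) \<notin> \<real>\<^sub>\<le>\<^sub>0" if "x \<in> {s..t}" for x
    using bspec[OF pos that] by (auto simp: complex_nonpos_Reals_iff)
  then show "continuous_on {s..t} (\<lambda>x. b * angle (c x))"
    unfolding angle_def
    by (intro continuous_intros continuous_on_subset[OF controlled_path_continuous(1)[OF c] sub]) auto
  show "(\<lambda>x. cmod (u x)) integrable_on {s..t}"
    using c sub integrable_on_subinterval unfolding controlled_path_def by blast
  show "finite S" "\<And>x. x \<in> {s..t} \<Longrightarrow> 0 \<le> cmod (u x)"
    using c by (auto simp: controlled_path_def)
  fix x assume x: "x \<in> {s<..<t} - S"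
  then have x': "x \<in> {0..1} - S" "x \<in> {s..t}"
    using sub by auto
  have SL: "c x \<in> SL2"
    using controlled_path_SL2[OF c] x' by auto
  have "b * Im (anti (c x) * cnj (u x) / hol (c x)) \<le> \<bar>b\<bar> * cmod (anti (c x) * cnj (u x) / hol (c x))"
    using abs_ge_self[of "b * Im (anti (c x) * cnj (u x) / hol (c x))"]
      mult_left_mono[OF abs_Im_le_cmod[of "anti (c x) * cnj (u x) / hol (c x)"] abs_ge_zero[of b]]
    by (simp only: abs_mult)
  also have "\<dots> = (\<bar>b\<bar> * tanh (radius (c x) / 2)) * cmod (u x)"
    by (simp add: tanh_radius[OF SL] norm_mult norm_divide)
  also have "\<dots> \<le> cmod (u x)"
    using mult_right_mono[OF b[OF x'(2)], of "cmod (u x)"] by simp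
  finally show "\<exists>D. ((\<lambda>x. b * angle (c x)) has_real_derivative D) (at x) \<and> D \<le> cmod (u x)"
    using DERIV_cmult[OF angle_has_derivative[OF c x'(1) bspec[OF pos x'(2)]], of b] by (intro exI conjI)
qed

text \<open>
  The radius fails to be differentiable on the fibre over the base point. The path is cut at its first
  and last passage through this fibre; between them only the angle contributes.
\<close>

lemma calib_increment:
  assumes c: "controlled_path c S u L" and ab: "0 \<le> s" "s \<le> t" "t \<le> 1"
    and b: "\<And>x. x \<in> {s..t} \<Longrightarrow> \<bar>b\<bar> * tanh (radius (c x) / 2) \<le> 1"
    and pos: "b = 0 \<or> (\<forall>x\<in>{s..t}. Re (hol (c x)) > 0)"
  shows "calib b (c t) - calib b (c s) \<le> integral {s..t} (\<lambda>x. cmod (u x))"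
proof (cases "\<exists>x\<in>{s..t}. anti (c x) = 0")
  case False
  then show ?thesis
    by (intro calib_increment_off_axis[OF assms]) auto
next
  case True
  define Z where "Z = {x \<in> {s..t}. anti (c x) = 0}"
  have sub: "{s..t} \<subseteq> {0..1}"
    using ab by auto
  have "Z = {s..t} \<inter> (\<lambda>x. anti (c x)) -` {0}"
    by (auto simp: Z_def)
  then have "closed Z"
    using continuous_closed_preimage[OF continuous_on_subset[OF controlled_path_continuous(2)[OF c] sub]] by simp
  moreover have "Z \<subseteq> {s..t}"
    by (auto simp: Z_def)
  ultimately have Z: "compact Z" "Z \<noteq> {}"
    using True bounded_subset[OF bounded_closed_interval] unfolding compact_eq_bounded_closed
    by (auto simp: Z_def)
  obtain p where p: "p \<in> Z" "\<forall>x\<in>Z. p \<le> x"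
    using compact_attains_inf[OF Z] by blast
  obtain q where q: "q \<in> Z" "\<forall>x\<in>Z. x \<le> q"
    using compact_attains_sup[OF Z] by blast
  have pq: "s \<le> p" "p \<le> q" "q \<le> t"
    using p q by (auto simp: Z_def)
  have nz: "anti (c x) \<noteq> 0" if "x \<in> {s<..<p} \<union> {q<..<t}" for x
  proof
    assume "anti (c x) = 0"
    then have "x \<in> Z"
      using that pq by (auto simp: Z_def)
    with p(2) q(2) have "p \<le> x" "x \<le> q" by blast+
    with that show False by auto
  qed
  have int: "(\<lambda>x. cmod (u x)) integrable_on {s..t}"
    using c sub integrable_on_subinterval unfolding controlled_path_def by blast
  have "calib b (c p) - calib b (c s) \<le> integral {s..p} (\<lambda>x. cmod (u x))"
    using ab pq b pos nz by (intro calib_increment_off_axis[OF c]) auto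
  moreover have "calib b (c t) - calib b (c q) \<le> integral {q..t} (\<lambda>x. cmod (u x))"
    using ab pq b pos nz by (intro calib_increment_off_axis[OF c]) auto
  moreover have "calib b (c q) - calib b (c p) \<le> integral {p..q} (\<lambda>x. cmod (u x))"
  proof -
    have "calib b (c q) = b * angle (c q)" "calib b (c p) = b * angle (c p)"
      using p q by (auto simp: calib_def Z_def radius_def)
    moreover have "0 \<le> integral {p..q} (\<lambda>x. cmod (u x))"
      using int pq by (intro integral_nonneg integrable_on_subinterval[OF int]) auto
    moreover have "b \<noteq> 0 \<Longrightarrow> b * angle (c q) - b * angle (c p) \<le> integral {p..q} (\<lambda>x. cmod (u x))"
      using ab pq b pos by (intro angle_increment[OF c]) auto
    ultimately show ?thesis
      by (cases "b = 0") auto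
  qed
  moreover have "integral {s..t} (\<lambda>x. cmod (u x)) = integral {s..p} (\<lambda>x. cmod (u x)) +
      integral {p..q} (\<lambda>x. cmod (u x)) + integral {q..t} (\<lambda>x. cmod (u x))"
    using pq Henstock_Kurzweil_Integration.integral_combine[of s q t, OF _ _ int]
      Henstock_Kurzweil_Integration.integral_combine[of s p q "\<lambda>x. cmod (u x)"] integrable_on_subinterval[OF int, of s q]
    by auto
  ultimately show ?thesis
    by linarith
qed

section \<open>Lower bounds for the distance\<close>

lemma controlled_path_integral_le:
  assumes c: "controlled_path c S u L" and ab: "0 \<le> s" "s \<le> t" "t \<le> 1"
  shows "(\<lambda>x. cmod (u x)) integrable_on {s..t}" "integral {s..t} (\<lambda>x. cmod (u x)) \<le> L"
proof -
  have int: "((\<lambda>x. cmod (u x)) has_integral L) {0..1}"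
    using c by (simp add: controlled_path_def)
  show *: "(\<lambda>x. cmod (u x)) integrable_on {s..t}"
    by (rule integrable_on_subinterval[OF has_integral_integrable[OF int]]) (use ab in auto)
  show "integral {s..t} (\<lambda>x. cmod (u x)) \<le> L"
    by (rule has_integral_subset_le[OF _ integrable_integral[OF *] int]) (use ab in auto)
qed

lemma controlled_path_radius_le:
  assumes c: "controlled_path c S u L" and t: "t \<in> {0..1}"
  shows "radius (c t) \<le> radius (c 0) + L"
  using calib_increment[OF c, of 0 t 0] controlled_path_integral_le(2)[OF c, of 0 t] t
  by (simp add: calib_zero)

lemma controlled_path_hol_diff:
  assumes c: "controlled_path c S u L" and t: "t \<in> {0..1}"
  shows "cmod (hol (c t) - hol (c 0)) \<le> L * (sinh ((radius (c 0) + L) / 2) / 2)"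
proof -
  define K where "K = sinh ((radius (c 0) + L) / 2) / 2"
  define D where "D x = (if x \<in> S then 0 else anti (c x) * cnj (u x) / 2)" for x
  have L: "0 \<le> L"
    using c by (auto simp: controlled_path_def intro: has_integral_nonneg)
  then have K: "0 \<le> K"
    by (simp add: K_def)
  have fin: "finite S"
    using c by (simp add: controlled_path_def)
  have "(D has_integral (hol (c t) - hol (c 0))) {0..t}"
  proof (rule fundamental_theorem_of_calculus_interior_strong[OF fin])
    show "continuous_on {0..t} (\<lambda>x. hol (c x))"
      using t by (intro continuous_on_subset[OF controlled_path_continuous(1)[OF c]]) auto
    fix x assume "x \<in> {0<..<t} - S"
    then show "((\<lambda>x. hol (c x)) has_vector_derivative D x) (at x)"
      using controlled_path_derivatives(1)[OF c, of x] t by (simp add: D_def)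
  qed (use t in auto)
  moreover have "cmod (D x) \<le> K * cmod (u x)" if "x \<in> {0..t}" for x
  proof -
    have "cmod (anti (c x)) = sinh (radius (c x) / 2)"
      by (simp add: sinh_radius)
    also have "\<dots> \<le> 2 * K"
      using controlled_path_radius_le[OF c, of x] that t by (simp add: K_def)
    finally have "cmod (anti (c x)) * cmod (u x) \<le> 2 * K * cmod (u x)"
      by (intro mult_right_mono) auto
    then show ?thesis
      using K by (simp add: D_def norm_mult norm_divide)
  qed
  ultimately have "cmod (hol (c t) - hol (c 0)) \<le> integral {0..t} (\<lambda>x. K * cmod (u x))"
    using integral_norm_bound_integral[of D "{0..t}" "\<lambda>x. K * cmod (u x)"]
      integrable_on_mult_right[OF controlled_path_integral_le(1)[OF c, of 0 t], of K] t
    by (auto simp: integral_unique has_integral_integrable)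
  also have "\<dots> \<le> K * L"
    using controlled_path_integral_le(2)[OF c, of 0 t] t K by (simp add: mult_left_mono)
  finally show ?thesis
    by (simp add: K_def mult.commute)
qed

lemma sinh_le_double: "0 \<le> x \<Longrightarrow> x \<le> 1 \<Longrightarrow> sinh x \<le> 2 * (x::real)"
proof -
  assume x: "0 \<le> x" "x \<le> 1"
  have "exp x \<le> 1 + x + x\<^sup>2" "1 - x \<le> exp (- x)"
    using exp_bound[OF x] exp_ge_add_one_self[of "- x"] by auto
  moreover have "x\<^sup>2 \<le> x"
    using x by (simp add: power2_eq_square mult_left_le)
  ultimately show "sinh x \<le> 2 * x"
    using x by (simp add: sinh_field_def field_simps)
qed

lemma joined_path_hol_near_1:
  assumes "controlled_path c S u L" "c 0 = mat 1" "t \<in> {0..1}" "L \<le> l" "l \<le> 1"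
  shows "cmod (hol (c t) - 1) \<le> L * (l / 2)"
proof -
  have L: "0 \<le> L"
    using assms(1) by (auto simp: controlled_path_def intro: has_integral_nonneg)
  have "cmod (hol (c t) - 1) \<le> L * (sinh (L / 2) / 2)"
    using controlled_path_hol_diff[OF assms(1,3)] assms(2) by (simp add: radius_def)
  also have "\<dots> \<le> L * (l / 2)"
    using sinh_le_double[of "L / 2"] L assms by (intro mult_left_mono) auto
  finally show ?thesis .
qed

lemma cc_distance_radius_le:
  assumes "g \<in> SL2" "h \<in> SL2"
  shows "radius h \<le> radius g + cc_distance g h"
proof -
  have "radius h - radius g \<le> cc_distance g h"
  proof (rule cc_distance_ge[OF assms])
    fix L assume "joined g h L"
    then obtain c S u where "controlled_path c S u L" "c 0 = g" "c 1 = h"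
      by (auto simp: joined_def)
    then show "radius h - radius g \<le> L"
      using controlled_path_radius_le[of c S u L 1] by simp
  qed
  then show ?thesis by simp
qed

lemma radius_le_cc_distance: "g \<in> SL2 \<Longrightarrow> radius g \<le> cc_distance (mat 1) g"
  using cc_distance_radius_le[of "mat 1" g] by (simp add: radius_def)

lemma cc_distance_hol_near_1:
  assumes "g \<in> SL2" "cc_distance (mat 1) g < l" "l \<le> 1"
  shows "cmod (hol g - 1) \<le> l * (l / 2)"
proof -
  obtain L where L: "joined (mat 1) g L" "L < l"
    using cc_distance_less[OF SL2_mat1 assms(1,2)] .
  then obtain c S u where c: "controlled_path c S u L" "c 0 = mat 1" "c 1 = g"
    by (auto simp: joined_def)
  have "0 \<le> L"
    by (rule joined_nonneg[OF L(1)])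
  then have "L * (l / 2) \<le> l * (l / 2)"
    using L by (intro mult_right_mono) auto
  then show ?thesis
    using joined_path_hol_near_1[OF c(1,2), of 1 l] L c(3) assms(3) by auto
qed

text \<open>
  The calibration is a local lower bound for the distance. The bound \<open>l\<close> confines all competing paths to
  a region where the argument of \<open>hol\<close> is a smooth function and the calibration has slope at most \<open>1\<close>.
\<close>

lemma cc_distance_calib_le:
  assumes SL: "g \<in> SL2" "h \<in> SL2"
    and l: "cc_distance (mat 1) g + cc_distance g h < l" "l \<le> 1"
    and b: "\<bar>b\<bar> * tanh (l / 2) \<le> 1"
  shows "calib b h - calib b g \<le> cc_distance g h"
proof (rule ccontr)
  assume *: "\<not> ?thesis"
  obtain M where M: "joined (mat 1) g M" "M < l - cc_distance g h"
    using cc_distance_less[of "mat 1" g "l - cc_distance g h"] SL l by auto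
  obtain L where L: "joined g h L" "L < calib b h - calib b g" "L < l - M"
    using cc_distance_less[of g h "min (calib b h - calib b g) (l - M)"] SL * M by auto
  obtain c0 S0 u0 where c0: "controlled_path c0 S0 u0 M" "c0 0 = mat 1" "c0 1 = g"
    using M by (auto simp: joined_def)
  obtain c S u where c: "controlled_path c S u L" "c 0 = g" "c 1 = h"
    using L by (auto simp: joined_def)
  have nonneg: "0 \<le> L" "0 \<le> M"
    using L M joined_nonneg by blast+
  have rg: "radius g \<le> M"
    using controlled_path_radius_le[OF c0(1), of 1] c0 by (simp add: radius_def)
  have "\<bar>b\<bar> * tanh (radius (c x) / 2) \<le> 1" if "x \<in> {0..1}" for x
  proof -
    have "tanh (radius (c x) / 2) \<le> tanh (l / 2)"
      using controlled_path_radius_le[OF c(1) that] c rg L by simp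
    then have "\<bar>b\<bar> * tanh (radius (c x) / 2) \<le> \<bar>b\<bar> * tanh (l / 2)"
      by (intro mult_left_mono) auto
    with b show ?thesis by linarith
  qed
  moreover have "Re (hol (c x)) > 0" if "x \<in> {0..1}" for x
  proof -
    have "cmod (hol g - 1) \<le> M * (l / 2)"
      using joined_path_hol_near_1[OF c0(1,2), of 1 l] c0 L nonneg l by simp
    moreover have "cmod (hol (c x) - hol g) \<le> L * (l / 2)"
    proof -
      have "cmod (hol (c x) - hol g) \<le> L * (sinh ((radius g + L) / 2) / 2)"
        using controlled_path_hol_diff[OF c(1) that] c by simp
      also have "\<dots> \<le> L * (l / 2)"
        using sinh_le_double[of "(radius g + L) / 2"] rg nonneg L l by (intro mult_left_mono) auto
      finally show ?thesis .
    qed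
    moreover have "cmod (hol (c x) - 1) \<le> cmod (hol (c x) - hol g) + cmod (hol g - 1)"
      using norm_triangle_ineq[of "hol (c x) - hol g" "hol g - 1"] by simp
    moreover have "(M + L) * (l / 2) \<le> 1 * (1 / 2)"
      using nonneg L l by (intro mult_mono) auto
    ultimately have "cmod (hol (c x) - 1) \<le> 1 / 2"
      by (simp add: algebra_simps)
    then show ?thesis
      using abs_Re_le_cmod[of "hol (c x) - 1"] by simp
  qed
  ultimately have "calib b (c 1) - calib b (c 0) \<le> integral {0..1} (\<lambda>x. cmod (u x))"
    by (intro calib_increment[OF c(1)]) auto
  also have "\<dots> \<le> L"
    by (intro controlled_path_integral_le(2)[OF c(1)]) auto
  finally show False
    using c L by simp
qed

section \<open>Arcs in polar coordinates\<close>

text \<open>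
  The rate of growth of the radius along an arc of curvature \<open>b\<close>, at distance \<open>x\<close> from its start. It is the
  cosine of the angle between the arc and the radial direction.
\<close>

definition radial_speed :: "real \<Rightarrow> real \<Rightarrow> real" where
  "radial_speed b x = sqrt (1 - b\<^sup>2 * (tanh (x / 2))\<^sup>2)"

text \<open>
  Length and angle, as functions of the radius reached, of an arc of curvature \<open>b\<close> that starts at the
  unit.
\<close>

definition arc_length :: "real \<Rightarrow> real \<Rightarrow> real" where
  "arc_length b r = integral {0..r} (\<lambda>x. 1 / radial_speed b x)"

definition arc_angle :: "real \<Rightarrow> real \<Rightarrow> real" where
  "arc_angle b r = integral {0..r} (\<lambda>x. b * (tanh (x / 2))\<^sup>2 / radial_speed b x)"

lemma eikonal_eq: "eikonal b r = integral {0..r} (radial_speed b)"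
  by (simp add: eikonal_def radial_speed_def[abs_def])

lemma tanh_half_mono:
  assumes "\<bar>b\<bar> * tanh (r / 2) < c" "x \<le> r"
  shows "\<bar>b\<bar> * tanh (x / 2) < (c::real)"
proof -
  have "\<bar>b\<bar> * tanh (x / 2) \<le> \<bar>b\<bar> * tanh (r / 2)"
    using assms by (intro mult_left_mono) auto
  with assms show ?thesis by linarith
qed

lemma radial_speed_pos:
  assumes "\<bar>b\<bar> * tanh (r / 2) < 1" "0 \<le> x" "x \<le> r"
  shows "0 < radial_speed b x" "(radial_speed b x)\<^sup>2 = 1 - b\<^sup>2 * (tanh (x / 2))\<^sup>2"
proof -
  have "(\<bar>b\<bar> * tanh (x / 2))\<^sup>2 < 1"
    using tanh_half_mono[OF assms(1,3)] assms(2) by (intro power_less_one_iff[THEN iffD2]) (auto simp: abs_mult)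
  then have "b\<^sup>2 * (tanh (x / 2))\<^sup>2 < 1"
    by (simp add: power_mult_distrib)
  then show "0 < radial_speed b x" "(radial_speed b x)\<^sup>2 = 1 - b\<^sup>2 * (tanh (x / 2))\<^sup>2"
    by (simp_all add: radial_speed_def)
qed

lemma continuous_on_radial_speed: "continuous_on A (radial_speed b)"
  unfolding radial_speed_def[abs_def] by (intro continuous_intros) (auto simp: cosh_real_nonzero)

lemma continuous_on_arc_integrands:
  assumes "\<bar>b\<bar> * tanh (r / 2) < 1"
  shows "continuous_on {0..r} (\<lambda>x. 1 / radial_speed b x)"
    "continuous_on {0..r} (\<lambda>x. b * (tanh (x / 2))\<^sup>2 / radial_speed b x)"
  using radial_speed_pos(1)[OF assms]
  by (force intro!: continuous_intros continuous_on_radial_speed simp: cosh_real_nonzero)+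

text \<open>
  Along its own arcs the calibration is the arc length.
\<close>

lemma arc_length_eq:
  assumes "\<bar>b\<bar> * tanh (r / 2) < 1"
  shows "arc_length b r = b * arc_angle b r + eikonal b r"
proof -
  have "arc_length b r = integral {0..r} (\<lambda>x. b * (b * (tanh (x / 2))\<^sup>2 / radial_speed b x) + radial_speed b x)"
    unfolding arc_length_def
  proof (rule integral_cong)
    fix x assume "x \<in> {0..r}"
    then show "1 / radial_speed b x = b * (b * (tanh (x / 2))\<^sup>2 / radial_speed b x) + radial_speed b x"
      using radial_speed_pos[OF assms, of x] by (simp add: field_simps power2_eq_square)
  qed
  also have "\<dots> = b * arc_angle b r + eikonal b r"
    unfolding arc_angle_def eikonal_eq
    by (intro integral_unique has_integral_add has_integral_mult_right integrable_integral
         integrable_continuous_real continuous_on_arc_integrands assms continuous_on_radial_speed)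
  finally show ?thesis .
qed

lemma radial_speed_DERIV:
  assumes "radial_speed b x > 0"
  shows "(radial_speed b has_real_derivative
     - (b * tanh (x / 2)) * (b * (1 - (tanh (x / 2))\<^sup>2) / (2 * radial_speed b x))) (at x within A)"
proof -
  have "1 - b\<^sup>2 * (tanh (x / 2))\<^sup>2 > 0"
    using assms by (simp add: radial_speed_def)
  then show ?thesis
    unfolding radial_speed_def[abs_def]
    by (auto intro!: derivative_eq_intros simp: cosh_real_nonzero field_simps power2_eq_square)
qed

lemma constant_if_derivative_zero:
  fixes f :: "real \<Rightarrow> real"
  assumes "\<And>x. x \<in> {0..r} \<Longrightarrow> (f has_real_derivative 0) (at x within {0..r})" "0 \<le> r"
  shows "f r = f 0"
  using has_field_derivative_zero_constant[of "{0..r}" f] assms by fastforce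

lemma arc_profile_identity:
  fixes s :: real
  assumes "th * ch = sh" "s\<^sup>2 = 1 - b\<^sup>2 * th\<^sup>2" "s > 0"
  shows "sh / 2 * s + - (b * th) * (b * (1 - th\<^sup>2) / (2 * s)) * ch = (1 - b\<^sup>2) / 4 * (2 * sh) * (1 / s)"
proof -
  have "sh / 2 * s + - (b * th) * (b * (1 - th\<^sup>2) / (2 * s)) * ch
      = (sh * s\<^sup>2 - b\<^sup>2 * (th * ch) * (1 - th\<^sup>2)) / (2 * s)"
    using assms(3) by (simp add: field_simps power2_eq_square)
  also have "sh * s\<^sup>2 - b\<^sup>2 * (th * ch) * (1 - th\<^sup>2) = (1 - b\<^sup>2) * sh"
    unfolding assms(1,2) by (simp add: algebra_simps)
  finally show ?thesis
    using assms(3) by simp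
qed

text \<open>
  The right-hand sides, as functions of the radius, and the functions \<open>arcS\<close> and \<open>arcC\<close> of the arc length solve
  the same linear system with the same initial values. Uniqueness follows from two first integrals of
  the pair of solutions.
\<close>

lemma arc_radius:
  assumes adm: "\<bar>b\<bar> * tanh (r / 2) < 1" and r: "0 \<le> r"
  shows "arcS b (arc_length b r) = 2 * sinh (r / 2)"
    "arcC b (arc_length b r) = cosh (r / 2) * radial_speed b r"
proof -
  define T P Q where "T = arc_length b" and "P x = cosh (x / 2) * radial_speed b x"
    and "Q x = 2 * sinh (x / 2)" for x :: real
  have T: "(T has_real_derivative 1 / radial_speed b x) (at x within {0..r})" if "x \<in> {0..r}" for x
    unfolding T_def arc_length_def using that
    by (intro integral_has_real_derivative continuous_on_arc_integrands adm)
  have C: "((\<lambda>x. arcC b (T x)) has_real_derivative arcK b * arcS b (T x) * (1 / radial_speed b x)) (at x within {0..r})"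
    and S: "((\<lambda>x. arcS b (T x)) has_real_derivative arcC b (T x) * (1 / radial_speed b x)) (at x within {0..r})"
    if "x \<in> {0..r}" for x
    by (rule DERIV_chain2[OF arc_DERIV(1) T[OF that]] DERIV_chain2[OF arc_DERIV(2) T[OF that]])+
  have dQ: "(Q has_real_derivative P x * (1 / radial_speed b x)) (at x within {0..r})" if "x \<in> {0..r}" for x
    unfolding Q_def[abs_def] P_def using radial_speed_pos[OF adm, of x] that
    by (auto intro!: derivative_eq_intros)
  have dP: "(P has_real_derivative arcK b * Q x * (1 / radial_speed b x)) (at x within {0..r})" if "x \<in> {0..r}" for x
  proof -
    have s: "radial_speed b x > 0" "(radial_speed b x)\<^sup>2 = 1 - b\<^sup>2 * (tanh (x / 2))\<^sup>2"
      using radial_speed_pos[OF adm, of x] that by auto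
    have "(P has_real_derivative sinh (x / 2) / 2 * radial_speed b x +
        - (b * tanh (x / 2)) * (b * (1 - (tanh (x / 2))\<^sup>2) / (2 * radial_speed b x)) * cosh (x / 2)) (at x within {0..r})"
      unfolding P_def[abs_def]
      by (rule DERIV_mult[OF _ radial_speed_DERIV[OF s(1)]]) (auto intro!: derivative_eq_intros)
    moreover have "sinh (x / 2) / 2 * radial_speed b x +
        - (b * tanh (x / 2)) * (b * (1 - (tanh (x / 2))\<^sup>2) / (2 * radial_speed b x)) * cosh (x / 2) =
        arcK b * Q x * (1 / radial_speed b x)"
      unfolding arcK_def Q_def
      by (rule arc_profile_identity[OF _ s(2,1)]) (simp add: tanh_def cosh_real_nonzero)
    ultimately show ?thesis by simp
  qed
  have zero: "T 0 = 0" "Q 0 = 0" "P 0 = 1"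
    by (simp_all add: T_def Q_def P_def arc_length_def radial_speed_def)
  have "P r * arcC b (T r) - arcK b * Q r * arcS b (T r) = P 0 * arcC b (T 0) - arcK b * Q 0 * arcS b (T 0)"
  proof (rule constant_if_derivative_zero[OF _ r])
    fix x assume x: "x \<in> {0..r}"
    show "((\<lambda>x. P x * arcC b (T x) - arcK b * Q x * arcS b (T x)) has_real_derivative 0) (at x within {0..r})"
      using x by (auto intro!: derivative_eq_intros dP dQ C S simp: algebra_simps)
  qed
  then have 1: "P r * arcC b (T r) - arcK b * Q r * arcS b (T r) = 1"
    by (simp add: zero)
  have "Q r * arcC b (T r) - P r * arcS b (T r) = Q 0 * arcC b (T 0) - P 0 * arcS b (T 0)"
  proof (rule constant_if_derivative_zero[OF _ r])
    fix x assume x: "x \<in> {0..r}"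
    show "((\<lambda>x. Q x * arcC b (T x) - P x * arcS b (T x)) has_real_derivative 0) (at x within {0..r})"
      using x by (auto intro!: derivative_eq_intros dP dQ C S simp: algebra_simps)
  qed
  then have 2: "Q r * arcC b (T r) - P r * arcS b (T r) = 0"
    by (simp add: zero)
  have 3: "(arcC b (T r))\<^sup>2 - arcK b * (arcS b (T r))\<^sup>2 = 1"
    by (rule arc_square)
  have "arcC b (T r) = P r" "arcS b (T r) = Q r"
    using 1 2 3 by algebra+
  then show "arcS b (arc_length b r) = 2 * sinh (r / 2)"
    "arcC b (arc_length b r) = cosh (r / 2) * radial_speed b r"
    by (simp_all add: T_def P_def Q_def)
qed

text \<open>
  With \<open>s = radial_speed b x\<close> and \<open>t = b * tanh (x / 2)\<close> the complex number \<open>Complex s (- t)\<close> has norm \<open>1\<close>,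
  and it turns at the rate that the angle defect \<open>psi\<close> compensates. So their product is constant.
\<close>

lemma arc_hol_polar:
  assumes adm: "\<bar>b\<bar> * tanh (r / 2) < 1" and r: "0 \<le> r"
  shows "arc_hol b (arc_length b r) = of_real (cosh (r / 2)) * cis (arc_angle b r / 2)"
proof -
  define psi where "psi x = (b * arc_length b x - arc_angle b x) / 2" for x
  define w where "w x = b * (1 - (tanh (x / 2))\<^sup>2) / (2 * radial_speed b x)" for x
  define t where "t x = b * tanh (x / 2)" for x
  define s where "s = radial_speed b"
  have ds: "(s has_real_derivative - t x * w x) (at x within {0..r})" if "x \<in> {0..r}" for x
    using radial_speed_DERIV[of b x "{0..r}"] radial_speed_pos[OF adm, of x] that
    by (simp add: s_def t_def w_def)
  (* s and t rotate into each other with angular velocity w *)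
  have dt: "(t has_real_derivative s x * w x) (at x within {0..r})" if "x \<in> {0..r}" for x
    unfolding t_def[abs_def] s_def w_def using radial_speed_pos[OF adm, of x] that
    by (auto intro!: derivative_eq_intros simp: cosh_real_nonzero)
  have dpsi: "(psi has_real_derivative w x) (at x within {0..r})" if "x \<in> {0..r}" for x
  proof -
    have "(psi has_real_derivative (b * (1 / radial_speed b x) - b * (tanh (x / 2))\<^sup>2 / radial_speed b x) / 2) (at x within {0..r})"
      unfolding psi_def[abs_def] arc_length_def arc_angle_def using that
      by (intro DERIV_cdivide DERIV_diff DERIV_cmult integral_has_real_derivative continuous_on_arc_integrands adm)
    then show ?thesis
      by (rule DERIV_cong) (simp add: w_def diff_divide_distrib right_diff_distrib)
  qed
  have zero: "psi 0 = 0" "t 0 = 0" "s 0 = 1"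
    by (simp_all add: psi_def t_def s_def arc_length_def arc_angle_def radial_speed_def)
  have "s r * cos (psi r) + t r * sin (psi r) = s 0 * cos (psi 0) + t 0 * sin (psi 0)"
  proof (rule constant_if_derivative_zero[OF _ r])
    fix x assume x: "x \<in> {0..r}"
    show "((\<lambda>x. s x * cos (psi x) + t x * sin (psi x)) has_real_derivative 0) (at x within {0..r})"
      using x by (auto intro!: derivative_eq_intros ds dt dpsi simp: algebra_simps)
  qed
  then have 1: "s r * cos (psi r) + t r * sin (psi r) = 1"
    by (simp add: zero)
  have "s r * sin (psi r) - t r * cos (psi r) = s 0 * sin (psi 0) - t 0 * cos (psi 0)"
  proof (rule constant_if_derivative_zero[OF _ r])
    fix x assume x: "x \<in> {0..r}"
    show "((\<lambda>x. s x * sin (psi x) - t x * cos (psi x)) has_real_derivative 0) (at x within {0..r})"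
      using x by (auto intro!: derivative_eq_intros ds dt dpsi simp: algebra_simps)
  qed
  then have 2: "s r * sin (psi r) - t r * cos (psi r) = 0"
    by (simp add: zero)
  have "Complex (s r) (- t r) * cis (psi r) = 1"
    using 1 2 by (simp add: complex_eq_iff)
  then have "Complex (s r) (- t r) * cis (psi r) * cis (arc_angle b r / 2) = cis (arc_angle b r / 2)"
    by simp
  then have "Complex (s r) (- t r) * cis (b * arc_length b r / 2) = cis (arc_angle b r / 2)"
    by (simp add: mult.assoc cis_mult psi_def add_divide_distrib[symmetric])
  moreover have "Complex (arcC b (arc_length b r)) (- (b * arcS b (arc_length b r) / 2)) = of_real (cosh (r / 2)) * Complex (s r) (- t r)"
    unfolding arc_radius[OF adm r] by (simp add: complex_eq_iff s_def t_def tanh_def cosh_real_nonzero)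
  ultimately show ?thesis
    by (simp add: arc_hol_def mult.assoc)
qed

lemma geo_arc_surj:
  assumes "h \<in> SL2" "\<bar>b\<bar> * tanh (radius h / 2) < 1" "angle h = arc_angle b (radius h)"
  obtains u where "cmod u = 1" "h = geo_arc b u (arc_length b (radius h))"
proof -
  define T where "T = arc_length b (radius h)"
  define u where "u = (if anti h = 0 then 1 else sgn (anti h) * cis (b * T / 2))"
  have "anti h = cmod (anti h) * sgn (anti h)"
    by (simp add: sgn_eq)
  then have "anti h = u * arcS b T / 2 * cis (- (b * T / 2))"
    by (simp add: u_def T_def arc_radius[OF assms(2)] sinh_radius mult_ac cis_mult)
  moreover have "hol h = arc_hol b T"
    using arc_hol_polar[OF assms(2)] hol_polar[OF assms(1)] assms(3) by (simp add: T_def)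
  ultimately have "h = geo_arc b u T"
    by (simp add: parts_eq_iff geo_arc_def)
  moreover have "cmod u = 1"
    by (simp add: u_def norm_mult norm_sgn)
  ultimately show ?thesis
    using that by (simp add: T_def)
qed

lemma arc_length_nonneg:
  assumes "\<bar>b\<bar> * tanh (r / 2) < 1"
  shows "0 \<le> arc_length b r"
  unfolding arc_length_def using radial_speed_pos(1)[OF assms]
  by (intro integral_nonneg integrable_continuous_real continuous_on_arc_integrands assms)
     (auto intro: less_imp_le)

lemma arc_length_mono:
  assumes "\<bar>B\<bar> * tanh (r / 2) < 1" "\<bar>b\<bar> \<le> \<bar>B\<bar>" "0 \<le> r"
  shows "arc_length b r \<le> arc_length B r"
proof -
  have "\<bar>b\<bar> * tanh (r / 2) \<le> \<bar>B\<bar> * tanh (r / 2)"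
    using assms by (intro mult_right_mono) auto
  then have b: "\<bar>b\<bar> * tanh (r / 2) < 1"
    using assms by linarith
  have "b\<^sup>2 \<le> B\<^sup>2"
    using assms by (simp add: abs_le_square_iff)
  then have "radial_speed B x \<le> radial_speed b x" for x
    unfolding radial_speed_def by (simp add: mult_right_mono)
  then show ?thesis
    unfolding arc_length_def using radial_speed_pos(1)[OF assms(1)]
    by (intro integral_le integrable_continuous_real continuous_on_arc_integrands assms b)
       (auto intro!: divide_left_mono mult_pos_pos intro: less_le_trans)
qed

lemma continuous_on_arc_angle_integrand:
  assumes "\<And>b. b \<in> U \<Longrightarrow> \<bar>b\<bar> * tanh (r / 2) < 1"
  shows "continuous_on (U \<times> cbox 0 r) (\<lambda>(b, x). b * (tanh (x / 2))\<^sup>2 / radial_speed b x)"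
proof -
  have "radial_speed (fst p) (snd p) \<noteq> 0" if "p \<in> U \<times> cbox 0 r" for p
    using radial_speed_pos(1)[OF assms, of "fst p" "snd p"] that by auto
  then show ?thesis
    unfolding split_beta radial_speed_def
    by (intro continuous_intros) (auto simp: cosh_real_nonzero)
qed

lemma continuous_on_arc_angle:
  assumes "B * tanh (r / 2) < 1" "0 \<le> r" 
  shows "continuous_on {- B..B} (\<lambda>b. arc_angle b r)"
proof -
  have "continuous_on ({- B..B} \<times> cbox 0 r) (\<lambda>(b, x). b * (tanh (x / 2))\<^sup>2 / radial_speed b x)"
  proof (rule continuous_on_arc_angle_integrand)
    fix b assume "b \<in> {- B..B}"
    then have "\<bar>b\<bar> * tanh (r / 2) \<le> B * tanh (r / 2)"
      using assms by (intro mult_right_mono) auto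
    with assms show "\<bar>b\<bar> * tanh (r / 2) < 1" by linarith
  qed
  from integral_continuous_on_param[OF this] show ?thesis
    by (simp add: arc_angle_def)
qed

text \<open>
  A point with a small angle compared to its radius is reached by an arc: the angle at a fixed radius
  depends continuously on the curvature and takes opposite values at \<open>B\<close> and \<open>- B\<close>.
\<close>

lemma arc_angle_surj:
  assumes "B * tanh (r / 2) < 1" "0 \<le> r" "0 \<le> B" "\<bar>\<theta>\<bar> \<le> arc_angle B r"
  obtains b where "\<bar>b\<bar> \<le> B" "arc_angle b r = \<theta>"
proof -
  have "arc_angle (- B) r = - arc_angle B r"
    by (simp add: arc_angle_def radial_speed_def)
  then have "\<exists>b\<ge>- B. b \<le> B \<and> arc_angle b r = \<theta>"
    using assms by (intro IVT' continuous_on_arc_angle) auto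
  then show ?thesis
    using that by (metis abs_le_iff minus_le_iff)
qed

text \<open>
  This is the envelope relation that recovers the angle from the family of calibrations.
\<close>

lemma eikonal_DERIV_param:
  assumes b: "\<bar>b\<bar> * tanh (r / 2) < 1" and r: "0 \<le> r"
  shows "((\<lambda>b. eikonal b r) has_real_derivative - arc_angle b r) (at b)"
proof -
  define U where "U = {b. \<bar>b\<bar> * tanh (r / 2) < 1}"
  have "open U"
    unfolding U_def by (intro open_Collect_less continuous_intros)
  have "convex U"
  proof -
    have "convex {b. \<bar>b\<bar> < 1 / tanh (r / 2)}"
    proof -
      have "{b. \<bar>b\<bar> < 1 / tanh (r / 2)} = ball 0 (1 / tanh (r / 2))"
        by auto
      then show ?thesis by simp
    qed
    moreover have "U = (if r = 0 then UNIV else {b. \<bar>b\<bar> < 1 / tanh (r / 2)})"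
      using r by (auto simp: U_def field_simps)
    ultimately show ?thesis by simp
  qed
  have "((\<lambda>b. integral (cbox 0 r) (radial_speed b)) has_real_derivative
      integral (cbox 0 r) (\<lambda>x. - (b * (tanh (x / 2))\<^sup>2 / radial_speed b x))) (at b within U)"
  proof (rule leibniz_rule_field_derivative)
    fix b x assume bx: "b \<in> U" "x \<in> cbox 0 r"
    then have s: "radial_speed b x > 0"
      using radial_speed_pos(1)[of b r x] by (auto simp: U_def)
    then have "1 - b\<^sup>2 * (tanh (x / 2))\<^sup>2 > 0"
      by (simp add: radial_speed_def)
    then show "((\<lambda>b. radial_speed b x) has_real_derivative - (b * (tanh (x / 2))\<^sup>2 / radial_speed b x)) (at b within U)"
      unfolding radial_speed_def by (auto intro!: derivative_eq_intros simp: field_simps)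
  next
    show "radial_speed b integrable_on cbox 0 r" for b
      by (intro integrable_continuous continuous_on_radial_speed)
    show "continuous_on (U \<times> cbox 0 r) (\<lambda>(b, x). - (b * (tanh (x / 2))\<^sup>2 / radial_speed b x))"
      using continuous_on_minus[OF continuous_on_arc_angle_integrand[of U r]]
      by (auto simp: U_def split_beta)
  qed (use b \<open>convex U\<close> in \<open>auto simp: U_def\<close>)
  moreover have "at b within U = at b"
    using b \<open>open U\<close> by (intro at_within_open) (auto simp: U_def)
  ultimately show ?thesis
    by (simp add: eikonal_eq arc_angle_def integral_neg)
qed

section \<open>Elementary estimates\<close>

lemma tanh_bounds:
  assumes "0 \<le> x" "x \<le> (1::real)"
  shows "x / 2 \<le> tanh x" "tanh x \<le> x"
proof -
  have "tanh x - x \<le> tanh 0 - 0"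
    by (rule DERIV_nonpos_imp_nonincreasing[OF assms(1)])
       (auto intro!: exI derivative_eq_intros simp: cosh_real_nonzero)
  then show "tanh x \<le> x" by simp
  have "sinh 0 - 0 \<le> sinh x - x"
    by (rule DERIV_nonneg_imp_nondecreasing[OF assms(1)])
       (auto intro!: exI derivative_eq_intros simp: cosh_real_ge_1)
  then have s: "x \<le> sinh x" by simp
  have "1 + x + x\<^sup>2 \<le> 1 + 1 + 1"
    using assms power_le_one[OF assms, of 2] by (intro add_mono) auto
  then have "exp x \<le> 3"
    using exp_bound[OF assms] by linarith
  moreover have "exp (- x) \<le> 1"
    using assms by simp
  ultimately have "exp x + exp (- x) \<le> 3 + 1"
    by (rule add_mono)
  then have "cosh x \<le> 2"
    by (simp add: cosh_field_def)
  then have "x / 2 * cosh x \<le> x / 2 * 2"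
    using assms by (intro mult_left_mono) auto
  with s show "x / 2 \<le> tanh x"
    by (simp add: tanh_def pos_le_divide_eq cosh_real_pos)
qed

lemma inverse_sqrt_bounds:
  fixes y :: real
  assumes "0 \<le> y" "y < 1"
  shows "1 + y / 2 \<le> 1 / sqrt (1 - y)" "y \<le> 1 / 2 \<Longrightarrow> 1 / sqrt (1 - y) \<le> 1 + y"
proof -
  have "(1 + y / 2)\<^sup>2 * (1 - y) = 1 - (3 / 4 * y\<^sup>2 + y ^ 3 / 4)"
    by (simp add: power2_eq_square power3_eq_cube field_simps)
  moreover have "0 \<le> 3 / 4 * y\<^sup>2" "0 \<le> y ^ 3 / 4"
    using assms by simp_all
  then have "1 - (3 / 4 * y\<^sup>2 + y ^ 3 / 4) \<le> 1"
    by linarith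
  ultimately have "(1 + y / 2)\<^sup>2 \<le> 1 / (1 - y)"
    using assms by (simp add: pos_le_divide_eq)
  then have "1 + y / 2 \<le> sqrt (1 / (1 - y))"
    using assms by (intro real_le_rsqrt)
  then show "1 + y / 2 \<le> 1 / sqrt (1 - y)"
    by (simp add: real_sqrt_divide)
  assume y: "y \<le> 1 / 2"
  have "(1 + y)\<^sup>2 * (1 - y) = 1 + y * (1 - y - y\<^sup>2)"
    by (simp add: power2_eq_square algebra_simps)
  moreover have "y\<^sup>2 \<le> y * (1 / 2)"
    unfolding power2_eq_square using y assms by (intro mult_left_mono) auto
  then have "0 \<le> y * (1 - y - y\<^sup>2)"
    using y assms by (intro mult_nonneg_nonneg) auto
  ultimately have "1 / (1 - y) \<le> (1 + y)\<^sup>2"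
    using assms by (simp add: pos_divide_le_eq)
  then have "sqrt (1 / (1 - y)) \<le> 1 + y"
    using assms by (intro real_le_lsqrt) auto
  then show "1 / sqrt (1 - y) \<le> 1 + y"
    by (simp add: real_sqrt_divide)
qed

lemma arc_length_upper:
  assumes "0 \<le> b" "b * tanh (r / 2) \<le> \<eta>" "\<eta>\<^sup>2 \<le> 1 / 2" "0 \<le> r"
  shows "arc_length b r \<le> r * (1 + \<eta>\<^sup>2)"
proof -
  have nn: "0 \<le> b * tanh (r / 2)"
    using assms by simp
  have "\<eta>\<^sup>2 < 1\<^sup>2"
    using assms by simp
  then have "\<eta> < 1"
    by (rule power2_less_imp_less) simp
  then have adm: "\<bar>b\<bar> * tanh (r / 2) < 1"
    using assms by simp
  have "arc_length b r \<le> integral {0..r} (\<lambda>x. 1 + \<eta>\<^sup>2)"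
    unfolding arc_length_def
  proof (intro integral_le integrable_continuous_real continuous_on_arc_integrands adm)
    fix x assume x: "x \<in> {0..r}"
    have "b * tanh (x / 2) \<le> b * tanh (r / 2)"
      using x assms by (intro mult_left_mono) auto
    then have "(b * tanh (x / 2))\<^sup>2 \<le> \<eta>\<^sup>2"
      using assms x by (intro power_mono) auto
    then have "b\<^sup>2 * (tanh (x / 2))\<^sup>2 \<le> \<eta>\<^sup>2"
      by (simp add: power_mult_distrib)
    then show "1 / radial_speed b x \<le> 1 + \<eta>\<^sup>2"
      using inverse_sqrt_bounds(2)[of "b\<^sup>2 * (tanh (x / 2))\<^sup>2"] assms(3)
      by (simp add: radial_speed_def)
  qed simp
  then show ?thesis
    using assms by simp
qed

lemma tanh_half_lower: "0 \<le> x \<Longrightarrow> x \<le> 2 \<Longrightarrow> (x / 4)\<^sup>2 \<le> (tanh (x / 2))\<^sup>2" for x :: real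
  using tanh_bounds(1)[of "x / 2"] by (intro power_mono) auto

lemma integral_cubic: "0 \<le> r \<Longrightarrow> integral {0..r} (\<lambda>x. c + k * x\<^sup>2) = c * r + k * r ^ 3 / 3" for r :: real
proof -
  assume r: "0 \<le> r"
  have "((\<lambda>x. c + k * x\<^sup>2) has_integral (c * r + k * r ^ 3 / 3) - (c * 0 + k * 0 ^ 3 / 3)) {0..r}"
    using r
    by (intro fundamental_theorem_of_calculus)
       (auto intro!: derivative_eq_intros simp: has_real_derivative_iff_has_vector_derivative[symmetric])
  then show ?thesis
    by (simp add: integral_unique)
qed

lemma arc_length_lower:
  assumes "\<bar>b\<bar> * tanh (r / 2) < 1" "0 \<le> r" "r \<le> 1"
  shows "r + b\<^sup>2 * r ^ 3 / 96 \<le> arc_length b r"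
proof -
  have "integral {0..r} (\<lambda>x. 1 + b\<^sup>2 / 32 * x\<^sup>2) \<le> arc_length b r"
    unfolding arc_length_def
  proof (intro integral_le integrable_continuous_real continuous_on_arc_integrands assms)
    fix x assume x: "x \<in> {0..r}"
    have "b\<^sup>2 * (x / 4)\<^sup>2 \<le> b\<^sup>2 * (tanh (x / 2))\<^sup>2"
      using tanh_half_lower[of x] x assms by (intro mult_left_mono) auto
    moreover have "b\<^sup>2 * (tanh (x / 2))\<^sup>2 < 1"
      using radial_speed_pos[OF assms(1), of x] x by (simp add: radial_speed_def)
    ultimately show "1 + b\<^sup>2 / 32 * x\<^sup>2 \<le> 1 / radial_speed b x"
      using inverse_sqrt_bounds(1)[of "b\<^sup>2 * (tanh (x / 2))\<^sup>2"]
      by (simp add: radial_speed_def power_divide)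
  qed (intro continuous_intros)
  then show ?thesis
    unfolding integral_cubic[OF assms(2)] by simp
qed

lemma arc_angle_lower:
  assumes "b * tanh (r / 2) < 1" "0 \<le> b" "0 \<le> r" "r \<le> 1"
  shows "b * r ^ 3 / 48 \<le> arc_angle b r"
proof -
  have adm: "\<bar>b\<bar> * tanh (r / 2) < 1"
    using assms by simp
  have "integral {0..r} (\<lambda>x. 0 + b / 16 * x\<^sup>2) \<le> arc_angle b r"
    unfolding arc_angle_def
  proof (intro integral_le integrable_continuous_real continuous_on_arc_integrands adm)
    fix x assume x: "x \<in> {0..r}"
    have "b * (x / 4)\<^sup>2 \<le> b * (tanh (x / 2))\<^sup>2"
      using tanh_half_lower[of x] x assms by (intro mult_left_mono) auto
    also have "\<dots> \<le> b * (tanh (x / 2))\<^sup>2 / radial_speed b x"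
    proof -
      have "radial_speed b x \<le> 1"
        by (simp add: radial_speed_def)
      then show ?thesis
        using radial_speed_pos(1)[OF adm, of x] x assms(2)
        by (simp add: pos_le_divide_eq mult_left_le)
    qed
    finally show "0 + b / 16 * x\<^sup>2 \<le> b * (tanh (x / 2))\<^sup>2 / radial_speed b x"
      by (simp add: power_divide)
  qed (intro continuous_intros)
  then show ?thesis
    unfolding integral_cubic[OF assms(3)] by simp
qed

lemma eikonal_nonneg:
  assumes "\<bar>b\<bar> * tanh (r / 2) \<le> 1"
  shows "0 \<le> eikonal b r"
  unfolding eikonal_eq
proof (intro integral_nonneg integrable_continuous_real continuous_on_radial_speed)
  fix x assume x: "x \<in> {0..r}"
  have "\<bar>b\<bar> * tanh (x / 2) \<le> \<bar>b\<bar> * tanh (r / 2)"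
    using x by (intro mult_left_mono) auto
  then have "(\<bar>b\<bar> * tanh (x / 2))\<^sup>2 \<le> 1"
    using assms x by (intro power_le_one) auto
  then show "0 \<le> radial_speed b x"
    by (simp add: radial_speed_def power_mult_distrib)
qed

section \<open>Minimizing curves are arcs\<close>

lemma cc_distance_refl [simp]: "g \<in> SL2 \<Longrightarrow> cc_distance g g = 0"
  using cc_distance_arc_le[of 1 0 g 0] cc_distance_nonneg[of g g] by simp

lemma abs_angle_calib_le:
  assumes "m \<in> SL2" "cc_distance (mat 1) m < l" "l \<le> 1" "0 \<le> b" "b * tanh (l / 2) \<le> 1"
  shows "b * \<bar>angle m\<bar> + eikonal b (radius m) \<le> cc_distance (mat 1) m"
proof -
  have "calib c m \<le> cc_distance (mat 1) m" if "\<bar>c\<bar> = b" for c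
    using cc_distance_calib_le[of "mat 1" m l c] assms that by simp
  from this[of b] this[of "- b"] show ?thesis
    using assms(4) by (auto simp: calib_def eikonal_def abs_if)
qed

text \<open>
  The rotation angle is an area, hence quadratic in the length. The curvature \<open>1 / tanh e\<close> is the largest
  one that the calibration bound admits for \<open>l = 2 * e\<close>.
\<close>

lemma angle_le_square:
  assumes "m \<in> SL2" "cc_distance (mat 1) m \<le> e" "0 < e" "e \<le> 1 / 2"
  shows "\<bar>angle m\<bar> \<le> e\<^sup>2"
proof -
  define b where "b = 1 / tanh e"
  have b: "b * tanh e = 1" "b > 0"
    using assms by (simp_all add: b_def)
  have "radius m \<le> e"
    using radius_le_cc_distance[OF assms(1)] assms(2) by linarith
  then have "b * tanh (radius m / 2) \<le> b * tanh e"
    using b(2) radius_nonneg[of m] assms(3) by (intro mult_left_mono) (auto simp del: radius_nonneg)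
  then have "0 \<le> eikonal b (radius m)"
    using b by (intro eikonal_nonneg) auto
  moreover have "b * \<bar>angle m\<bar> + eikonal b (radius m) \<le> cc_distance (mat 1) m"
    using assms b by (intro abs_angle_calib_le[of m "2 * e"]) auto
  ultimately have "b * \<bar>angle m\<bar> \<le> e"
    using assms by linarith
  then have "\<bar>angle m\<bar> \<le> e * tanh e"
    using assms by (simp add: b_def divide_simps split: if_splits)
  also have "\<dots> \<le> e * e"
    using tanh_bounds[of e] assms by (intro mult_left_mono) auto
  finally show ?thesis
    by (simp add: power2_eq_square)
qed

lemma reach_by_arc:
  assumes h: "h \<in> SL2" and b: "0 \<le> B" "B * tanh (radius h / 2) < 1" "\<bar>angle h\<bar> \<le> arc_angle B (radius h)"
  obtains b u where "\<bar>b\<bar> \<le> B" "cmod u = 1" "\<bar>b\<bar> * tanh (radius h / 2) < 1"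
    "h = geo_arc b u (arc_length b (radius h))" "arc_length b (radius h) = calib b h"
proof -
  obtain b where b': "\<bar>b\<bar> \<le> B" "arc_angle b (radius h) = angle h"
    using arc_angle_surj[OF b(2) _ b(1,3)] by auto
  have "\<bar>b\<bar> * tanh (radius h / 2) \<le> B * tanh (radius h / 2)"
    using b'(1) by (intro mult_right_mono) auto
  then have adm: "\<bar>b\<bar> * tanh (radius h / 2) < 1"
    using b by linarith
  obtain u where "cmod u = 1" "h = geo_arc b u (arc_length b (radius h))"
    using geo_arc_surj[OF h adm] b' by metis
  moreover have "arc_length b (radius h) = calib b h"
    using arc_length_eq[OF adm] b' by (simp add: calib_def)
  ultimately show ?thesis
    using that b' adm by blast
qed

lemma cc_distance_le_arc_length:
  assumes h: "h \<in> SL2" and b: "0 \<le> B" "B * tanh (radius h / 2) < 1" "\<bar>angle h\<bar> \<le> arc_angle B (radius h)"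
  shows "cc_distance (mat 1) h \<le> arc_length B (radius h)"
proof -
  obtain b u where *: "\<bar>b\<bar> \<le> B" "cmod u = 1" "\<bar>b\<bar> * tanh (radius h / 2) < 1"
    "h = geo_arc b u (arc_length b (radius h))"
    using reach_by_arc[OF assms] by metis
  have "cc_distance (mat 1) (mat 1 ** geo_arc b u (arc_length b (radius h))) \<le> arc_length b (radius h)"
    using * by (intro cc_distance_arc_le arc_length_nonneg) auto
  then have "cc_distance (mat 1) h \<le> arc_length b (radius h)"
    using *(4) by simp
  also have "\<dots> \<le> arc_length B (radius h)"
    using * b by (intro arc_length_mono) auto
  finally show ?thesis .
qed

text \<open>
  The calibration bound at the two ends forces \<open>calib b (g t) = t\<close> for all intermediate \<open>t\<close>. For other
  curvatures \<open>c\<close> only \<open>calib c (g t) \<le> t\<close> is known, so \<open>b\<close> maximizes \<open>c \<mapsto> calib c (g t)\<close>. The vanishing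
  derivative says that \<open>g t\<close> has the angle, and then the radius, of the point of the arc at time \<open>t\<close>.
\<close>

lemma calibrated_curve_hol:
  assumes SL: "\<And>t. t \<in> {0..l} \<Longrightarrow> g t \<in> SL2"
    and dist: "\<And>s t. 0 \<le> s \<Longrightarrow> s \<le> t \<Longrightarrow> t \<le> l \<Longrightarrow> cc_distance (g s) (g t) = t - s"
    and g0: "g 0 = mat 1" and l: "0 < l" "l \<le> 1 / 2"
    and b: "\<bar>b\<bar> * tanh l \<le> 1 / 2" and cal: "calib b (g l) = l" and t: "t \<in> {0..l}"
  shows "hol (g t) = arc_hol b t"
proof -
  have d0: "cc_distance (mat 1) (g t) = t"
    using dist[of 0 t] t g0 by simp
  have le: "calib c (g t) \<le> t" if "\<bar>c\<bar> * tanh l \<le> 1" for c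
    using cc_distance_calib_le[of "mat 1" "g t" "2 * l" c] that SL t l d0 by simp
  have ge: "t \<le> calib b (g t)"
    using cc_distance_calib_le[of "g t" "g l" "2 * l" b] SL t l d0 b cal dist[of t l] by simp
  have r: "radius (g t) \<le> l"
    using radius_le_cc_distance[OF SL[OF t]] d0 t by simp
  have "\<bar>b\<bar> * tanh (radius (g t) / 2) \<le> \<bar>b\<bar> * tanh l"
    using r radius_nonneg[of "g t"] l by (intro mult_left_mono) (auto simp del: radius_nonneg)
  then have adm: "\<bar>b\<bar> * tanh (radius (g t) / 2) < 1"
    using b by linarith
  have eq: "calib b (g t) = t"
    using le[of b] ge b by simp
  have "((\<lambda>c. calib c (g t)) has_real_derivative angle (g t) - arc_angle b (radius (g t))) (at b)"
    unfolding calib_def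
    by (rule derivative_eq_intros eikonal_DERIV_param adm radius_nonneg refl)+ simp
  moreover have "\<forall>c. \<bar>b - c\<bar> < 1 / 2 \<longrightarrow> calib c (g t) \<le> calib b (g t)"
  proof (intro allI impI)
    fix c assume "\<bar>b - c\<bar> < 1 / 2"
    then have "\<bar>c\<bar> \<le> \<bar>b\<bar> + 1 / 2"
      by linarith
    then have "\<bar>c\<bar> * tanh l \<le> (\<bar>b\<bar> + 1 / 2) * tanh l"
      using l by (intro mult_right_mono) auto
    also have "\<dots> \<le> 1"
      using b tanh_real_lt_1[of l] by (simp add: distrib_right)
    finally show "calib c (g t) \<le> calib b (g t)"
      using le eq by simp
  qed
  ultimately have "angle (g t) - arc_angle b (radius (g t)) = 0"
    by (intro DERIV_local_max[of "\<lambda>c. calib c (g t)" _ b "1 / 2"]) auto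
  then have ang: "angle (g t) = arc_angle b (radius (g t))"
    by simp
  then have "arc_length b (radius (g t)) = t"
    using arc_length_eq[OF adm] eq by (simp add: calib_def)
  then show ?thesis
    using arc_hol_polar[OF adm] hol_polar[OF SL[OF t]] ang by simp
qed

lemma arc_hol_minus: "arc_hol (- b) t = arc_hol b (- t)"
  by (simp add: arc_hol_def arc_minus)

lemma calib_inv:
  assumes "h \<in> SL2" "Re (hol h) > 0"
  shows "calib (- b) (matrix_inv h) = calib b h"
proof -
  have "Ln (cnj (hol h)) = cnj (Ln (hol h))"
    using assms(2) by (intro cnj_Ln[symmetric]) (auto simp: complex_nonpos_Reals_iff)
  then have "angle (matrix_inv h) = - angle h"
    using assms by (simp add: angle_def SL2_inv_eq)
  then show ?thesis
    using assms by (simp add: calib_def eikonal_def radius_def SL2_inv_eq)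
qed

text \<open>
  If the radius \<open>r\<close> of the end point is almost the length, then the calibration bound keeps its angle so
  small that some arc ends at the same point \<open>h\<close>, and this arc is as long as the curve. The lemma
  \<open>calibrated_curve_hol\<close>, applied from the start and, after reversal, from \<open>h\<close>, gives \<open>hol (g t)\<close> and
  \<open>hol (matrix_inv h ** g t)\<close>. These two numbers determine \<open>g t\<close>, because \<open>anti h\<close> does not vanish.
\<close>

lemma straight_minimizer_is_arc:
  assumes SL: "\<And>t. t \<in> {0..l} \<Longrightarrow> g t \<in> SL2"
    and dist: "\<And>s t. 0 \<le> s \<Longrightarrow> s \<le> t \<Longrightarrow> t \<le> l \<Longrightarrow> cc_distance (g s) (g t) = t - s"
    and g0: "g 0 = mat 1" and l: "0 < l" "l \<le> 1 / 2"
    and straight: "999 / 1000 * l \<le> radius (g l)"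
  obtains b u where "cmod u = 1" "\<And>t. t \<in> {0..l} \<Longrightarrow> g t = geo_arc b u t"
proof -
  define h where "h = g l"
  define r where "r = radius h"
  (* half of the largest curvature that the calibration bound admits for 2 * l, so that neighbouring curvatures are admitted too *)
  define B where "B = 1 / (2 * tanh l)"
  have h: "h \<in> SL2" "cc_distance (mat 1) h = l"
    using SL[of l] dist[of 0 l] l g0 by (auto simp: h_def)
  have B: "0 \<le> B" "B * tanh l = 1 / 2"
    using l by (simp_all add: B_def)
  have r: "r \<le> l" "0 < r"
    using radius_le_cc_distance[OF h(1)] h straight l by (auto simp: r_def h_def)
  have "B * tanh (r / 2) \<le> B * tanh l"
    using B r l by (intro mult_left_mono) auto
  then have adm: "B * tanh (r / 2) < 1"
    using B by linarith
  (* arcs of curvature B are longer than the curve: the excess factor of the length beats 1000 / 999 *)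
  have "l \<le> r + B\<^sup>2 * r ^ 3 / 96"
  proof -
    have "1 / (2 * l) \<le> B"
      unfolding B_def using tanh_bounds[of l] l by (intro divide_left_mono) auto
    then have "1 / (2 * l) * (9 / 10 * l) \<le> B * r"
      using straight l r B(1) by (intro mult_mono) (auto simp: r_def h_def)
    then have "(9 / 20)\<^sup>2 \<le> (B * r)\<^sup>2"
      using l by (intro power_mono) auto
    then have "r * (9 / 20)\<^sup>2 \<le> r * (B * r)\<^sup>2"
      using r by (intro mult_left_mono) auto
    then have "r * (81 / 400) / 96 \<le> B\<^sup>2 * r ^ 3 / 96"
      by (simp add: power_mult_distrib power2_eq_square power3_eq_cube mult_ac)
    moreover have "999 / 1000 * l \<le> r"
      using straight by (simp add: r_def h_def)
    ultimately show ?thesis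
      using r by linarith
  qed
  also have "\<dots> \<le> arc_length B r"
    using adm B r l by (intro arc_length_lower) auto
  also have "\<dots> = B * arc_angle B r + eikonal B r"
    using adm B by (intro arc_length_eq) auto
  finally have "l \<le> B * arc_angle B r + eikonal B r" .
  moreover have "B * \<bar>angle h\<bar> + eikonal B r \<le> l"
    using abs_angle_calib_le[of h "2 * l" B] h l B by (simp add: r_def)
  ultimately have "B * \<bar>angle h\<bar> \<le> B * arc_angle B r"
    by linarith
  moreover have "B > 0"
    using l by (simp add: B_def)
  ultimately have "\<bar>angle h\<bar> \<le> arc_angle B r"
    by simp
  then obtain b u where b: "\<bar>b\<bar> \<le> B" "cmod u = 1" "\<bar>b\<bar> * tanh (r / 2) < 1"
    "h = geo_arc b u (arc_length b r)" "arc_length b r = calib b h"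
    using reach_by_arc[OF h(1) B(1)] adm by (metis r_def)
  have bl: "\<bar>b\<bar> * tanh l \<le> 1 / 2"
    using mult_right_mono[OF b(1), of "tanh l"] B l by simp
  have "l \<le> arc_length b r"
    using cc_distance_arc_le[OF b(2) arc_length_nonneg[OF b(3)] SL2_mat1, of b] b(4) h by simp
  moreover have "calib b h \<le> l"
    using cc_distance_calib_le[of "mat 1" h "2 * l" b] h l bl by simp
  ultimately have len: "arc_length b r = l" "calib b h = l"
    using b(5) by linarith+
  have hb: "h = geo_arc b u l"
    using b(4) unfolding len(1) .
  have hol: "hol (g t) = arc_hol b t" if "t \<in> {0..l}" for t
    using len(2) unfolding h_def by (intro calibrated_curve_hol[OF SL dist g0 l bl _ that])
  have pos: "Re (hol h) > 0"
  proof -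
    have "cmod (hol h - 1) \<le> 2 * l * (2 * l / 2)"
      using h l by (intro cc_distance_hol_near_1) auto
    also have "\<dots> \<le> 1 * (1 / 2)"
      using l by (intro mult_mono) auto
    finally show ?thesis
      using abs_Re_le_cmod[of "hol h - 1"] by simp
  qed
  (* the reversed curve, moved to start at the unit *)
  have hol': "hol (matrix_inv h ** g t) = arc_hol (- b) (l - t)" if "t \<in> {0..l}" for t
  proof -
    have "hol ((\<lambda>t. matrix_inv h ** g (l - t)) (l - t)) = arc_hol (- b) (l - t)"
    proof (rule calibrated_curve_hol[where l = l])
      show "cc_distance (matrix_inv h ** g (l - s)) (matrix_inv h ** g (l - t)) = t - s" if "0 \<le> s" "s \<le> t" "t \<le> l" for s t
        using that SL h dist[of "l - t" "l - s"] by (simp add: cc_distance_left cc_distance_sym[of "g (l - s)"])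
      show "calib (- b) (matrix_inv h ** g (l - l)) = l"
        using calib_inv[OF h(1) pos] len g0 by simp
    qed (use SL h l bl that in \<open>auto simp: h_def\<close>)
    then show ?thesis by simp
  qed
  have "g t = geo_arc b u t" if t: "t \<in> {0..l}" for t
  proof -
    have "geo_arc b u t = h ** geo_arc b (u * cis (- b * l)) (t - l)"
      using geo_arc_shift[OF b(2), of b l "t - l"] hb by simp
    then have "hol (matrix_inv h ** geo_arc b u t) = arc_hol b (t - l)"
      using h by (simp add: geo_arc_def)
    then have "hol (matrix_inv h ** g t) = hol (matrix_inv h ** geo_arc b u t)"
      using hol'[OF t] by (simp add: arc_hol_minus)
    moreover have "hol (g t) = hol (geo_arc b u t)"
      using hol[OF t] by (simp add: geo_arc_def)
    ultimately have "anti h * cnj (anti (g t)) = anti h * cnj (anti (geo_arc b u t))"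
      using h by (simp add: hol_inv_mult)
    moreover have "anti h \<noteq> 0"
      using r by (auto simp: r_def radius_def)
    ultimately show ?thesis
      using \<open>hol (g t) = hol (geo_arc b u t)\<close> by (simp add: parts_eq_iff)
  qed
  then show ?thesis
    using that b by blast
qed

definition minimizing :: "(real \<Rightarrow> mat2) \<Rightarrow> real \<Rightarrow> real \<Rightarrow> bool" where
  "minimizing \<gamma> a b \<longleftrightarrow>
     (\<forall>t\<in>{a..b}. \<gamma> t \<in> SL2) \<and>
     (\<forall>s t. a \<le> s \<longrightarrow> s \<le> t \<longrightarrow> t \<le> b \<longrightarrow> cc_distance (\<gamma> s) (\<gamma> t) = t - s)"

text \<open>
  The hyperbolic distance between the projections of two points of the curve.
\<close>

definition chord :: "(real \<Rightarrow> mat2) \<Rightarrow> real \<Rightarrow> real \<Rightarrow> real" where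
  "chord \<gamma> s t = radius (matrix_inv (\<gamma> s) ** \<gamma> t)"

lemma minimizing_SL2: "minimizing \<gamma> a b \<Longrightarrow> t \<in> {a..b} \<Longrightarrow> \<gamma> t \<in> SL2"
  by (simp add: minimizing_def)

lemma minimizing_dist:
  "minimizing \<gamma> a b \<Longrightarrow> a \<le> s \<Longrightarrow> s \<le> t \<Longrightarrow> t \<le> b \<Longrightarrow> cc_distance (\<gamma> s) (\<gamma> t) = t - s"
  by (simp add: minimizing_def)

lemma minimizing_subset: "minimizing \<gamma> a b \<Longrightarrow> a \<le> c \<Longrightarrow> d \<le> b \<Longrightarrow> minimizing \<gamma> c d"
  by (auto simp: minimizing_def)

lemma cc_distance_inv_left:
  "g \<in> SL2 \<Longrightarrow> h \<in> SL2 \<Longrightarrow> cc_distance (mat 1) (matrix_inv g ** h) = cc_distance g h"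
  using cc_distance_left[of "matrix_inv g" g h] by simp

lemma minimizing_dist_inv:
  assumes "minimizing \<gamma> a b" "a \<le> s" "s \<le> t" "t \<le> b"
  shows "matrix_inv (\<gamma> s) ** \<gamma> t \<in> SL2" "cc_distance (mat 1) (matrix_inv (\<gamma> s) ** \<gamma> t) = t - s"
  using minimizing_SL2[OF assms(1), of s] minimizing_SL2[OF assms(1), of t] minimizing_dist[OF assms] assms
  by (simp_all add: cc_distance_inv_left)

lemma straight_minimizing_is_arc:
  assumes min: "minimizing \<gamma> s t" and st: "s < t" "t - s \<le> 1 / 2"
    and straight: "999 / 1000 * (t - s) \<le> chord \<gamma> s t"
  shows "\<exists>g b u. g \<in> SL2 \<and> cmod u = 1 \<and> (\<forall>x\<in>{s..t}. \<gamma> x = g ** geo_arc b u x)"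
proof -
  have SL: "\<gamma> x \<in> SL2" if "x \<in> {s..t}" for x
    using minimizing_SL2[OF min that] .
  define g where "g x = matrix_inv (\<gamma> s) ** \<gamma> (s + x)" for x
  obtain b u where u: "cmod u = 1" and bu: "\<And>x. x \<in> {0..t - s} \<Longrightarrow> g x = geo_arc b u x"
  proof (rule straight_minimizer_is_arc[of "t - s" g])
    show "g x \<in> SL2" if "x \<in> {0..t - s}" for x
      using that SL st by (simp add: g_def)
    show "cc_distance (g x) (g y) = y - x" if "0 \<le> x" "x \<le> y" "y \<le> t - s" for x y
      using that SL st minimizing_dist[OF min, of "s + x" "s + y"] by (simp add: g_def cc_distance_left)
    show "g 0 = mat 1"
      using SL st by (simp add: g_def)
    show "999 / 1000 * (t - s) \<le> radius (g (t - s))"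
      using straight by (simp add: g_def chord_def)
  qed (use st in auto)
  have "\<gamma> x = (\<gamma> s ** geo_arc b u (- s)) ** geo_arc b (u * cis (- b * (- s))) x" if x: "x \<in> {s..t}" for x
  proof -
    have "matrix_inv (\<gamma> s) ** \<gamma> x = geo_arc b u (- s + x)"
      using bu[of "x - s"] x by (simp add: g_def)
    then have "\<gamma> s ** (matrix_inv (\<gamma> s) ** \<gamma> x) = \<gamma> s ** geo_arc b u (- s + x)"
      by simp
    then show ?thesis
      using SL[of s] st unfolding geo_arc_shift[OF u] by (simp add: matrix_mul_assoc)
  qed
  moreover have "\<gamma> s ** geo_arc b u (- s) \<in> SL2"
    using SL[of s] st u by (simp add: geo_arc_SL2)
  moreover have "cmod (u * cis (- b * (- s))) = 1"
    using u by (simp add: norm_mult)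
  ultimately show ?thesis
    by (intro exI[of _ "\<gamma> s ** geo_arc b u (- s)"] exI[of _ b] exI[of _ "u * cis (- b * (- s))"] conjI ballI)
qed

section \<open>Minimizing curves contain almost straight pieces\<close>

lemma radius_mult_rot [simp]: "radius (g ** rot \<phi>) = radius g"
  by (simp add: radius_def anti_mult norm_mult)

lemma radius_mult_le:
  assumes "g \<in> SL2" "h \<in> SL2"
  shows "radius (g ** h) \<le> radius g + radius h"
proof -
  obtain u where u: "cmod u = 1" "h = geo_arc 0 u (radius h) ** rot (angle h / 2)"
    using polar_decomposition[OF assms(2)] .
  have "radius (g ** h) = radius (g ** geo_arc 0 u (radius h))"
    by (subst u(2)) (simp add: matrix_mul_assoc)
  also have "\<dots> \<le> radius g + cc_distance g (g ** geo_arc 0 u (radius h))"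
    using assms u by (intro cc_distance_radius_le) (auto simp: geo_arc_SL2)
  also have "\<dots> \<le> radius g + radius h"
    using cc_distance_arc_le[OF u(1), of "radius h" g 0] assms by simp
  finally show ?thesis .
qed

lemma rot_mult_segment: "rot \<phi> ** geo_arc 0 u x = geo_arc 0 (u * cis (2 * \<phi>)) x ** rot \<phi>"
proof -
  have "cis (- (2 * \<phi>)) * cis (2 * \<phi>) = 1" "cis \<phi> = cis (2 * \<phi>) * cis (- \<phi>)"
    by (simp_all add: cis_mult)
  then show ?thesis
    by (simp add: parts_eq_iff hol_mult anti_mult geo_arc_0 cis_cnj)
qed

lemma cc_distance_rot_le:
  assumes "P \<in> SL2"
  shows "cc_distance P (P ** rot (\<theta> / 2)) \<le> rot_cost \<theta>"
proof -
  obtain b where "rot (\<theta> / 2) = geo_arc b 1 (rot_cost \<theta>)"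
    by (rule geo_arc_full_circle)
  then show ?thesis
    using cc_distance_arc_le[of 1 "rot_cost \<theta>" P b] assms by (simp add: rot_cost_nonneg)
qed

lemma rot_cost_mono: "\<bar>x\<bar> \<le> \<bar>y\<bar> \<Longrightarrow> rot_cost x \<le> rot_cost y"
  unfolding rot_cost_def
  by (intro mult_left_mono real_sqrt_le_mono diff_mono power_mono add_mono divide_right_mono) auto

lemma isCont_rot_cost: "isCont rot_cost x"
  unfolding rot_cost_def[abs_def] by (intro continuous_intros) auto

lemma rot_cost_0 [simp]: "rot_cost 0 = 0"
  by (simp add: rot_cost_def)

text \<open>
  Replace each of the \<open>n\<close> pieces of the curve by its polar decomposition. As rotations move past segments
  (\<open>rot_mult_segment\<close>), they collect at the end of the product, and what remains is a polygon \<open>P\<close> of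
  chords.
\<close>

lemma polygon_approximation:
  assumes min: "minimizing \<gamma> a (a + real n * e)" and e: "0 < e" "e \<le> 1 / 2"
    and short: "\<And>i. i < n \<Longrightarrow> chord \<gamma> (a + real i * e) (a + real (Suc i) * e) \<le> k * e"
    and "i \<le> n"
  shows "\<exists>P \<phi>. P \<in> SL2 \<and> matrix_inv (\<gamma> a) ** \<gamma> (a + real i * e) = P ** rot \<phi> \<and>
    cc_distance (mat 1) P \<le> real i * (k * e) \<and> \<bar>\<phi>\<bar> \<le> real i * e\<^sup>2"
  using \<open>i \<le> n\<close>
proof (induction i)
  case 0
  have "\<gamma> a \<in> SL2"
    using minimizing_SL2[OF min, of a] e by simp
  then show ?case
    by (intro exI[of _ "mat 1"] exI[of _ 0]) simp
next
  case (Suc i)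
  then obtain P \<phi> where P: "P \<in> SL2" "matrix_inv (\<gamma> a) ** \<gamma> (a + real i * e) = P ** rot \<phi>"
    "cc_distance (mat 1) P \<le> real i * (k * e)" "\<bar>\<phi>\<bar> \<le> real i * e\<^sup>2"
    by auto
  define s t where "s = a + real i * e" and "t = a + real (Suc i) * e"
  define m where "m = matrix_inv (\<gamma> s) ** \<gamma> t"
  have "real (Suc i) * e \<le> real n * e"
    using Suc.prems e by (intro mult_right_mono) auto
  then have st: "a \<le> s" "s \<le> t" "t \<le> a + real n * e"
    using e by (simp_all add: s_def t_def algebra_simps)
  have SL: "\<gamma> s \<in> SL2" "\<gamma> t \<in> SL2"
    using minimizing_SL2[OF min] st by auto
  have ts: "t - s = e"
    by (simp add: s_def t_def algebra_simps)
  have m: "m \<in> SL2" "cc_distance (mat 1) m = e"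
    using minimizing_dist_inv[OF min st] ts by (simp_all add: m_def)
  have rm: "radius m \<le> k * e"
    using short[of i] Suc.prems by (simp add: m_def chord_def s_def t_def)
  have am: "\<bar>angle m\<bar> \<le> e\<^sup>2"
    using m e by (intro angle_le_square) auto
  obtain u where u: "cmod u = 1" "m = geo_arc 0 u (radius m) ** rot (angle m / 2)"
    using polar_decomposition[OF m(1)] .
  define Q where "Q = P ** geo_arc 0 (u * cis (2 * \<phi>)) (radius m)"
  have u': "cmod (u * cis (2 * \<phi>)) = 1"
    using u by (simp add: norm_mult)
  have "matrix_inv (\<gamma> a) ** \<gamma> t = (matrix_inv (\<gamma> a) ** \<gamma> s) ** m"
    using SL by (simp add: m_def matrix_mul_assoc[symmetric])
  also have "\<dots> = P ** (rot \<phi> ** geo_arc 0 u (radius m)) ** rot (angle m / 2)"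
    using P(2) by (subst u(2)) (simp add: s_def matrix_mul_assoc)
  also have "\<dots> = Q ** rot (\<phi> + angle m / 2)"
    unfolding rot_mult_segment Q_def by (simp add: matrix_mul_assoc[symmetric] rot_add)
  finally have 1: "matrix_inv (\<gamma> a) ** \<gamma> t = Q ** rot (\<phi> + angle m / 2)" .
  have Q: "Q \<in> SL2"
    using P u' by (simp add: Q_def geo_arc_SL2)
  have "cc_distance (mat 1) Q \<le> cc_distance (mat 1) P + cc_distance P Q"
    using P Q by (intro cc_distance_triangle) auto
  also have "\<dots> \<le> real i * (k * e) + radius m"
    using P(3) cc_distance_arc_le[OF u', of "radius m" P 0] P(1) by (simp add: Q_def)
  also have "\<dots> \<le> real (Suc i) * (k * e)"
    using rm by (simp add: algebra_simps)
  finally have 2: "cc_distance (mat 1) Q \<le> real (Suc i) * (k * e)" .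
  have 3: "\<bar>\<phi> + angle m / 2\<bar> \<le> real (Suc i) * e\<^sup>2"
    using P(4) am by (simp add: algebra_simps)
  show ?case
    using 1 2 3 Q unfolding t_def by blast
qed

text \<open>
  If all chords were shorter than the curve by a fixed factor, then so would be the polygons. The rotations that
  they miss add up to an angle of order \<open>1 / n\<close>, whose cost tends to zero.
\<close>

lemma straight_pair_exists:
  assumes min: "minimizing \<gamma> a b" and ab: "a < b" "b - a \<le> 1 / 2"
  shows "\<exists>s t. a \<le> s \<and> s < t \<and> t \<le> b \<and> 999 / 1000 * (t - s) \<le> chord \<gamma> s t"
proof (rule ccontr)
  assume "\<not> ?thesis"
  then have bent: "chord \<gamma> s t \<le> 999 / 1000 * (t - s)" if "a \<le> s" "s < t" "t \<le> b" for s t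
    using that by (meson less_imp_le not_le)
  define l where "l = b - a"
  have "(\<lambda>n. 2 * l\<^sup>2 * inverse (real (Suc n))) \<longlonglongrightarrow> 2 * l\<^sup>2 * 0"
    by (intro tendsto_intros LIMSEQ_inverse_real_of_nat)
  from isCont_tendsto_compose[OF isCont_rot_cost this]
  have "(\<lambda>n. rot_cost (2 * l\<^sup>2 * inverse (real (Suc n)))) \<longlonglongrightarrow> rot_cost 0"
    by (simp only: mult_zero_right)
  then have "\<forall>\<^sub>F n in sequentially. rot_cost (2 * l\<^sup>2 * inverse (real (Suc n))) < l / 1000"
    using ab by (intro order_tendstoD(2)) (auto simp: l_def)
  then obtain n' where n': "rot_cost (2 * l\<^sup>2 * inverse (real (Suc n'))) < l / 1000"
    by (auto simp: eventually_sequentially)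
  define n e where "n = Suc n'" and "e = l / real n"
  have n: "real n * e = l" "real n \<ge> 1"
    by (simp_all add: n_def e_def)
  have e: "0 < e" "e \<le> 1 / 2"
    using ab n by (simp_all add: e_def l_def divide_le_eq)
  have "\<exists>P \<phi>. P \<in> SL2 \<and> matrix_inv (\<gamma> a) ** \<gamma> (a + real n * e) = P ** rot \<phi> \<and>
    cc_distance (mat 1) P \<le> real n * (999 / 1000 * e) \<and> \<bar>\<phi>\<bar> \<le> real n * e\<^sup>2"
  proof (rule polygon_approximation[of _ _ n])
    show "minimizing \<gamma> a (a + real n * e)"
      using min n by (simp add: l_def)
    show "chord \<gamma> (a + real i * e) (a + real (Suc i) * e) \<le> 999 / 1000 * e" if "i < n" for i
    proof -
      have "real (Suc i) * e \<le> real n * e"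
        using that e by (intro mult_right_mono) auto
      then show ?thesis
        using bent[of "a + real i * e" "a + real (Suc i) * e"] e n(1) by (simp add: l_def algebra_simps)
    qed
  qed (use e in auto)
  then obtain P \<phi> where P: "P \<in> SL2" "matrix_inv (\<gamma> a) ** \<gamma> b = P ** rot \<phi>"
    "cc_distance (mat 1) P \<le> real n * (999 / 1000 * e)" "\<bar>\<phi>\<bar> \<le> real n * e\<^sup>2"
    using n(1) by (auto simp: l_def)
  have "l = cc_distance (mat 1) (P ** rot \<phi>)"
    using minimizing_dist_inv(2)[OF min, of a b] ab P(2) by (simp add: l_def)
  also have "\<dots> \<le> cc_distance (mat 1) P + cc_distance P (P ** rot \<phi>)"
    using P by (intro cc_distance_triangle) auto
  also have "\<dots> \<le> 999 / 1000 * l + rot_cost (2 * \<phi>)"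
    using P(3) cc_distance_rot_le[OF P(1), of "2 * \<phi>"] n(1) by (simp add: algebra_simps)
  also have "rot_cost (2 * \<phi>) \<le> rot_cost (2 * l\<^sup>2 * inverse (real (Suc n')))"
  proof (rule rot_cost_mono)
    have "real n * e\<^sup>2 = l\<^sup>2 * inverse (real n)"
      using n by (simp add: e_def power2_eq_square divide_inverse)
    then show "\<bar>2 * \<phi>\<bar> \<le> \<bar>2 * l\<^sup>2 * inverse (real (Suc n'))\<bar>"
      using P(4) by (simp add: n_def abs_mult)
  qed
  finally show False
    using n' by linarith
qed

lemma arc_near_0:
  obtains x0 where "0 < x0" "\<And>x. 0 \<le> x \<Longrightarrow> x \<le> x0 \<Longrightarrow> 3 / 4 * x \<le> arcS b x"
    "\<And>x. 0 \<le> x \<Longrightarrow> x \<le> x0 \<Longrightarrow> \<bar>Im (arc_hol b x)\<bar> \<le> \<bar>b\<bar> * x ^ 3"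
proof -
  have "isCont (arcC b) 0"
    using arc_DERIV(1) by (rule DERIV_isCont)
  then have "\<exists>d>0. \<forall>x. \<bar>x\<bar> < d \<longrightarrow> dist (arcC b x) 1 < 1 / 4"
    unfolding continuous_at_eps_delta dist_real_def arc_0 diff_0_right by (elim allE[of _ "1 / 4"]) simp
  then obtain x0 where x0: "x0 > 0" "\<And>x. \<bar>x\<bar> < x0 \<Longrightarrow> \<bar>arcC b x - 1\<bar> < 1 / 4"
    by (auto simp: dist_real_def)
  have S: "3 / 4 * x \<le> arcS b x \<and> arcS b x \<le> 5 / 4 * x" if x: "0 \<le> x" "x < x0" for x
  proof (cases "x = 0")
    case False
    then obtain z where z: "0 < z" "z < x" "arcS b x - arcS b 0 = (x - 0) * arcC b z"
      using MVT2[of 0 x "arcS b" "arcC b"] arc_DERIV(2) x by auto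
    have "\<bar>arcC b z - 1\<bar> < 1 / 4"
      using x0(2)[of z] z x by simp
    then have "3 / 4 \<le> arcC b z" "arcC b z \<le> 5 / 4"
      by linarith+
    then have "x * (3 / 4) \<le> x * arcC b z" "x * arcC b z \<le> x * (5 / 4)"
      using x by (intro mult_left_mono; simp)+
    then show ?thesis
      using z(3) by simp
  qed simp
  have d: "((\<lambda>t. Im (arc_hol b t)) has_real_derivative arcS b t / 4 * sin (b * t / 2)) (at t)" for t
  proof -
    have A: "((\<lambda>t. Im (hol (geo_arc b 1 t))) has_vector_derivative Im (hol (geo_arc b 1 t ** horiz (1 * cis (- b * t))))) (at t)"
      by (intro bounded_linear.has_vector_derivative[OF bounded_linear_compose[OF bounded_linear_Im bounded_linear_hol]]
            geo_arc_has_vector_derivative) simp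
    have "hol (geo_arc b 1 t ** horiz (1 * cis (- b * t))) = of_real (arcS b t / 4) * cis (b * t / 2)"
      by (simp add: hol_mult geo_arc_def cis_cnj cis_mult)
    then have "Im (hol (geo_arc b 1 t ** horiz (1 * cis (- b * t)))) = Im (of_real (arcS b t / 4) * cis (b * t / 2))"
      by (rule arg_cong)
    also have "\<dots> = arcS b t / 4 * sin (b * t / 2)"
      by simp
    finally show ?thesis
      using A by (simp only: has_real_derivative_iff_has_vector_derivative geo_arc_def hol_of_parts)
  qed
  have "\<bar>Im (arc_hol b x)\<bar> \<le> \<bar>b\<bar> * x ^ 3" if x: "0 \<le> x" "x < x0" for x
  proof (cases "x = 0")
    case False
    then obtain z where z: "0 < z" "z < x"
      "Im (arc_hol b x) - Im (arc_hol b 0) = (x - 0) * (arcS b z / 4 * sin (b * z / 2))"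
      using MVT2[of 0 x "\<lambda>t. Im (arc_hol b t)", OF _ d] x by (auto simp: less_le)
    have "\<bar>arcS b z / 4 * sin (b * z / 2)\<bar> \<le> x * (\<bar>b\<bar> * x)"
      unfolding abs_mult
    proof (rule mult_mono)
      show "\<bar>arcS b z / 4\<bar> \<le> x"
        using S[of z] z x by auto
      have "\<bar>sin (b * z / 2)\<bar> \<le> \<bar>b * z / 2\<bar>"
        by (rule abs_sin_x_le_abs_x)
      also have "\<dots> \<le> \<bar>b\<bar> * x"
        using z mult_left_mono[of "z / 2" x "\<bar>b\<bar>"] by (simp add: abs_mult)
      finally show "\<bar>sin (b * z / 2)\<bar> \<le> \<bar>b\<bar> * x" .
    qed (use x in auto)
    then have "x * \<bar>arcS b z / 4 * sin (b * z / 2)\<bar> \<le> x * (x * (\<bar>b\<bar> * x))"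
      using x by (intro mult_left_mono) auto
    moreover have "Im (arc_hol b x) = x * (arcS b z / 4 * sin (b * z / 2))"
      using z(3) by (simp add: arc_hol_def)
    then have "\<bar>Im (arc_hol b x)\<bar> = x * \<bar>arcS b z / 4 * sin (b * z / 2)\<bar>"
      by (simp only: abs_mult[of x] abs_of_nonneg[OF x(1)])
    moreover have "x * (x * (\<bar>b\<bar> * x)) = \<bar>b\<bar> * x ^ 3"
      by (simp add: power3_eq_cube)
    ultimately show ?thesis
      by linarith
  qed (simp add: arc_hol_def)
  then show ?thesis
    using that[of "x0 / 2"] S x0(1) by auto
qed

lemma angle_le_Im:
  assumes "cmod (hol p - 1) \<le> 1 / 2"
  shows "\<bar>angle p\<bar> \<le> 4 * \<bar>Im (hol p)\<bar>"
proof -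
  have Re: "1 / 2 \<le> Re (hol p)"
    using assms abs_Re_le_cmod[of "hol p - 1"] by simp
  then have "hol p \<noteq> 0"
    by auto
  with Re have "angle p = 2 * arctan (Im (hol p) / Re (hol p))"
    using arg_conv_arctan[of "hol p"] Arg_eq_Im_Ln[of "hol p"] by (auto simp: angle_def)
  then have "\<bar>angle p\<bar> \<le> 2 * (\<bar>Im (hol p)\<bar> / Re (hol p))"
    using abs_arctan_le[of "Im (hol p) / Re (hol p)"] Re by (simp add: abs_mult)
  also have "\<dots> \<le> 2 * (\<bar>Im (hol p)\<bar> / (1 / 2))"
    using Re by (intro mult_left_mono divide_left_mono) auto
  finally show ?thesis by simp
qed

text \<open>
  Look at the triangle with vertices \<open>t - N * d\<close>, \<open>t\<close> and \<open>t + d\<close> for a large \<open>N\<close> and a tiny \<open>d\<close>. On its long side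
  the curve is an arc, nearly straight at this scale, so that the rotation angle between the extreme
  points is only of order \<open>N * d\<^sup>2\<close>. Over a chord of length about \<open>N * d\<close> an arc of curvature about
  \<open>1 / (N * (N * d))\<close> absorbs this angle, at an extra length of order \<open>d / N\<close>. Minimality then forces the
  chord of the extreme points to be almost \<open>(N + 1) * d\<close>, and the triangle inequality leaves almost
  \<open>2 * d\<close> for the chord from \<open>t - d\<close> to \<open>t + d\<close>.
\<close>

lemma arc_extends_straight:
  assumes min: "minimizing \<gamma> (t - e) (t + e)" and e: "0 < e"
    and g0: "g0 \<in> SL2" and u: "cmod u = 1"
    and arc: "\<And>x. x \<in> {t - e..t} \<Longrightarrow> \<gamma> x = g0 ** geo_arc b u x"
  shows "\<exists>d>0. d \<le> e \<and> d \<le> 1 / 4 \<and> 999 / 1000 * (2 * d) \<le> chord \<gamma> (t - d) (t + d)"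
proof -
  (* large enough that (N + 1) * \<eta>^2 stays below 2 / 1000 for \<eta> = 3072 / N *)
  define N :: real where "N = 10 ^ 10"
  obtain x0 where x0: "0 < x0" "\<And>x. 0 \<le> x \<Longrightarrow> x \<le> x0 \<Longrightarrow> 3 / 4 * x \<le> arcS b x"
    "\<And>x. 0 \<le> x \<Longrightarrow> x \<le> x0 \<Longrightarrow> \<bar>Im (arc_hol b x)\<bar> \<le> \<bar>b\<bar> * x ^ 3"
    using arc_near_0[of b] by metis
  define d where "d = min (min (e / N) (1 / (4 * N))) (min (x0 / N) (1 / ((\<bar>b\<bar> + 1) * N ^ 3)))"
  have Npos: "N > 0"
    by (simp add: N_def)
  have d0: "d > 0"
    using e x0 Npos by (simp add: d_def)
  have dl: "N * d \<le> e" "N * d \<le> 1 / 4" "N * d \<le> x0" "\<bar>b\<bar> * N ^ 3 * d \<le> 1"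
  proof -
    have "d \<le> e / N" "d \<le> 1 / (4 * N)" "d \<le> x0 / N" "d \<le> 1 / ((\<bar>b\<bar> + 1) * N ^ 3)"
      by (simp_all add: d_def)
    then show "N * d \<le> e" "N * d \<le> 1 / 4" "N * d \<le> x0"
      using Npos by (simp_all add: field_simps)
    have "(\<bar>b\<bar> + 1) * N ^ 3 * d \<le> 1"
      using \<open>d \<le> 1 / ((\<bar>b\<bar> + 1) * N ^ 3)\<close> Npos by (simp add: pos_le_divide_eq mult_ac add_pos_nonneg)
    moreover have "0 \<le> N ^ 3 * d"
      using Npos d0 by simp
    ultimately show "\<bar>b\<bar> * N ^ 3 * d \<le> 1"
      by (simp add: algebra_simps)
  qed
  have d1: "d \<le> N * d"
    using d0 by (simp add: N_def)
  (* g is the long side of the triangle, m the short side, p the third side, c the chord to be bounded *)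
  define x where "x = N * d"
  have x: "0 < x" "x \<le> e" "x \<le> 1 / 4" "x \<le> x0" "d \<le> x"
    using dl d0 d1 Npos by (simp_all add: x_def)
  define g m q c where "g = matrix_inv (\<gamma> (t - x)) ** \<gamma> t" and "m = matrix_inv (\<gamma> t) ** \<gamma> (t + d)"
    and "q = matrix_inv (\<gamma> (t - x)) ** \<gamma> (t - d)" and "c = matrix_inv (\<gamma> (t - d)) ** \<gamma> (t + d)"
  define p where "p = matrix_inv (\<gamma> (t - x)) ** \<gamma> (t + d)"
  have SL: "\<gamma> (t - x) \<in> SL2" "\<gamma> (t - d) \<in> SL2" "\<gamma> t \<in> SL2" "\<gamma> (t + d) \<in> SL2"
    using minimizing_SL2[OF min] x d0 by simp_all
  have g: "g \<in> SL2" "cc_distance (mat 1) g = x"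
    and m: "m \<in> SL2" "cc_distance (mat 1) m = d"
    and q: "q \<in> SL2" "cc_distance (mat 1) q = x - d"
    and p: "p \<in> SL2" "cc_distance (mat 1) p = x + d"
    using minimizing_dist_inv[OF min, of "t - x" t] minimizing_dist_inv[OF min, of t "t + d"]
      minimizing_dist_inv[OF min, of "t - x" "t - d"] minimizing_dist_inv[OF min, of "t - x" "t + d"] x d0
    by (simp_all add: g_def m_def q_def p_def)
  have c: "c \<in> SL2"
    using SL by (simp add: c_def)
  have pgm: "p = g ** m" and pqc: "p = q ** c"
    using SL by (simp_all add: p_def g_def m_def q_def c_def matrix_mul_assoc[symmetric])
  have garc: "g = geo_arc b (u * cis (- b * (t - x))) x"
  proof -
    have "\<gamma> t = g0 ** geo_arc b u ((t - x) + x)"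
      using arc[of t] e by simp
    also have "\<dots> = \<gamma> (t - x) ** geo_arc b (u * cis (- b * (t - x))) x"
      unfolding geo_arc_shift[OF u] using arc[of "t - x"] x by (simp add: matrix_mul_assoc)
    finally show ?thesis
      using SL by (simp add: g_def)
  qed
  have rg: "radius g \<le> x" and rm: "radius m \<le> d" and rq: "radius q \<le> x - d" and rp: "radius p \<le> x + d"
    using radius_le_cc_distance g m q p by metis+
  have anti: "cmod (anti h) \<le> y" if "radius h \<le> y" "y \<le> 1 / 4" for h y
  proof -
    have "cmod (anti h) = sinh (radius h / 2)"
      by (simp add: sinh_radius)
    also have "\<dots> \<le> 2 * (radius h / 2)"
      using that by (intro sinh_le_double) auto
    finally show ?thesis using that by simp
  qed
  have ag: "cmod (anti g) \<le> x" and am: "cmod (anti m) \<le> d"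
    using anti[OF rg] anti[OF rm] x by auto
  have hol2: "cmod (hol h) \<le> 2" if "h \<in> SL2" "cmod (anti h) \<le> 1" for h
  proof (rule power2_le_imp_le)
    show "(cmod (hol h))\<^sup>2 \<le> 2\<^sup>2"
      using that power_le_one[of "cmod (anti h)" 2] by (simp add: SL2_iff)
  qed simp
  have hg: "cmod (hol g) \<le> 2" and hm: "cmod (hol m) \<le> 2"
    using hol2 g m ag am x by auto
  have Ig: "\<bar>Im (hol g)\<bar> \<le> d\<^sup>2"
  proof -
    have "\<bar>Im (hol g)\<bar> \<le> \<bar>b\<bar> * x ^ 3"
      using x0(3)[of x] x garc by (simp add: geo_arc_def)
    also have "\<dots> = (\<bar>b\<bar> * N ^ 3 * d) * d\<^sup>2"
      by (simp add: x_def power2_eq_square power3_eq_cube mult_ac)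
    also have "\<dots> \<le> 1 * d\<^sup>2"
      using dl by (intro mult_right_mono) auto
    finally show ?thesis by simp
  qed
  have Im: "\<bar>Im (hol m)\<bar> \<le> d\<^sup>2"
  proof -
    have "hol m = of_real (cmod (hol m)) * cis (angle m / 2)"
      using hol_polar[OF m(1)] cosh_radius[OF m(1)] by simp
    moreover have "Im (of_real y * cis w) = y * sin w" for y w
      by simp
    ultimately have "Im (hol m) = cmod (hol m) * sin (angle m / 2)"
      by metis
    then have "\<bar>Im (hol m)\<bar> = cmod (hol m) * \<bar>sin (angle m / 2)\<bar>"
      by (simp add: abs_mult)
    also have "\<dots> \<le> 2 * \<bar>angle m / 2\<bar>"
      using hm abs_sin_x_le_abs_x[of "angle m / 2"] by (intro mult_mono) auto
    also have "\<dots> \<le> d\<^sup>2"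
      using angle_le_square[OF m(1), of d] m d0 x by simp
    finally show ?thesis .
  qed
  have "\<bar>Im (hol p)\<bar> \<le> 2 * N * d\<^sup>2"
  proof -
    have ImM: "\<bar>Im (y * z)\<bar> \<le> \<bar>Im y\<bar> * cmod z + cmod y * \<bar>Im z\<bar>" for y z
    proof -
      have "\<bar>Im (y * z)\<bar> \<le> \<bar>Im y\<bar> * \<bar>Re z\<bar> + \<bar>Re y\<bar> * \<bar>Im z\<bar>"
        by (simp add: abs_mult[symmetric])
      also have "\<dots> \<le> \<bar>Im y\<bar> * cmod z + cmod y * \<bar>Im z\<bar>"
        by (intro add_mono mult_mono abs_Re_le_cmod) auto
      finally show ?thesis .
    qed
    have "\<bar>Im (hol g * hol m)\<bar> \<le> \<bar>Im (hol g)\<bar> * cmod (hol m) + cmod (hol g) * \<bar>Im (hol m)\<bar>"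
      by (rule ImM)
    also have "\<dots> \<le> d\<^sup>2 * 2 + 2 * d\<^sup>2"
      using Ig Im hg hm by (intro add_mono mult_mono) auto
    finally have 1: "\<bar>Im (hol g * hol m)\<bar> \<le> 4 * d\<^sup>2" by simp
    have "\<bar>Im (anti g * cnj (anti m))\<bar> \<le> cmod (anti g) * cmod (anti m)"
      using abs_Im_le_cmod[of "anti g * cnj (anti m)"] by (simp add: norm_mult)
    also have "\<dots> \<le> x * d"
      using ag am x by (intro mult_mono) auto
    also have "x * d = N * d\<^sup>2"
      by (simp add: x_def power2_eq_square)
    finally have 2: "\<bar>Im (anti g * cnj (anti m))\<bar> \<le> N * d\<^sup>2" .
    have "Im (hol p) = Im (hol g * hol m) + Im (anti g * cnj (anti m))"
      by (simp only: pgm hol_mult plus_complex.sel)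
    then have "\<bar>Im (hol p)\<bar> \<le> 4 * d\<^sup>2 + N * d\<^sup>2"
      using 1 2 by linarith
    then show ?thesis
      by (simp add: N_def)
  qed
  moreover have "cmod (hol p - 1) \<le> 1 / 2"
    using cc_distance_hol_near_1[OF p(1), of 1] p x by simp
  then have "\<bar>angle p\<bar> \<le> 4 * \<bar>Im (hol p)\<bar>"
    by (rule angle_le_Im)
  ultimately have ap: "\<bar>angle p\<bar> \<le> 8 * N * d\<^sup>2"
    by simp
  define r where "r = radius p"
  have "3 / 8 * x \<le> radius g"
  proof -
    have "cmod (anti g) = arcS b x / 2"
      using u x0(2)[of x] x unfolding garc by (simp add: geo_arc_def norm_mult norm_divide)
    then have "3 / 8 * x \<le> sinh (radius g / 2)"
      using x0(2)[of x] x by (simp add: sinh_radius)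
    also have "\<dots> \<le> 2 * (radius g / 2)"
      using rg x by (intro sinh_le_double) auto
    finally show ?thesis by simp
  qed
  moreover have "radius g \<le> radius p + d"
  proof -
    have "radius g \<le> radius p + cc_distance p g"
      using p g by (intro cc_distance_radius_le)
    also have "cc_distance p g = d"
      using SL minimizing_dist[OF min, of t "t + d"] x d0
      by (simp add: p_def g_def cc_distance_left cc_distance_sym[of "\<gamma> (t + d)"])
    finally show ?thesis .
  qed
  ultimately have r: "x / 4 \<le> r" "r \<le> x + d" "0 < r" "r \<le> 1 / 2"
    using rp x d0 by (auto simp: r_def x_def N_def)
  define \<eta> :: real where "\<eta> = 3072 / N"
  define B where "B = \<eta> / tanh (r / 2)"
  have eta: "0 < \<eta>" "\<eta> < 1" "\<eta>\<^sup>2 \<le> 1 / 2"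
    by (simp_all add: \<eta>_def N_def power_divide)
  have B: "0 \<le> B" "B * tanh (r / 2) = \<eta>"
    using r eta by (simp_all add: B_def)
  (* curvature B suffices to absorb the angle of p *)
  have "8 * N * d\<^sup>2 \<le> arc_angle B r"
  proof -
    have "2 * \<eta> / r \<le> B"
      unfolding B_def using tanh_bounds(2)[of "r / 2"] r eta by (simp add: field_simps)
    then have "2 * \<eta> / r * (r ^ 3 / 48) \<le> B * (r ^ 3 / 48)"
      using r by (intro mult_right_mono) auto
    moreover have "2 * \<eta> / r * (r ^ 3 / 48) = \<eta> * r\<^sup>2 / 24"
      using r by (simp add: power2_eq_square power3_eq_cube)
    moreover have "\<eta> * (x / 4)\<^sup>2 / 24 \<le> \<eta> * r\<^sup>2 / 24"
      using r x eta by (intro divide_right_mono mult_left_mono power_mono) auto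
    moreover have "\<eta> * (x / 4)\<^sup>2 / 24 = 8 * N * d\<^sup>2"
      by (simp add: \<eta>_def x_def N_def power_mult_distrib power_divide)
    moreover have "B * r ^ 3 / 48 \<le> arc_angle B r"
      using B eta r by (intro arc_angle_lower) auto
    ultimately show ?thesis by simp
  qed
  then have "cc_distance (mat 1) p \<le> arc_length B r"
    unfolding r_def using ap B eta p by (intro cc_distance_le_arc_length) (auto simp: r_def)
  also have "\<dots> \<le> r * (1 + \<eta>\<^sup>2)"
    using B eta r by (intro arc_length_upper) auto
  also have "\<dots> \<le> ((x - d) + radius c) * (1 + \<eta>\<^sup>2)"
    using radius_mult_le[OF q(1) c] rq by (intro mult_right_mono) (auto simp: r_def pqc)
  finally have fin: "x + d \<le> ((x - d) + radius c) * (1 + \<eta>\<^sup>2)"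
    using p by simp
  have "999 / 1000 * (2 * d) \<le> radius c"
  proof (rule ccontr)
    assume "\<not> ?thesis"
    then have "((x - d) + radius c) * (1 + \<eta>\<^sup>2) \<le> ((x - d) + 999 / 1000 * (2 * d)) * (1 + \<eta>\<^sup>2)"
      by (intro mult_right_mono) auto
    with fin have "x + d \<le> ((x - d) + 999 / 1000 * (2 * d)) * (1 + \<eta>\<^sup>2)"
      by linarith
    then show False
      using d0 by (simp add: x_def \<eta>_def N_def power_divide algebra_simps)
  qed
  then show ?thesis
    using d0 x unfolding c_def chord_def by (intro exI[of _ d]) auto
qed

section \<open>Continuing an arc along a geodesic\<close>

lemma cis_eq_1_imp_0: "cis z = 1 \<Longrightarrow> \<bar>z\<bar> < pi \<Longrightarrow> z = 0"
  using Arg_cis[of z] by (simp add: abs_less_iff)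

text \<open>
  The norm of \<open>anti\<close> determines \<open>arcS\<close>, and then its argument is \<open>- b * y / 2\<close> up to the argument of \<open>u\<close>. Comparing
  the times \<open>e\<close> and \<open>e / 2\<close> separates \<open>u\<close> from \<open>b\<close>.
\<close>

lemma geo_arc_inject:
  assumes d: "0 < d" and u: "cmod u = 1" "cmod u' = 1"
    and eq: "\<And>y. y \<in> {0..d} \<Longrightarrow> geo_arc b u y = geo_arc b' u' y"
  shows "b = b'" "u = u'"
proof -
  obtain x0 where x0: "0 < x0" "\<And>x. 0 \<le> x \<Longrightarrow> x \<le> x0 \<Longrightarrow> 3 / 4 * x \<le> arcS b x"
    using arc_near_0[of b] by metis
  obtain x1 where x1: "0 < x1" "\<And>x. 0 \<le> x \<Longrightarrow> x \<le> x1 \<Longrightarrow> 3 / 4 * x \<le> arcS b' x"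
    using arc_near_0[of b'] by metis
  define e where "e = min d (min x0 x1)"
  have e: "0 < e" "e \<le> d" "e \<le> x0" "e \<le> x1"
    using d x0 x1 by (auto simp: e_def)
  have cis: "u' = u * cis ((b' - b) * y / 2)" if y: "0 < y" "y \<le> e" for y
  proof -
    have pos: "0 < arcS b y" "0 < arcS b' y"
      using x0(2)[of y] x1(2)[of y] y e by auto
    have an: "u * arcS b y / 2 * cis (- (b * y / 2)) = u' * arcS b' y / 2 * cis (- (b' * y / 2))"
      using eq[of y] y e by (simp add: geo_arc_def parts_eq_iff)
    then have "cmod (u * arcS b y / 2 * cis (- (b * y / 2))) = cmod (u' * arcS b' y / 2 * cis (- (b' * y / 2)))"
      by simp
    then have "arcS b y = arcS b' y"
      using pos u by (simp add: norm_mult norm_divide)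
    then have "u * cis (- (b * y / 2)) = u' * cis (- (b' * y / 2))"
      using an pos by simp
    then have "u * cis (- (b * y / 2)) * cis (b' * y / 2) = u' * cis (- (b' * y / 2)) * cis (b' * y / 2)"
      by simp
    then show ?thesis
      by (simp add: mult.assoc cis_mult left_diff_distrib diff_divide_distrib)
  qed
  have "u \<noteq> 0"
    using u by auto
  then have c: "cis ((b' - b) * e / 2) = cis ((b' - b) * (e / 2) / 2)"
    using cis[of e] cis[of "e / 2"] e by simp
  moreover have "cis ((b' - b) * e / 2) = cis ((b' - b) * (e / 2) / 2) * cis ((b' - b) * (e / 2) / 2)"
    unfolding cis_mult by (rule arg_cong[of _ _ cis]) (simp add: field_simps)
  ultimately have 1: "cis ((b' - b) * e / 2) = 1"
    by (metis cis_neq_zero mult_cancel_right1)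
  then show uu: "u = u'"
    using cis[of e] e by simp
  (* a time so small that the phase difference stays below pi *)
  define y where "y = min e (1 / (\<bar>b' - b\<bar> + 1))"
  have y: "0 < y" "y \<le> e" "\<bar>b' - b\<bar> * y \<le> 1"
  proof -
    show "0 < y" "y \<le> e"
      using e by (auto simp: y_def)
    have "\<bar>b' - b\<bar> * y \<le> \<bar>b' - b\<bar> * (1 / (\<bar>b' - b\<bar> + 1))"
      by (intro mult_left_mono) (auto simp: y_def)
    also have "\<dots> \<le> 1"
      by simp
    finally show "\<bar>b' - b\<bar> * y \<le> 1" .
  qed
  have "cis ((b' - b) * y / 2) = 1"
    using cis[OF y(1,2)] uu \<open>u \<noteq> 0\<close> by simp
  moreover have "\<bar>(b' - b) * y / 2\<bar> < pi"
    using y pi_gt3 by (simp add: abs_mult)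
  ultimately have "(b' - b) * y / 2 = 0"
    by (rule cis_eq_1_imp_0)
  then show "b = b'"
    using y by simp
qed

lemma arc_determined_by_interval:
  assumes st: "s < t" and g: "g \<in> SL2" "g' \<in> SL2" and u: "cmod u = 1" "cmod u' = 1"
    and eq: "\<And>x. x \<in> {s..t} \<Longrightarrow> g ** geo_arc b u x = g' ** geo_arc b' u' x"
  shows "g ** geo_arc b u x = g' ** geo_arc b' u' x"
proof -
  define k where "k = g ** geo_arc b u s"
  have k': "k = g' ** geo_arc b' u' s"
    using eq[of s] st by (simp add: k_def)
  have k: "k \<in> SL2"
    using g u by (simp add: k_def geo_arc_SL2)
  have shift: "g ** geo_arc b u x = k ** geo_arc b (u * cis (- b * s)) (x - s)"
    "g' ** geo_arc b' u' x = k ** geo_arc b' (u' * cis (- b' * s)) (x - s)" for x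
    using geo_arc_shift[OF u(1), of b s "x - s"] geo_arc_shift[OF u(2), of b' s "x - s"]
    by (simp_all add: k_def matrix_mul_assoc) (simp add: k_def[symmetric] k' matrix_mul_assoc[symmetric])
  have "geo_arc b (u * cis (- b * s)) y = geo_arc b' (u' * cis (- b' * s)) y" if "y \<in> {0..t - s}" for y
  proof -
    have "k ** geo_arc b (u * cis (- b * s)) y = k ** geo_arc b' (u' * cis (- b' * s)) y"
      using eq[of "s + y"] shift[of "s + y"] that by simp
    then have "matrix_inv k ** (k ** geo_arc b (u * cis (- b * s)) y) = matrix_inv k ** (k ** geo_arc b' (u' * cis (- b' * s)) y)"
      by simp
    then show ?thesis
      using k by simp
  qed
  from geo_arc_inject[of "t - s", OF _ _ _ this] st u
  have "b = b'" "u * cis (- b * s) = u' * cis (- b' * s)"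
    by (simp_all add: norm_mult)
  then show ?thesis
    unfolding shift by simp
qed

lemma cc_distance_eq_0_imp_eq:
  assumes "g \<in> SL2" "h \<in> SL2" "cc_distance g h \<le> 0"
  shows "g = h"
proof -
  define m where "m = matrix_inv g ** h"
  have m: "m \<in> SL2" "cc_distance (mat 1) m \<le> 0"
    using assms by (simp_all add: m_def cc_distance_inv_left)
  then have "radius m \<le> 0"
    using radius_le_cc_distance[OF m(1)] by linarith
  then have "radius m = 0"
    using radius_nonneg[of m] by linarith
  moreover have "angle m = 0"
  proof (rule ccontr)
    assume "angle m \<noteq> 0"
    define e where "e = min (1 / 2) (\<bar>angle m\<bar> / 2)"
    have e: "0 < e" "e \<le> 1 / 2" "e < \<bar>angle m\<bar>"
      using \<open>angle m \<noteq> 0\<close> by (auto simp: e_def)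
    have "\<bar>angle m\<bar> \<le> e\<^sup>2"
      using m e by (intro angle_le_square) auto
    also have "\<dots> \<le> e"
      using e by (simp add: power2_eq_square mult_left_le)
    finally show False
      using e by simp
  qed
  ultimately have "m = mat 1"
    using hol_polar[OF m(1)] sinh_radius[of m] by (simp add: parts_eq_iff)
  then have "g ** m = g" by simp
  then show ?thesis
    using assms by (simp add: m_def)
qed

text \<open>
  At the last time \<open>T\<close> of agreement the curve is almost straight across \<open>T\<close>, so it is an arc on both sides of
  \<open>T\<close>, and this arc is the given one because they overlap.
\<close>

lemma arc_continues:
  assumes SL: "\<And>t. \<gamma> t \<in> SL2"
    and lip: "\<And>s t. s \<le> t \<Longrightarrow> cc_distance (\<gamma> s) (\<gamma> t) \<le> t - s"
    and loc: "\<And>t. \<exists>e>0. minimizing \<gamma> (t - e) (t + e)"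
    and g: "g \<in> SL2" and u: "cmod u = 1" and st: "s < t"
    and arc: "\<And>x. x \<in> {s..t} \<Longrightarrow> \<gamma> x = g ** geo_arc b u x" and x: "s \<le> x"
  shows "\<gamma> x = g ** geo_arc b u x"
proof (rule ccontr)
  assume neq: "\<not> ?thesis"
  define A where "A = {y. t \<le> y \<and> (\<forall>z\<in>{s..y}. \<gamma> z = g ** geo_arc b u z)}"
  define T where "T = Sup A"
  have tA: "t \<in> A"
    using arc by (auto simp: A_def)
  have bdd: "bdd_above A"
  proof (rule bdd_aboveI)
    fix y assume "y \<in> A"
    then show "y \<le> x"
      using neq x by (force simp: A_def not_le)
  qed
  have tT: "t \<le> T"
    unfolding T_def by (rule cSup_upper[OF tA bdd])
  have before: "\<gamma> z = g ** geo_arc b u z" if z: "s \<le> z" "z < T" for z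
  proof -
    obtain y where "y \<in> A" "z < y"
      using less_cSupD[of A z] z tA by (auto simp: T_def)
    then show ?thesis
      using z by (auto simp: A_def)
  qed
  have at: "\<gamma> T = g ** geo_arc b u T"
  proof (rule cc_distance_eq_0_imp_eq)
    show "cc_distance (\<gamma> T) (g ** geo_arc b u T) \<le> 0"
    proof (rule field_le_epsilon)
      fix e :: real assume e: "0 < e"
      define z where "z = max s (T - e / 2)"
      have z: "s \<le> z" "z < T"
        using e st tT by (auto simp: z_def)
      have "T - e / 2 \<le> z"
        by (simp add: z_def)
      then have z': "T - z \<le> e / 2"
        by linarith
      have "g ** geo_arc b u T = \<gamma> z ** geo_arc b (u * cis (- b * z)) (T - z)"
        using geo_arc_shift[OF u, of b z "T - z"] before[OF z(1,2)] by (simp add: matrix_mul_assoc)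
      then have "cc_distance (\<gamma> z) (g ** geo_arc b u T) \<le> T - z"
        using cc_distance_arc_le[of "u * cis (- b * z)" "T - z" "\<gamma> z" b] u z SL by (simp add: norm_mult)
      moreover have "cc_distance (\<gamma> T) (\<gamma> z) \<le> T - z"
        using lip[of z T] z by (simp add: cc_distance_sym[of "\<gamma> T"])
      moreover have "cc_distance (\<gamma> T) (g ** geo_arc b u T) \<le> cc_distance (\<gamma> T) (\<gamma> z) + cc_distance (\<gamma> z) (g ** geo_arc b u T)"
        using SL g u by (intro cc_distance_triangle) (auto simp: geo_arc_SL2)
      ultimately show "cc_distance (\<gamma> T) (g ** geo_arc b u T) \<le> 0 + e"
        using z' by linarith
    qed
  qed (use SL g u in \<open>auto simp: geo_arc_SL2\<close>)
  have upto: "\<gamma> z = g ** geo_arc b u z" if "s \<le> z" "z \<le> T" for z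
    using before[of z] at that by (cases "z = T") auto
  obtain e0 where e0: "e0 > 0" "minimizing \<gamma> (T - e0) (T + e0)"
    using loc by blast
  define e where "e = min e0 (T - s)"
  have e: "0 < e" "e \<le> e0" "e \<le> T - s"
    using e0 st tT by (auto simp: e_def)
  have min: "minimizing \<gamma> (T - e) (T + e)"
    using minimizing_subset[OF e0(2)] e by simp
  obtain d where d: "0 < d" "d \<le> e" "d \<le> 1 / 4" "999 / 1000 * (2 * d) \<le> chord \<gamma> (T - d) (T + d)"
    using arc_extends_straight[OF min e(1) g u, of b] upto e by auto
  have min': "minimizing \<gamma> (T - d) (T + d)"
    using minimizing_subset[OF min] d by simp
  have len: "T - d < T + d" "T + d - (T - d) \<le> 1 / 2" "999 / 1000 * (T + d - (T - d)) \<le> chord \<gamma> (T - d) (T + d)"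
    using d by auto
  obtain g' b' u' where g': "g' \<in> SL2" "cmod u' = 1" "\<And>x. x \<in> {T - d..T + d} \<Longrightarrow> \<gamma> x = g' ** geo_arc b' u' x"
    using straight_minimizing_is_arc[OF min' len] by auto
  have same: "g ** geo_arc b u x = g' ** geo_arc b' u' x" for x
  proof (rule arc_determined_by_interval[of "T - d" T])
    show "g ** geo_arc b u x = g' ** geo_arc b' u' x" if "x \<in> {T - d..T}" for x
      using g'(3)[of x] upto[of x] that d e by simp
  qed (use d g g' u in auto)
  have "T + d \<in> A"
    unfolding A_def
  proof (intro CollectI conjI ballI)
    fix z assume "z \<in> {s..T + d}"
    then show "\<gamma> z = g ** geo_arc b u z"
      using upto[of z] g'(3)[of z] same d by (cases "z \<le> T") auto
  qed (use tT d in simp)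
  then have "T + d \<le> T"
    unfolding T_def by (rule cSup_upper[OF _ bdd])
  then show False
    using d by simp
qed

text \<open>
  Arcs continue to the right without end. Starting ever further to the left gives the whole curve,
  since any two of these rays overlap.
\<close>

lemma locally_minimizing_is_arc:
  assumes SL: "\<And>t. \<gamma> t \<in> SL2"
    and lip: "\<And>s t. s \<le> t \<Longrightarrow> cc_distance (\<gamma> s) (\<gamma> t) \<le> t - s"
    and loc: "\<And>t. \<exists>e>0. minimizing \<gamma> (t - e) (t + e)"
  obtains g b u where "g \<in> SL2" "cmod u = 1" "\<And>x. \<gamma> x = g ** geo_arc b u x"
proof -
  have ray: "\<exists>s g b u. s \<le> a \<and> g \<in> SL2 \<and> cmod u = 1 \<and> (\<forall>x\<ge>s. \<gamma> x = g ** geo_arc b u x)" for a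
  proof -
    obtain e0 where e0: "e0 > 0" "minimizing \<gamma> ((a - 1) - e0) ((a - 1) + e0)"
      using loc by blast
    define e where "e = min e0 (1 / 4)"
    have min: "minimizing \<gamma> ((a - 1) - e) ((a - 1) + e)"
      using minimizing_subset[OF e0(2)] by (simp add: e_def)
    have e: "0 < e" "e \<le> 1 / 4"
      using e0 by (auto simp: e_def)
    obtain s t where st: "(a - 1) - e \<le> s" "s < t" "t \<le> (a - 1) + e" "999 / 1000 * (t - s) \<le> chord \<gamma> s t"
      using straight_pair_exists[OF min] e by auto
    have min': "minimizing \<gamma> s t" "t - s \<le> 1 / 2"
      using minimizing_subset[OF min] st e by simp_all
    obtain g b u where gbu: "g \<in> SL2" "cmod u = 1" "\<And>x. x \<in> {s..t} \<Longrightarrow> \<gamma> x = g ** geo_arc b u x"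
      using straight_minimizing_is_arc[OF min'(1) st(2) min'(2) st(4)] by auto
    have "\<gamma> x = g ** geo_arc b u x" if "s \<le> x" for x
      by (rule arc_continues[OF SL lip loc gbu(1,2) st(2) gbu(3) that])
    then show ?thesis
      using gbu st e by (intro exI[of _ s] exI[of _ g] exI[of _ b] exI[of _ u]) auto
  qed
  obtain s g b u where gbu: "g \<in> SL2" "cmod u = 1" "\<And>x. s \<le> x \<Longrightarrow> \<gamma> x = g ** geo_arc b u x"
    using ray[of 0] by auto
  have "\<gamma> x = g ** geo_arc b u x" for x
  proof -
    obtain s' g' b' u' where *: "s' \<le> x" "g' \<in> SL2" "cmod u' = 1" "\<And>x. s' \<le> x \<Longrightarrow> \<gamma> x = g' ** geo_arc b' u' x"
      using ray[of x] by auto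
    have "g ** geo_arc b u x = g' ** geo_arc b' u' x"
    proof (rule arc_determined_by_interval[of "max s s'" "max s s' + 1"])
      show "g ** geo_arc b u x = g' ** geo_arc b' u' x" if "x \<in> {max s s'..max s s' + 1}" for x
        using gbu(3)[of x] *(4)[of x] that by auto
    qed (use gbu * in auto)
    then show ?thesis
      using * by simp
  qed
  then show ?thesis
    using that gbu by blast
qed

text \<open>
  Partitions with a single interval show that a geodesic does not increase distances; the triangle
  inequality makes it minimizing on every subinterval of a shortest arc.
\<close>

lemma geodesic_is_arc:
  assumes "geodesic SL2 cc_distance \<gamma>"
  obtains g b u where "g \<in> SL2" "cmod u = 1" "\<And>x. \<gamma> x = g ** geo_arc b u x"
proof (rule locally_minimizing_is_arc[of \<gamma>])
  show SL: "\<gamma> t \<in> SL2" for t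
    using assms by (auto simp: geodesic_def)
  show lip: "cc_distance (\<gamma> s) (\<gamma> t) \<le> t - s" if st: "s \<le> t" for s t
  proof -
    define \<tau> where "\<tau> i = (if i = 0 then s else t)" for i :: nat
    have "ereal (\<Sum>i<1. cc_distance (\<gamma> (\<tau> i)) (\<gamma> (\<tau> (Suc i)))) \<le> curve_length cc_distance \<gamma> s t"
      unfolding curve_length_def
      by (rule SUP_upper2[of "(1, \<tau>)"]) (use st in \<open>auto simp: \<tau>_def mono_def\<close>)
    also have "\<dots> = ereal (t - s)"
      using assms st by (simp add: geodesic_def)
    finally show ?thesis
      by (simp add: \<tau>_def)
  qed
  show "\<exists>e>0. minimizing \<gamma> (t - e) (t + e)" for t
  proof -
    obtain e where e: "0 < e" "shortest_arc cc_distance \<gamma> (t - e) (t + e)"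
      using assms unfolding geodesic_def by blast
    have "curve_length cc_distance \<gamma> (t - e) (t + e) = ereal ((t + e) - (t - e))"
      using assms e(1) by (simp add: geodesic_def)
    then have total: "cc_distance (\<gamma> (t - e)) (\<gamma> (t + e)) = 2 * e"
      using e(2) by (simp add: shortest_arc_def)
    have "cc_distance (\<gamma> x) (\<gamma> y) = y - x" if "t - e \<le> x" "x \<le> y" "y \<le> t + e" for x y
    proof -
      have "2 * e \<le> cc_distance (\<gamma> (t - e)) (\<gamma> x) + cc_distance (\<gamma> x) (\<gamma> y) + cc_distance (\<gamma> y) (\<gamma> (t + e))"
        using cc_distance_triangle[OF SL SL SL, of "t - e" "t + e" x] cc_distance_triangle[OF SL SL SL, of x "t + e" y] total
        by linarith
      then show ?thesis
        using lip[of "t - e" x] lip[of x y] lip[of y "t + e"] that by linarith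
    qed
    then show ?thesis
      using SL e by (auto simp: minimizing_def)
  qed
qed (use that in blast)

section \<open>Arcs are orbits\<close>

text \<open>
  The isometry flow whose orbit through \<open>g\<close> is the arc \<open>t \<mapsto> g ** geo_arc b u t\<close>.
\<close>

definition screw :: "mat2 \<Rightarrow> real \<Rightarrow> complex \<Rightarrow> real \<Rightarrow> mat2 \<Rightarrow> mat2" where
  "screw g b u t x = g ** exp_sub b u t ** matrix_inv g ** x ** rot (b * t / 2)"

lemma screw_SL2: "g \<in> SL2 \<Longrightarrow> cmod u = 1 \<Longrightarrow> x \<in> SL2 \<Longrightarrow> screw g b u t x \<in> SL2"
  by (simp add: screw_def exp_sub_SL2)

lemma screw_0: "g \<in> SL2 \<Longrightarrow> screw g b u 0 x = x"
  by (simp add: screw_def)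

lemma screw_add:
  assumes "g \<in> SL2" "cmod u = 1"
  shows "screw g b u (s + t) x = screw g b u s (screw g b u t x)"
proof -
  have "screw g b u s (screw g b u t x) = g ** exp_sub b u s ** (matrix_inv g ** g) ** exp_sub b u t ** matrix_inv g ** x **
      (rot (b * t / 2) ** rot (b * s / 2))"
    by (simp only: screw_def matrix_mul_assoc)
  also have "\<dots> = screw g b u (s + t) x"
    using assms by (simp add: screw_def exp_sub_add rot_add matrix_mul_assoc add_divide_distrib distrib_left add.commute)
  finally show ?thesis by simp
qed

lemma isCont_arc_parts:
  assumes "cmod u = 1"
  shows "isCont (\<lambda>t. hol (geo_arc b u t)) t" "isCont (\<lambda>t. anti (geo_arc b u t)) t"
proof -
  have c: "isCont (geo_arc b u) t"
    using geo_arc_has_vector_derivative[OF assms] by (rule has_vector_derivative_continuous)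
  show "isCont (\<lambda>t. hol (geo_arc b u t)) t" "isCont (\<lambda>t. anti (geo_arc b u t)) t"
    using bounded_linear.continuous[OF bounded_linear_hol c] bounded_linear.continuous[OF bounded_linear_anti c] .
qed

text \<open>
  By the group law it suffices to compare a point with its image for small times, and there the polar
  decomposition bounds the distance by a continuous function of the matrix entries.
\<close>

lemma screw_continuous:
  assumes g: "g \<in> SL2" and u: "cmod u = 1" and x: "x \<in> SL2"
  shows "((\<lambda>s. cc_distance (screw g b u s x) (screw g b u t x)) \<longlongrightarrow> 0) (at t)"
proof -
  define m where "m s = matrix_inv x ** screw g b u s x" for s
  define F where "F s = radius (m s) + rot_cost (angle (m s))" for s
  have m_eq: "m s = (matrix_inv x ** g) ** geo_arc b u s ** rot (- (b * s / 2)) ** (matrix_inv g ** x) ** rot (b * s / 2)" for s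
  proof -
    have "rot \<phi> ** (rot (- \<phi>) ** y) = y" for \<phi> and y :: mat2
      by (simp add: matrix_mul_assoc rot_add)
    then show ?thesis
      unfolding m_def screw_def by (simp add: geo_arc_eq_exp_sub_rot matrix_mul_assoc[symmetric])
  qed
  have cis: "isCont (\<lambda>s. cis (f s)) 0" if "isCont f 0" for f :: "real \<Rightarrow> real"
    using that unfolding isCont_def by (rule tendsto_cis)
  have hol: "isCont (\<lambda>s. hol (m s)) 0" and anti: "isCont (\<lambda>s. anti (m s)) 0"
    unfolding m_eq hol_mult anti_mult hol_rot anti_rot
    by (intro continuous_intros cis isCont_arc_parts u; simp)+
  have m0: "m 0 = mat 1"
    using x g by (simp add: m_def screw_0)
  have "isCont (\<lambda>s. Im (Ln (hol (m s)))) 0"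
    by (intro Complex.isCont_Im isCont_Ln' hol) (simp add: m0)
  then have "isCont F 0"
    unfolding F_def radius_def angle_def
    by (intro continuous_intros isCont_o2[OF _ isCont_rot_cost] anti)
  then have "isCont F (t - t)"
    by simp
  moreover have "isCont (\<lambda>s. s - t) t"
    by (intro continuous_intros)
  ultimately have "isCont (\<lambda>s. F (s - t)) t"
    by (intro isCont_o2[where f = "\<lambda>s. s - t" and g = F])
  then have lim: "((\<lambda>s. F (s - t)) \<longlongrightarrow> 0) (at t)"
    by (simp add: isCont_def F_def m0 radius_def angle_def)
  have "cc_distance (screw g b u s x) (screw g b u t x) \<le> F (s - t)" for s
  proof -
    have "cc_distance (screw g b u s x) (screw g b u t x) = cc_distance (screw g b u t (screw g b u (s - t) x)) (screw g b u t x)"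
      using screw_add[OF g u, of b t "s - t" x] by simp
    also have "\<dots> = cc_distance (screw g b u (s - t) x) x"
      unfolding screw_def[of g b u t] using g u x screw_SL2[OF g u x]
      by (intro cc_distance_translate) (auto simp: exp_sub_SL2)
    also have "\<dots> = cc_distance x (x ** m (s - t))"
      using x by (simp add: m_def cc_distance_sym)
    also have "\<dots> \<le> F (s - t)"
      unfolding F_def using x screw_SL2[OF g u x] by (intro cc_distance_polar_le) (auto simp: m_def)
    finally show ?thesis .
  qed
  then show ?thesis
    using screw_SL2[OF g u x]
    by (intro tendsto_sandwich[OF _ _ tendsto_const lim] always_eventually allI cc_distance_nonneg) auto
qed

lemma screw_subgroup:
  assumes g: "g \<in> SL2" and u: "cmod u = 1"
  shows "one_parameter_isometry_subgroup SL2 cc_distance (screw g b u)"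
proof -
  have inv: "screw g b u (- t) (screw g b u t x) = x" "screw g b u t (screw g b u (- t) x) = x" for t x
    using screw_add[OF g u, of b "- t" t x] screw_add[OF g u, of b t "- t" x] screw_0[OF g] by simp_all
  have "isometry_of SL2 cc_distance (screw g b u t)" for t
    unfolding isometry_of_def
  proof (intro conjI ballI)
    show "bij_betw (screw g b u t) SL2 SL2"
      by (rule bij_betwI[where g = "screw g b u (- t)"]) (auto simp: inv screw_SL2 g u)
    show "cc_distance (screw g b u t x) (screw g b u t y) = cc_distance x y" if "x \<in> SL2" "y \<in> SL2" for x y
      unfolding screw_def using g u that by (intro cc_distance_translate) (auto simp: exp_sub_SL2)
  qed
  then show ?thesis
    unfolding one_parameter_isometry_subgroup_def
    using screw_0[OF g] screw_add[OF g u] screw_continuous[OF g u] by auto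
qed

theorem proposition2:
  shows "geodesic_orbit_space SL2 cc_distance"
  unfolding geodesic_orbit_space_def
proof (intro allI impI)
  fix \<gamma> assume "geodesic SL2 cc_distance \<gamma>"
  then obtain g b u where g: "g \<in> SL2" and u: "cmod u = 1" and \<gamma>: "\<And>t. \<gamma> t = g ** geo_arc b u t"
    by (rule geodesic_is_arc) blast
  have "\<gamma> t = screw g b u t (\<gamma> 0)" for t
    using g by (simp add: \<gamma> screw_def geo_arc_eq_exp_sub_rot matrix_mul_assoc[symmetric])
  then show "\<exists>\<phi>. one_parameter_isometry_subgroup SL2 cc_distance \<phi> \<and> (\<forall>t. \<gamma> t = \<phi> t (\<gamma> 0))"
    using screw_subgroup[OF g u] by blast
qed

end
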